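(* Let $Q$ be the quiver with three vertices $1,2,3$ and three arrows $\alpha\colon 2\to 1$, $\beta\colon 2\to 2$ (a loop), $\gamma\colon 3\to 2$. For every field $k$ there exists an admissible ideal $I\subseteq kQ$ such that the finite dimensional $k$-algebra $\Lambda=kQ/I$ (whose ordinary quiver is $Q$) satisfies $\mathrm{HH}^1(\Lambda)=0$, i.e. every $k$-derivation of $\Lambda$ is inner. Moreover, every algebra $\Lambda=kQ/I$ with $I$ admissible has infinite global dimension, and every such $\Lambda$ with $\mathrm{HH}^1(\Lambda)=0$ is of infinite representation type.
   Context: The path algebra $kQ$ is the $k$-algebra generated by pairwise orthogonal idempotents $e_1,e_2,e_3$ with $e_1+e_2+e_3=1$ and by $\alpha,\beta,\gamma$, subject to $e_1\alpha=\alpha=\alpha e_2$, $e_2\beta=\beta=\beta e_2$, $e_3\gamma=\gamma=\gamma e_2$, $\gamma\alpha=\beta\alpha=\gamma\beta=0$ (so products such as $\alpha\beta^i\gamma$ are nonzero paths). An ideal $I\subseteq kQ$ is admissible if $(\alpha,\beta,\gamma)^N\subseteq I\subseteq(\alpha,\beta,\gamma)^2$ for some $N\ge 2$. For a $k$-algebra $\Lambda$, $\mathrm{HH}^1(\Lambda)=\mathrm{Der}_k(\Lambda,\Lambda)/\mathrm{Inn}(\Lambda)$ is the space of $k$-derivations modulo inner derivations. *)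

theory Defs
  imports "Jordan_Normal_Form.Matrix" "HOL-Algebra.QuotRing"
begin

datatype vert = V1 | V2 | V3
datatype arr = Alpha | Beta | Gamma

fun asrc :: "arr \<Rightarrow> vert" where
  "asrc Alpha = V2" | "asrc Beta = V2" | "asrc Gamma = V3"
fun atgt :: "arr \<Rightarrow> vert" where
  "atgt Alpha = V1" | "atgt Beta = V2" | "atgt Gamma = V2"

text \<open>A path is a trivial path e_v or a nonempty word a1 a2 ... an of arrows
  (written as a product, composed right to left, so that e_{tgt a} a = a = a e_{src a}).\<close>
datatype path = Triv vert | Arrs "arr list"

fun valid_path :: "path \<Rightarrow> bool" where
  "valid_path (Triv v) = True"
| "valid_path (Arrs as) = (as \<noteq> [] \<and> (\<forall>i. i + 1 < length as \<longrightarrow> asrc (as ! i) = atgt (as ! (i + 1))))"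

fun psrc :: "path \<Rightarrow> vert" where
  "psrc (Triv v) = v" | "psrc (Arrs as) = asrc (last as)"
fun ptgt :: "path \<Rightarrow> vert" where
  "ptgt (Triv v) = v" | "ptgt (Arrs as) = atgt (hd as)"
fun plen :: "path \<Rightarrow> nat" where
  "plen (Triv v) = 0" | "plen (Arrs as) = length as"

fun pconcat :: "path \<Rightarrow> path \<Rightarrow> path" where
  "pconcat (Triv v) q = q"
| "pconcat p (Triv v) = p"
| "pconcat (Arrs as) (Arrs bs) = Arrs (as @ bs)"

definition pmul :: "path \<Rightarrow> path \<Rightarrow> path option" where
  "pmul p q = (if psrc p = ptgt q then Some (pconcat p q) else None)"

definition kQ :: "(path \<Rightarrow> 'k::field) ring" where
  "kQ = \<lparr> carrier = {f. (\<forall>p. \<not> valid_path p \<longrightarrow> f p = 0) \<and> finite {p. f p \<noteq> 0}},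
          mult = (\<lambda>f g r. \<Sum>(p, q) \<in> {(p, q). f p \<noteq> 0 \<and> g q \<noteq> 0 \<and> pmul p q = Some r}. f p * g q),
          one = (\<lambda>p. case p of Triv v \<Rightarrow> 1 | Arrs _ \<Rightarrow> 0),
          zero = (\<lambda>p. 0),
          add = (\<lambda>f g p. f p + g p) \<rparr>"

definition arrow_ideal_pow :: "nat \<Rightarrow> (path \<Rightarrow> 'k::field) set" where
  "arrow_ideal_pow m = {f \<in> carrier kQ. \<forall>p. plen p < m \<longrightarrow> f p = 0}"

definition admissible :: "(path \<Rightarrow> 'k::field) set \<Rightarrow> bool" where
  "admissible I \<longleftrightarrow> ideal I kQ \<and>
     (\<exists>N\<ge>2. arrow_ideal_pow N \<subseteq> I \<and> I \<subseteq> arrow_ideal_pow 2)"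

definition Lam :: "(path \<Rightarrow> 'k::field) set \<Rightarrow> (path \<Rightarrow> 'k) set ring" where
  "Lam I = kQ Quot I"

definition Lam_scal :: "(path \<Rightarrow> 'k::field) set \<Rightarrow> 'k \<Rightarrow> (path \<Rightarrow> 'k) set" where
  "Lam_scal I c = I +>\<^bsub>kQ\<^esub> (\<lambda>p. c * one kQ p)"

text \<open>A: ring, sc: structure map k \<rightarrow> A making A a k-algebra (scalar c acts as sc c \<otimes> _).\<close>
definition is_derivation :: "('a, 'b) ring_scheme \<Rightarrow> ('k \<Rightarrow> 'a) \<Rightarrow> ('a \<Rightarrow> 'a) \<Rightarrow> bool" where
  "is_derivation A sc D \<longleftrightarrow> D \<in> carrier A \<rightarrow> carrier A \<and>
     (\<forall>x\<in>carrier A. \<forall>y\<in>carrier A. D (x \<oplus>\<^bsub>A\<^esub> y) = D x \<oplus>\<^bsub>A\<^esub> D y) \<and>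
     (\<forall>c. \<forall>x\<in>carrier A. D (sc c \<otimes>\<^bsub>A\<^esub> x) = sc c \<otimes>\<^bsub>A\<^esub> D x) \<and>
     (\<forall>x\<in>carrier A. \<forall>y\<in>carrier A. D (x \<otimes>\<^bsub>A\<^esub> y) = (D x \<otimes>\<^bsub>A\<^esub> y) \<oplus>\<^bsub>A\<^esub> (x \<otimes>\<^bsub>A\<^esub> D y))"

definition is_inner_derivation :: "('a, 'b) ring_scheme \<Rightarrow> ('a \<Rightarrow> 'a) \<Rightarrow> bool" where
  "is_inner_derivation A D \<longleftrightarrow>
     (\<exists>a\<in>carrier A. \<forall>x\<in>carrier A. D x = (a \<otimes>\<^bsub>A\<^esub> x) \<ominus>\<^bsub>A\<^esub> (x \<otimes>\<^bsub>A\<^esub> a))"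

definition HH1_vanishes :: "('a, 'b) ring_scheme \<Rightarrow> ('k \<Rightarrow> 'a) \<Rightarrow> bool" where
  "HH1_vanishes A sc \<longleftrightarrow> (\<forall>D. is_derivation A sc D \<longrightarrow> is_inner_derivation A D)"

text \<open>A finite dimensional left A-module: (n, rho) with rho : A \<rightarrow> M_n(k) a unital k-algebra map.\<close>
type_synonym ('a, 'k) fdmod = "nat \<times> ('a \<Rightarrow> 'k mat)"

definition is_fdmod :: "('a, 'b) ring_scheme \<Rightarrow> ('k \<Rightarrow> 'a) \<Rightarrow> ('a, 'k::field) fdmod \<Rightarrow> bool" where
  "is_fdmod A sc M \<longleftrightarrow> (let n = fst M; \<rho> = snd M in
     (\<forall>x\<in>carrier A. \<rho> x \<in> carrier_mat n n) \<and> \<rho> \<one>\<^bsub>A\<^esub> = 1\<^sub>m n \<and>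
     (\<forall>x\<in>carrier A. \<forall>y\<in>carrier A. \<rho> (x \<oplus>\<^bsub>A\<^esub> y) = \<rho> x + \<rho> y) \<and>
     (\<forall>x\<in>carrier A. \<forall>y\<in>carrier A. \<rho> (x \<otimes>\<^bsub>A\<^esub> y) = \<rho> x * \<rho> y) \<and>
     (\<forall>c. \<forall>x\<in>carrier A. \<rho> (sc c \<otimes>\<^bsub>A\<^esub> x) = c \<cdot>\<^sub>m \<rho> x))"

definition is_mod_hom :: "('a, 'b) ring_scheme \<Rightarrow> ('a, 'k::field) fdmod \<Rightarrow> ('a, 'k) fdmod \<Rightarrow> 'k mat \<Rightarrow> bool" where
  "is_mod_hom A M N T \<longleftrightarrow> T \<in> carrier_mat (fst N) (fst M) \<and>
     (\<forall>x\<in>carrier A. T * snd M x = snd N x * T)"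

definition mod_iso :: "('a, 'b) ring_scheme \<Rightarrow> ('a, 'k::field) fdmod \<Rightarrow> ('a, 'k) fdmod \<Rightarrow> bool" where
  "mod_iso A M N \<longleftrightarrow> (\<exists>T S. is_mod_hom A M N T \<and> is_mod_hom A N M S \<and>
     S * T = 1\<^sub>m (fst M) \<and> T * S = 1\<^sub>m (fst N))"

definition indecomposable :: "('a, 'b) ring_scheme \<Rightarrow> ('a, 'k::field) fdmod \<Rightarrow> bool" where
  "indecomposable A M \<longleftrightarrow> fst M > 0 \<and>
     (\<forall>E. is_mod_hom A M M E \<and> E * E = E \<longrightarrow> E = 0\<^sub>m (fst M) (fst M) \<or> E = 1\<^sub>m (fst M))"

definition surj_mat :: "'k::field mat \<Rightarrow> bool" where
  "surj_mat T \<longleftrightarrow> (\<forall>v\<in>carrier_vec (dim_row T). \<exists>u\<in>carrier_vec (dim_col T). T *\<^sub>v u = v)"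

definition inj_mat :: "'k::field mat \<Rightarrow> bool" where
  "inj_mat T \<longleftrightarrow> (\<forall>u\<in>carrier_vec (dim_col T). T *\<^sub>v u = 0\<^sub>v (dim_row T) \<longrightarrow> u = 0\<^sub>v (dim_col T))"

definition exact_at :: "'k::field mat \<Rightarrow> 'k mat \<Rightarrow> bool" where
  "exact_at f g \<longleftrightarrow> g * f = 0\<^sub>m (dim_row g) (dim_col f) \<and>
     (\<forall>v\<in>carrier_vec (dim_col g). g *\<^sub>v v = 0\<^sub>v (dim_row g) \<longrightarrow>
        (\<exists>u\<in>carrier_vec (dim_col f). f *\<^sub>v u = v))"

definition is_projective :: "('a, 'b) ring_scheme \<Rightarrow> ('k \<Rightarrow> 'a) \<Rightarrow> ('a, 'k::field) fdmod \<Rightarrow> bool" where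
  "is_projective A sc P \<longleftrightarrow> is_fdmod A sc P \<and>
     (\<forall>M N g f. is_fdmod A sc M \<and> is_fdmod A sc N \<and> is_mod_hom A M N g \<and> surj_mat g \<and>
        is_mod_hom A P N f \<longrightarrow> (\<exists>h. is_mod_hom A P M h \<and> g * h = f))"

text \<open>pd M \<le> n: there is a projective resolution 0 \<rightarrow> P_n \<rightarrow> ... \<rightarrow> P_0 \<rightarrow> M \<rightarrow> 0,
  with d 0 : P_0 \<rightarrow> M the augmentation and d i : P_i \<rightarrow> P_(i-1) for 1 \<le> i \<le> n.\<close>
definition proj_dim_le :: "('a, 'b) ring_scheme \<Rightarrow> ('k \<Rightarrow> 'a) \<Rightarrow> ('a, 'k::field) fdmod \<Rightarrow> nat \<Rightarrow> bool" where
  "proj_dim_le A sc M n \<longleftrightarrow> (\<exists>P d.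
     (\<forall>i\<le>n. is_projective A sc (P i)) \<and>
     is_mod_hom A (P 0) M (d 0) \<and>
     (\<forall>i\<in>{1..n}. is_mod_hom A (P i) (P (i - 1)) (d i)) \<and>
     surj_mat (d 0) \<and>
     (\<forall>i<n. exact_at (d (i + 1)) (d i)) \<and>
     inj_mat (d n))"

definition infinite_global_dimension :: "('a, 'b) ring_scheme \<Rightarrow> ('k::field \<Rightarrow> 'a) \<Rightarrow> bool" where
  "infinite_global_dimension A sc \<longleftrightarrow>
     (\<forall>n. \<exists>M :: ('a, 'k) fdmod. is_fdmod A sc M \<and> \<not> proj_dim_le A sc M n)"

definition infinite_rep_type :: "('a, 'b) ring_scheme \<Rightarrow> ('k::field \<Rightarrow> 'a) \<Rightarrow> bool" where
  "infinite_rep_type A sc \<longleftrightarrow>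
     (\<forall>F :: ('a, 'k) fdmod set. finite F \<longrightarrow>
        (\<exists>M. is_fdmod A sc M \<and> indecomposable A M \<and> (\<forall>N\<in>F. \<not> mod_iso A M N)))"

end

theory Submission
  imports Defs "HOL-Library.Function_Algebras" "HOL-Computational_Algebra.Polynomial"
    "Jordan_Normal_Form.Determinant"
begin

text \<open>Cutting with the idempotents turns \<open>kQ\<close> into a ring of upper triangular matrices over \<open>k[x]\<close>
  (with \<open>x = \<beta>\<close>), and an admissible ideal into three exponents \<open>n, m, l\<close> and a subspace \<open>W\<close> of
  \<open>k[x]\<close>. Up to inner ones, derivations are operators \<open>f \<partial> + g\<close> preserving \<open>W\<close>, so \<open>HH\<^sup>1 = 0\<close> forces
  \<open>m = l = n \<ge> 4\<close>, and it holds for \<open>n = 10\<close> and a suitably rigid \<open>W\<close>.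

  The simple module at the vertex 2 has infinite projective dimension: dividing out the part of a module
  generated at the vertex 3 turns projectives into free modules over \<open>k[x]/(x\<^sup>n)\<close>, on which
  multiplication by \<open>x\<close> and \<open>x\<^sup>n\<^sup>-\<^sup>1\<close> is exact; exactness climbs up a finite resolution, but fails for
  the simple module because \<open>n \<ge> 2\<close>.

  For \<open>n \<ge> 4\<close> the universal cover contains the extended Dynkin quiver \<open>D\<^sub>5\<close> without relations, which
  provides indecomposable modules of dimension \<open>8m\<close> for every \<open>m\<close>.\<close>

section \<open>The path algebra as a triangular matrix ring\<close>

text \<open>The corners at the vertices 1 and 3 are just \<open>k\<close>, so the space
  \<open>W\<close> need not be closed under multiplication by \<open>x\<close>: apart from
  containing all multiples of \<open>x^m\<close> and \<open>x^l\<close> it is an arbitrary subspace.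
  This freedom is the source of rigidity. A derivation normalised to vanish on \<gamma> and to send
  \<beta> to \<open>f\<close> and \<alpha> to \<open>\<alpha>g\<close> acts on \<open>W\<close> as
  \<open>f\<partial> + g\<close>, and for m = l = n it is inner only if \<open>f\<close> is 0 and
  \<open>g\<close> is constant modulo \<open>x^n\<close>. In small characteristic \<partial> loses
  terms, hence \<open>W\<close> is chosen so that the linear equations for \<open>f\<close> and
  \<open>g\<close>, read over the integers, generate the whole lattice.

  For the global dimension the obstacle is l < n: \<open>e_2\<Lambda>e_3\<close> is
  \<open>k[x]/(x^l)\<close>, so the space of a projective at the vertex 2 is not free over
  \<open>k[x]/(x^n)\<close> until the part generated at the vertex 3 is divided out. Dividing it out
  keeps short exact sequences exact only if the coefficients in that part are unique, a
  torsion-freeness that submodules of projectives inherit.\<close>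

declare [[typedef_overloaded]]

text \<open>The matrix with rows (\<open>c1\<close>, \<open>pA\<close>, \<open>pC\<close>), (0,
  \<open>pB\<close>, \<open>pG\<close>), (0, 0, \<open>c3\<close>); its entry in row i and column j
  is the corner \<open>e_i kQ e_j\<close>. As a type with a ring instance it replaces sums over
  pairs of paths by polynomial arithmetic.\<close>

datatype 'k tri = Tri (c1: 'k) (c3: 'k) (pB: "'k poly") (pA: "'k poly") (pG: "'k poly") (pC: "'k poly")

instantiation tri :: (field) ring_1
begin
definition "0 = Tri 0 0 0 0 0 0"
definition "1 = Tri 1 1 1 0 0 0"
definition "s + t = Tri (c1 s + c1 t) (c3 s + c3 t) (pB s + pB t) (pA s + pA t) (pG s + pG t) (pC s + pC t)"
definition "- t = Tri (- c1 t) (- c3 t) (- pB t) (- pA t) (- pG t) (- pC t)"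
definition "s - t = Tri (c1 s - c1 t) (c3 s - c3 t) (pB s - pB t) (pA s - pA t) (pG s - pG t) (pC s - pC t)"
definition "s * t = Tri (c1 s * c1 t) (c3 s * c3 t) (pB s * pB t)
  (Polynomial.smult (c1 s) (pA t) + pA s * pB t)
  (pB s * pG t + Polynomial.smult (c3 t) (pG s))
  (Polynomial.smult (c1 s) (pC t) + pA s * pG t + Polynomial.smult (c3 t) (pC s))"
instance
  by standard (simp_all add: zero_tri_def one_tri_def plus_tri_def uminus_tri_def minus_tri_def
      times_tri_def algebra_simps smult_add_right smult_add_left)
end

lemmas tri_ops = zero_tri_def one_tri_def plus_tri_def uminus_tri_def minus_tri_def times_tri_def

lemma tri_sel [simp]:
  "c1 (0 :: 'k::field tri) = 0" "c3 (0 :: 'k tri) = 0" "pB (0 :: 'k tri) = 0"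
  "pA (0 :: 'k tri) = 0" "pG (0 :: 'k tri) = 0" "pC (0 :: 'k tri) = 0"
  "c1 (1 :: 'k tri) = 1" "c3 (1 :: 'k tri) = 1" "pB (1 :: 'k tri) = 1"
  "pA (1 :: 'k tri) = 0" "pG (1 :: 'k tri) = 0" "pC (1 :: 'k tri) = 0"
  "c1 (s + t) = c1 s + c1 t" "c3 (s + t) = c3 s + c3 t" "pB (s + t) = pB s + pB t"
  "pA (s + t) = pA s + pA t" "pG (s + t) = pG s + pG t" "pC (s + t) = pC s + pC t"
  "c1 (s - t) = c1 s - c1 t" "c3 (s - t) = c3 s - c3 t" "pB (s - t) = pB s - pB t"
  "pA (s - t) = pA s - pA t" "pG (s - t) = pG s - pG t" "pC (s - t) = pC s - pC t"
  "c1 (s * t) = c1 s * c1 t" "c3 (s * t) = c3 s * c3 t" "pB (s * t) = pB s * pB t"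
  "pA (s * t) = Polynomial.smult (c1 s) (pA t) + pA s * pB t"
  "pG (s * t) = pB s * pG t + Polynomial.smult (c3 t) (pG s)"
  "pC (s * t) = Polynomial.smult (c1 s) (pC t) + pA s * pG t + Polynomial.smult (c3 t) (pC s)"
  for s t :: "'k::field tri"
  by (simp_all add: tri_ops)

section \<open>The paths of the quiver and their products\<close>

datatype pidx = I1 | I3 | IB nat | IA nat | IG nat | IC nat

text \<open>\<open>IB 0\<close> stands for \<open>e_2\<close>, so that powers of \<beta>, the
  trivial one included, multiply by adding exponents.\<close>

fun pth :: "pidx \<Rightarrow> path" where
  "pth I1 = Triv V1"
| "pth I3 = Triv V3"
| "pth (IB i) = (if i = 0 then Triv V2 else Arrs (replicate i Beta))"
| "pth (IA i) = Arrs (Alpha # replicate i Beta)"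
| "pth (IG i) = Arrs (replicate i Beta @ [Gamma])"
| "pth (IC i) = Arrs (Alpha # replicate i Beta @ [Gamma])"

fun ilen :: "pidx \<Rightarrow> nat" where
  "ilen I1 = 0" | "ilen I3 = 0" | "ilen (IB i) = i" | "ilen (IA i) = Suc i"
| "ilen (IG i) = Suc i" | "ilen (IC i) = Suc (Suc i)"

lemma plen_pth [simp]: "plen (pth i) = ilen i"
  by (cases i) auto

lemma replicate_Beta_neq [simp]:
  "replicate i Beta \<noteq> Alpha # xs" "replicate i Beta \<noteq> xs @ [Gamma]"
  "replicate i Beta @ [Gamma] \<noteq> Alpha # xs"
  "Alpha # xs \<noteq> replicate i Beta" "xs @ [Gamma] \<noteq> replicate i Beta"
  "Alpha # xs \<noteq> replicate i Beta @ [Gamma]"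
proof -
  show "replicate i Beta \<noteq> Alpha # xs" for xs by (cases i) auto
  then show "Alpha # xs \<noteq> replicate i Beta" for xs by metis
  show "replicate i Beta \<noteq> xs @ [Gamma]" for xs
  proof
    assume "replicate i Beta = xs @ [Gamma]"
    then have "set (replicate i Beta) = set (xs @ [Gamma])" by simp
    then have "Gamma \<in> set (replicate i Beta)" by simp
    then show False by simp
  qed
  then show "xs @ [Gamma] \<noteq> replicate i Beta" for xs by metis
  show "replicate i Beta @ [Gamma] \<noteq> Alpha # xs" for xs by (cases i) auto
  then show "Alpha # xs \<noteq> replicate i Beta @ [Gamma]" for xs by metis
qed

lemma pth_inj [simp]: "pth i = pth j \<longleftrightarrow> i = j"
  by (cases i; cases j) (auto split: if_splits dest: arg_cong[where f = length])

lemma valid_path_Cons2: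
  "valid_path (Arrs (a # b # as)) \<longleftrightarrow> asrc a = atgt b \<and> valid_path (Arrs (b # as))"
  by (force simp: nth_Cons split: nat.splits)

text \<open>No arrow starts at the vertex 1, so \<alpha> can only be the leftmost letter; no arrow
  ends at the vertex 3, so \<gamma> can only be the rightmost one.\<close>

lemma valid_path_Arrs_cases:
  "valid_path (Arrs as) \<Longrightarrow> (\<exists>i. as = replicate (Suc i) Beta) \<or> (\<exists>i. as = Alpha # replicate i Beta) \<or>
    (\<exists>i. as = replicate i Beta @ [Gamma]) \<or> (\<exists>i. as = Alpha # replicate i Beta @ [Gamma])"
proof (induction as)
  case Nil
  then show ?case by simp
next
  case (Cons a as)
  show ?case
  proof (cases as)
    case Nil
    have "[Beta] = replicate (Suc 0) Beta" "[Alpha] = Alpha # replicate 0 Beta"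
      "[Gamma] = replicate 0 Beta @ [Gamma]" by simp_all
    then show ?thesis using Nil by (cases a) metis+
  next
    case (Cons b bs)
    then have v: "asrc a = atgt b" "valid_path (Arrs as)"
      using Cons.prems valid_path_Cons2 by metis+
    have hd: "b = hd as" using Cons by simp
    from Cons.IH[OF v(2)] consider
        i where "as = replicate (Suc i) Beta" | i where "as = Alpha # replicate i Beta"
      | i where "as = replicate i Beta @ [Gamma]" | i where "as = Alpha # replicate i Beta @ [Gamma]"
      by blast
    then show ?thesis
    proof cases
      case (1 i)
      then have "a = Alpha \<or> a = Beta" using v(1) hd by (cases a) auto
      then show ?thesis using 1 by (metis replicate_Suc)
    next
      case (2 i)
      then show ?thesis using v(1) hd by (cases a) auto
    next
      case (3 i)
      then have "atgt b = V2" using hd by (cases i) auto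
      then have "a = Alpha \<or> a = Beta" using v(1) by (cases a) auto
      then show ?thesis using 3 by (metis replicate_Suc append_Cons)
    next
      case (4 i)
      then show ?thesis using v(1) hd by (cases a) auto
    qed
  qed
qed

lemma valid_path_replicate: "valid_path (Arrs (replicate (Suc i) Beta))"
  by (simp del: replicate_Suc)

lemma valid_path_Beta_Gamma: "valid_path (Arrs (replicate i Beta @ [Gamma]))"
proof -
  have "asrc ((replicate i Beta @ [Gamma]) ! j) = atgt ((replicate i Beta @ [Gamma]) ! (j + 1))"
    if "j < i" for j
    using that by (auto simp: nth_append not_less_eq)
  then show ?thesis by simp
qed

lemma valid_path_pth [simp]: "valid_path (pth i)"
proof (cases i)
  case (IB j)
  then show ?thesis using valid_path_replicate[of "j - 1"] by (cases j) auto
next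
  case (IA j)
  have "valid_path (Arrs (Alpha # replicate j Beta))"
  proof (cases j)
    case (Suc l)
    then show ?thesis
      using valid_path_replicate[of l] valid_path_Cons2[of Alpha Beta "replicate l Beta"]
      by (simp del: valid_path.simps)
  qed simp
  then show ?thesis using IA by simp
next
  case (IG j)
  then show ?thesis using valid_path_Beta_Gamma[of j] by simp
next
  case (IC j)
  have "valid_path (Arrs (Alpha # replicate j Beta @ [Gamma]))"
  proof (cases j)
    case (Suc l)
    then show ?thesis
      using valid_path_Beta_Gamma[of j] valid_path_Cons2[of Alpha Beta "replicate l Beta @ [Gamma]"]
      by (simp del: valid_path.simps)
  qed simp
  then show ?thesis using IC by simp
qed auto

lemma valid_path_iff: "valid_path p \<longleftrightarrow> p \<in> range pth"
proof
  assume v: "valid_path p"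
  show "p \<in> range pth"
  proof (cases p)
    case (Triv v)
    then have "p = pth (case v of V1 \<Rightarrow> I1 | V2 \<Rightarrow> IB 0 | V3 \<Rightarrow> I3)" by (cases v) auto
    then show ?thesis by blast
  next
    case (Arrs as)
    then have "(\<exists>i. p = pth (IB (Suc i))) \<or> (\<exists>i. p = pth (IA i)) \<or> (\<exists>i. p = pth (IG i)) \<or> (\<exists>i. p = pth (IC i))"
      using valid_path_Arrs_cases[of as] v by auto
    then show ?thesis by blast
  qed
qed auto

fun imul :: "pidx \<Rightarrow> pidx \<Rightarrow> pidx option" where
  "imul I1 I1 = Some I1"
| "imul I1 (IA i) = Some (IA i)"
| "imul I1 (IC i) = Some (IC i)"
| "imul I3 I3 = Some I3"
| "imul (IB i) (IB j) = Some (IB (i + j))"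
| "imul (IB i) (IG j) = Some (IG (i + j))"
| "imul (IA i) (IB j) = Some (IA (i + j))"
| "imul (IA i) (IG j) = Some (IC (i + j))"
| "imul (IG i) I3 = Some (IG i)"
| "imul (IC i) I3 = Some (IC i)"
| "imul _ _ = None"

text \<open>The factorisations of each path, that is, the index set of the convolution; the families
  over \<open>l \<le> m\<close> become Cauchy products of polynomials.\<close>

lemma imul_eq_Some:
  "imul i j = Some I1 \<longleftrightarrow> i = I1 \<and> j = I1"
  "imul i j = Some I3 \<longleftrightarrow> i = I3 \<and> j = I3"
  "imul i j = Some (IB m) \<longleftrightarrow> (\<exists>l\<le>m. i = IB l \<and> j = IB (m - l))"
  "imul i j = Some (IA m) \<longleftrightarrow> i = I1 \<and> j = IA m \<or> (\<exists>l\<le>m. i = IA l \<and> j = IB (m - l))"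
  "imul i j = Some (IG m) \<longleftrightarrow> i = IG m \<and> j = I3 \<or> (\<exists>l\<le>m. i = IB l \<and> j = IG (m - l))"
  "imul i j = Some (IC m) \<longleftrightarrow> i = I1 \<and> j = IC m \<or> i = IC m \<and> j = I3 \<or>
     (\<exists>l\<le>m. i = IA l \<and> j = IG (m - l))"
  by (cases i; cases j; auto)+

lemma hd_replicate_append: "hd (replicate i x @ ys) = (if i = 0 then hd ys else x)"
  by (cases i) auto

lemma pmul_pth: "pmul (pth i) (pth j) = map_option pth (imul i j)"
  by (cases i; cases j) (auto simp: pmul_def hd_replicate_append replicate_add)

section \<open>The isomorphism between the matrix ring and the path algebra\<close>

fun tcoeff :: "'k::field tri \<Rightarrow> pidx \<Rightarrow> 'k" where
  "tcoeff t I1 = c1 t"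
| "tcoeff t I3 = c3 t"
| "tcoeff t (IB i) = coeff (pB t) i"
| "tcoeff t (IA i) = coeff (pA t) i"
| "tcoeff t (IG i) = coeff (pG t) i"
| "tcoeff t (IC i) = coeff (pC t) i"

definition iota :: "'k::field tri \<Rightarrow> path \<Rightarrow> 'k" where
  "iota t p = (if valid_path p then tcoeff t (inv_into UNIV pth p) else 0)"

lemma inj_pth: "inj pth"
  by (simp add: inj_def)

lemma iota_pth [simp]: "iota t (pth i) = tcoeff t i"
  by (simp add: iota_def inv_f_f[OF inj_pth])

lemma iota_invalid: "\<not> valid_path p \<Longrightarrow> iota t p = 0"
  by (simp add: iota_def)

lemma iota_nonzeroD: "iota t p \<noteq> 0 \<Longrightarrow> \<exists>i. p = pth i \<and> tcoeff t i \<noteq> 0"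
  using iota_invalid valid_path_iff by fastforce

lemma fun_eq_pthI:
  assumes "\<And>p. \<not> valid_path p \<Longrightarrow> f p = 0" "\<And>p. \<not> valid_path p \<Longrightarrow> g p = 0"
    "\<And>i. f (pth i) = g (pth i)"
  shows "f = g"
  using assms valid_path_iff by (metis (no_types, lifting) ext imageE)

lemma finite_tcoeff: "finite {i. tcoeff t i \<noteq> 0}"
proof -
  have "{i. tcoeff t i \<noteq> 0} \<subseteq> {I1, I3} \<union> IB ` {..degree (pB t)} \<union> IA ` {..degree (pA t)}
      \<union> IG ` {..degree (pG t)} \<union> IC ` {..degree (pC t)}"
  proof
    fix i assume "i \<in> {i. tcoeff t i \<noteq> 0}"
    then show "i \<in> {I1, I3} \<union> IB ` {..degree (pB t)} \<union> IA ` {..degree (pA t)}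
      \<union> IG ` {..degree (pG t)} \<union> IC ` {..degree (pC t)}"
      by (cases i) (auto simp: le_degree)
  qed
  then show ?thesis by (rule finite_subset) simp
qed

lemma kQ_sel:
  "carrier kQ = {f. (\<forall>p. \<not> valid_path p \<longrightarrow> f p = 0) \<and> finite {p. f p \<noteq> 0}}"
  "f \<oplus>\<^bsub>kQ\<^esub> g = (\<lambda>p. f p + g p)"
  "\<zero>\<^bsub>kQ\<^esub> = (\<lambda>p. 0)"
  "\<one>\<^bsub>kQ\<^esub> = (\<lambda>p. case p of Triv v \<Rightarrow> 1 | Arrs _ \<Rightarrow> 0)"
  "(f \<otimes>\<^bsub>kQ\<^esub> g) r = (\<Sum>(p, q) \<in> {(p, q). f p \<noteq> 0 \<and> g q \<noteq> 0 \<and> pmul p q = Some r}. f p * g q)"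
  by (simp_all add: kQ_def)

lemma iota_carrier [simp]: "iota t \<in> carrier kQ"
proof -
  have "{p. iota t p \<noteq> 0} \<subseteq> pth ` {i. tcoeff t i \<noteq> 0}"
    using iota_nonzeroD by fastforce
  then have "finite {p. iota t p \<noteq> 0}"
    using finite_tcoeff finite_surj by blast
  then show ?thesis by (simp add: kQ_sel iota_invalid)
qed

lemma tri_eqI: "(\<And>i. tcoeff s i = tcoeff t i) \<Longrightarrow> s = t"
  by (rule tri.expand)
    (metis tcoeff.simps poly_eqI)

lemma iota_inj [simp]: "iota s = iota t \<longleftrightarrow> s = t"
  by (metis iota_pth tri_eqI)

lemma iota_surj: "f \<in> carrier kQ \<Longrightarrow> \<exists>t. f = iota t"
proof -
  assume f: "f \<in> carrier kQ"
  then have fin: "finite {p. f p \<noteq> 0}" by (simp add: kQ_sel)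
  have fin': "finite {i. f (pth i) \<noteq> 0}"
  proof -
    have "finite (pth -` {p. f p \<noteq> 0})" by (rule finite_vimageI[OF fin inj_pth])
    then show ?thesis by (simp add: vimage_def)
  qed
  have cp: "\<exists>q :: 'a poly. \<forall>i. coeff q i = f (pth (h i))" if "inj h" for h :: "nat \<Rightarrow> pidx"
  proof -
    have "finite (h -` {i. f (pth i) \<noteq> 0})" by (rule finite_vimageI[OF fin' that])
    then have "\<forall>\<^sub>\<infinity>i. f (pth (h i)) = 0" by (simp add: vimage_def MOST_iff_cofinite)
    then have "(\<lambda>i. f (pth (h i))) \<in> {g. \<forall>\<^sub>\<infinity>n. g n = 0}" by simp
    then show ?thesis by (metis Abs_poly_inverse)
  qed
  obtain b where b: "\<And>i. coeff b i = f (pth (IB i))" using cp[of IB] by (auto simp: inj_def)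
  obtain a where a: "\<And>i. coeff a i = f (pth (IA i))" using cp[of IA] by (auto simp: inj_def)
  obtain g where g: "\<And>i. coeff g i = f (pth (IG i))" using cp[of IG] by (auto simp: inj_def)
  obtain c where c: "\<And>i. coeff c i = f (pth (IC i))" using cp[of IC] by (auto simp: inj_def)
  have "f = iota (Tri (f (pth I1)) (f (pth I3)) b a g c)"
  proof (rule fun_eq_pthI)
    show "f (pth i) = iota (Tri (f (pth I1)) (f (pth I3)) b a g c) (pth i)" for i
      unfolding iota_pth by (cases i) (simp_all add: a b c g del: pth.simps)
  qed (use f in \<open>auto simp: kQ_sel iota_invalid\<close>)
  then show ?thesis by blast
qed

lemma iota_add: "iota (s + t) = iota s \<oplus>\<^bsub>kQ\<^esub> iota t"
proof (rule fun_eq_pthI)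
  show "iota (s + t) (pth i) = (iota s \<oplus>\<^bsub>kQ\<^esub> iota t) (pth i)" for i
    unfolding kQ_sel iota_pth by (cases i) simp_all
qed (simp_all add: iota_invalid kQ_sel)

lemma iota_zero: "iota 0 = \<zero>\<^bsub>kQ\<^esub>"
proof (rule fun_eq_pthI)
  show "iota 0 (pth i) = \<zero>\<^bsub>kQ\<^esub> (pth i)" for i :: pidx
    unfolding kQ_sel iota_pth by (cases i) simp_all
qed (simp_all add: iota_invalid kQ_sel)

lemma iota_scal: "iota (Tri c c [:c:] 0 0 0) = (\<lambda>p. c * \<one>\<^bsub>kQ\<^esub> p)"
proof (rule fun_eq_pthI)
  show "iota (Tri c c [:c:] 0 0 0) (pth i) = c * \<one>\<^bsub>kQ\<^esub> (pth i)" for i :: pidx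
    unfolding kQ_sel iota_pth by (cases i) (simp_all add: coeff_pCons split: nat.split)
  show "\<not> valid_path p \<Longrightarrow> c * \<one>\<^bsub>kQ\<^esub> p = 0" for p
    by (cases p) (auto simp: kQ_sel)
qed (simp_all add: iota_invalid)

lemma iota_one: "iota 1 = \<one>\<^bsub>kQ\<^esub>"
  using iota_scal[of 1] by (simp add: one_tri_def one_pCons)

lemma sum_imul:
  fixes s t :: "'k::field tri"
  shows "(\<Sum>(i, j)\<in>{(i, j). tcoeff s i \<noteq> 0 \<and> tcoeff t j \<noteq> 0 \<and> imul i j = Some k}. tcoeff s i * tcoeff t j)
    = tcoeff (s * t) k"
proof -
  let ?S = "{(i, j). imul i j = Some k}"
  let ?f = "\<lambda>(i, j). tcoeff s i * tcoeff t j"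
  \<comment> \<open>A path has finitely many factorisations, so the sum makes sense over all of
    them; the support conditions only drop zero terms.\<close>
  have main: "finite ?S \<and> (\<Sum>x\<in>?S. ?f x) = tcoeff (s * t) k"
  proof (cases k)
    case I1
    have "?S = {(I1, I1)}" unfolding I1 by (auto simp: imul_eq_Some)
    then show ?thesis using I1 by simp
  next
    case I3
    have "?S = {(I3, I3)}" unfolding I3 by (auto simp: imul_eq_Some)
    then show ?thesis using I3 by simp
  next
    case (IB m)
    have S: "?S = (\<lambda>i. (IB i, IB (m - i))) ` {..m}"
      unfolding IB by (auto simp: imul_eq_Some)
    have "inj_on (\<lambda>i. (IB i, IB (m - i))) {..m}" by (auto simp: inj_on_def)
    then show ?thesis unfolding S using IB by (simp add: sum.reindex coeff_mult)
  next
    case (IA m)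
    have S: "?S = insert (I1, IA m) ((\<lambda>i. (IA i, IB (m - i))) ` {..m})"
      unfolding IA by (auto simp: imul_eq_Some)
    have "inj_on (\<lambda>i. (IA i, IB (m - i))) {..m}" by (auto simp: inj_on_def)
    moreover have "(I1, IA m) \<notin> (\<lambda>i. (IA i, IB (m - i))) ` {..m}" by auto
    ultimately show ?thesis unfolding S using IA by (simp add: sum.reindex coeff_mult)
  next
    case (IG m)
    have S: "?S = insert (IG m, I3) ((\<lambda>i. (IB i, IG (m - i))) ` {..m})"
      unfolding IG by (auto simp: imul_eq_Some)
    have "inj_on (\<lambda>i. (IB i, IG (m - i))) {..m}" by (auto simp: inj_on_def)
    moreover have "(IG m, I3) \<notin> (\<lambda>i. (IB i, IG (m - i))) ` {..m}" by auto
    ultimately show ?thesis unfolding S using IG by (simp add: sum.reindex coeff_mult)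
  next
    case (IC m)
    have S: "?S = insert (I1, IC m) (insert (IC m, I3) ((\<lambda>i. (IA i, IG (m - i))) ` {..m}))"
      unfolding IC by (auto simp: imul_eq_Some)
    have "inj_on (\<lambda>i. (IA i, IG (m - i))) {..m}" by (auto simp: inj_on_def)
    moreover have "(I1, IC m) \<notin> insert (IC m, I3) ((\<lambda>i. (IA i, IG (m - i))) ` {..m})"
      "(IC m, I3) \<notin> (\<lambda>i. (IA i, IG (m - i))) ` {..m}" by auto
    ultimately show ?thesis unfolding S using IC by (simp add: sum.reindex coeff_mult)
  qed
  have "(\<Sum>(i, j)\<in>{(i, j). tcoeff s i \<noteq> 0 \<and> tcoeff t j \<noteq> 0 \<and> imul i j = Some k}. tcoeff s i * tcoeff t j)
    = (\<Sum>x\<in>?S. ?f x)"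
    by (rule sum.mono_neutral_left) (use main in auto)
  then show ?thesis using main by simp
qed

lemma iota_mult: "iota (s * t) = iota s \<otimes>\<^bsub>kQ\<^esub> iota t"
proof (rule fun_eq_pthI)
  fix p assume p: "\<not> valid_path p"
  show "iota (s * t) p = 0" by (rule iota_invalid[OF p])
  have "pmul q r \<noteq> Some p" if "iota s q \<noteq> 0" "iota t r \<noteq> 0" for q r
    using that p pmul_pth iota_nonzeroD valid_path_pth
    by (metis (no_types, lifting) map_option_eq_Some)
  then have E: "{(q, r). iota s q \<noteq> 0 \<and> iota t r \<noteq> 0 \<and> pmul q r = Some p} = {}" by auto
  show "(iota s \<otimes>\<^bsub>kQ\<^esub> iota t) p = 0"
    unfolding kQ_sel E by simp
next
  fix k
  let ?T = "{(i, j). tcoeff s i \<noteq> 0 \<and> tcoeff t j \<noteq> 0 \<and> imul i j = Some k}"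
  have "{(p, q). iota s p \<noteq> 0 \<and> iota t q \<noteq> 0 \<and> pmul p q = Some (pth k)} = (\<lambda>(i, j). (pth i, pth j)) ` ?T"
    (is "?S = _")
  proof
    show "?S \<subseteq> (\<lambda>(i, j). (pth i, pth j)) ` ?T"
    proof clarify
      fix p q assume pq: "iota s p \<noteq> 0" "iota t q \<noteq> 0" "pmul p q = Some (pth k)"
      obtain i j where "p = pth i" "q = pth j" "tcoeff s i \<noteq> 0" "tcoeff t j \<noteq> 0"
        using pq iota_nonzeroD by metis
      then show "(p, q) \<in> (\<lambda>(i, j). (pth i, pth j)) ` ?T" using pq by (auto simp: pmul_pth)
    qed
    show "(\<lambda>(i, j). (pth i, pth j)) ` ?T \<subseteq> ?S"
      by (auto simp: pmul_pth simp del: pth.simps)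
  qed
  moreover have "inj_on (\<lambda>(i, j). (pth i, pth j)) ?T" by (auto simp: inj_on_def simp del: pth.simps)
  ultimately show "iota (s * t) (pth k) = (iota s \<otimes>\<^bsub>kQ\<^esub> iota t) (pth k)"
    unfolding kQ_sel iota_pth sum_imul[symmetric]
    by (simp add: sum.reindex case_prod_unfold del: pth.simps)
qed

text \<open>The axioms are carried over from \<open>tri\<close> along the bijection
  \<open>iota\<close>; no argument about concatenation of paths is needed for associativity.\<close>

lemma ring_kQ: "ring (kQ :: (path \<Rightarrow> 'k::field) ring)"
proof -
  note surj = iota_surj
  note hom = iota_add[symmetric] iota_mult[symmetric] iota_zero[symmetric] iota_one[symmetric]
  show ?thesis
  proof (rule ringI)
    show "abelian_group (kQ :: (path \<Rightarrow> 'k) ring)"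
    proof (rule abelian_groupI)
      show "\<exists>y\<in>carrier kQ. y \<oplus>\<^bsub>kQ\<^esub> x = \<zero>\<^bsub>kQ\<^esub>" if x: "x \<in> carrier kQ" for x :: "path \<Rightarrow> 'k"
      proof -
        obtain t where t: "x = iota t" using surj[OF x] by blast
        have "iota (- t) \<oplus>\<^bsub>kQ\<^esub> x = \<zero>\<^bsub>kQ\<^esub>" by (simp add: t hom)
        then show ?thesis by (intro bexI[where x = "iota (- t)"]) simp_all
      qed
    qed (auto dest!: surj simp: hom ac_simps)
    show "monoid (kQ :: (path \<Rightarrow> 'k) ring)"
      by (rule monoidI) (auto dest!: surj simp: hom mult.assoc)
  qed (auto dest!: surj simp: hom distrib_left distrib_right)
qed

section \<open>Quotients of the path algebra\<close>

definition jset :: "(path \<Rightarrow> 'k::field) set \<Rightarrow> 'k tri set" where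
  "jset I = {t. iota t \<in> I}"

definition cls :: "(path \<Rightarrow> 'k::field) set \<Rightarrow> 'k tri \<Rightarrow> (path \<Rightarrow> 'k) set" where
  "cls I t = I +>\<^bsub>kQ\<^esub> iota t"

definition scal :: "'k::field \<Rightarrow> 'k tri" where
  "scal c = Tri c c [:c:] 0 0 0"

lemma scal_sel [simp]: "c1 (scal c) = c" "c3 (scal c) = c" "pB (scal c) = [:c:]"
  "pA (scal c) = 0" "pG (scal c) = 0" "pC (scal c) = 0"
  by (simp_all add: scal_def)

lemma Lam_scal_cls: "Lam_scal I c = cls I (scal c)"
  by (simp add: Lam_scal_def cls_def scal_def iota_scal)

definition tri_ideal :: "'k::field tri set \<Rightarrow> bool" where
  "tri_ideal J \<longleftrightarrow> 0 \<in> J \<and> (\<forall>s\<in>J. \<forall>t\<in>J. s + t \<in> J) \<and> (\<forall>s\<in>J. \<forall>t. s * t \<in> J \<and> t * s \<in> J)"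

lemma tri_idealD:
  assumes "tri_ideal J"
  shows "0 \<in> J" "s \<in> J \<Longrightarrow> t \<in> J \<Longrightarrow> s + t \<in> J" "s \<in> J \<Longrightarrow> s * r \<in> J" "s \<in> J \<Longrightarrow> r * s \<in> J"
    "s \<in> J \<Longrightarrow> - s \<in> J" "s \<in> J \<Longrightarrow> t \<in> J \<Longrightarrow> s - t \<in> J"
proof -
  show *: "s \<in> J \<Longrightarrow> - s \<in> J" for s
    using assms unfolding tri_ideal_def by (metis mult_minus1)
  show "0 \<in> J" "s \<in> J \<Longrightarrow> t \<in> J \<Longrightarrow> s + t \<in> J" "s \<in> J \<Longrightarrow> s * r \<in> J" "s \<in> J \<Longrightarrow> r * s \<in> J"
    using assms by (auto simp: tri_ideal_def)
  show "s \<in> J \<Longrightarrow> t \<in> J \<Longrightarrow> s - t \<in> J"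
    using * assms unfolding tri_ideal_def by (metis diff_conv_add_uminus)
qed

lemma iota_minus:
  fixes s t :: "'k::field tri"
  shows "iota (s - t) = iota s \<ominus>\<^bsub>kQ\<^esub> iota t"
proof -
  interpret ring "kQ :: (path \<Rightarrow> 'k) ring" by (rule ring_kQ)
  have "iota (- t) \<oplus>\<^bsub>kQ\<^esub> iota t = \<zero>\<^bsub>kQ\<^esub>"
    by (simp add: iota_add[symmetric] iota_zero[symmetric])
  then have "\<ominus>\<^bsub>kQ\<^esub> iota t = iota (- t)" by (intro minus_equality) simp_all
  then show ?thesis unfolding a_minus_def by (simp add: iota_add[symmetric])
qed

context
  fixes I :: "(path \<Rightarrow> 'k::field) set"
  assumes I: "ideal I kQ"
begin

interpretation I: ideal I "kQ :: (path \<Rightarrow> 'k) ring" by (rule I)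

lemma ring_Lam: "ring (Lam I)"
  unfolding Lam_def by (rule I.quotient_is_ring)

lemma cls_carrier [simp]: "cls I t \<in> carrier (Lam I)"
  unfolding Lam_def cls_def using ring_hom_closed[OF I.rcos_ring_hom] iota_carrier by blast

lemma cls_surj: "X \<in> carrier (Lam I) \<Longrightarrow> \<exists>t. X = cls I t"
  unfolding Lam_def cls_def FactRing_simps using iota_surj by fastforce

lemma cls_add: "cls I (s + t) = cls I s \<oplus>\<^bsub>Lam I\<^esub> cls I t"
  unfolding Lam_def cls_def iota_add
  by (rule ring_hom_add[OF I.rcos_ring_hom]) simp_all

lemma cls_mult: "cls I (s * t) = cls I s \<otimes>\<^bsub>Lam I\<^esub> cls I t"
  unfolding Lam_def cls_def iota_mult
  by (rule ring_hom_mult[OF I.rcos_ring_hom]) simp_all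

lemma cls_one: "cls I 1 = \<one>\<^bsub>Lam I\<^esub>"
  unfolding Lam_def cls_def iota_one
  by (rule ring_hom_one[OF I.rcos_ring_hom])

lemma cls_eq_iff: "cls I s = cls I t \<longleftrightarrow> s - t \<in> jset I"
  unfolding cls_def jset_def
  using I.quotient_eq_iff_same_a_r_cos[OF I iota_carrier[of s] iota_carrier[of t]]
  by (simp add: iota_minus)

lemma cls_minus: "cls I (s - t) = cls I s \<ominus>\<^bsub>Lam I\<^esub> cls I t"
proof -
  interpret L: ring "Lam I" by (rule ring_Lam)
  have "cls I (s - t) \<oplus>\<^bsub>Lam I\<^esub> cls I t = cls I s"
    by (simp add: cls_add[symmetric])
  then show ?thesis
    by (metis L.minus_eq L.a_assoc L.r_neg L.r_zero L.a_inv_closed cls_carrier)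
qed

lemma tri_ideal_jset: "tri_ideal (jset I)"
  unfolding tri_ideal_def jset_def
  by (auto simp: iota_zero iota_add iota_mult intro: I.I_l_closed I.I_r_closed)

text \<open>A derivation upstairs that preserves the ideal descends to the quotient, where it is
  inner; a representative of the inner element then works upstairs up to an error in the
  ideal.\<close>

lemma HH1_vanishesD:
  assumes HH: "HH1_vanishes (Lam I) (Lam_scal I)"
    and add: "\<And>s t. \<delta> (s + t) = \<delta> s + \<delta> t"
    and sc: "\<And>c t. \<delta> (scal c * t) = scal c * \<delta> t"
    and mult: "\<And>s t. \<delta> (s * t) = \<delta> s * t + s * \<delta> t"
    and J: "\<And>t. t \<in> jset I \<Longrightarrow> \<delta> t \<in> jset I"
  shows "\<exists>a. \<forall>t. \<delta> t - (a * t - t * a) \<in> jset I"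
proof -
  define D where "D X = cls I (\<delta> (SOME t. X = cls I t))" for X
  have D: "D (cls I t) = cls I (\<delta> t)" for t
  proof -
    define s where "s = (SOME s. cls I t = cls I s)"
    have "cls I t = cls I s" unfolding s_def by (rule someI[where x = t]) simp
    then have "t - s \<in> jset I" by (simp add: cls_eq_iff)
    then have "\<delta> (t - s) \<in> jset I" by (rule J)
    moreover have "\<delta> (t - s) = \<delta> t - \<delta> s" using add[of "t - s" s] by simp
    ultimately show ?thesis unfolding D_def s_def[symmetric] by (simp add: cls_eq_iff[symmetric])
  qed
  have "is_derivation (Lam I) (Lam_scal I) D"
    unfolding is_derivation_def Lam_scal_cls
  proof (intro conjI ballI allI)
    show "D \<in> carrier (Lam I) \<rightarrow> carrier (Lam I)"
      by (auto dest!: cls_surj simp: D)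
    show "D (cls I (scal c) \<otimes>\<^bsub>Lam I\<^esub> x) = cls I (scal c) \<otimes>\<^bsub>Lam I\<^esub> D x"
      if "x \<in> carrier (Lam I)" for c x
      using cls_surj[OF that] by (auto simp: D cls_mult[symmetric] sc)
  qed (auto dest!: cls_surj simp: D cls_add[symmetric] cls_mult[symmetric] add mult)
  then have "is_inner_derivation (Lam I) D" using HH by (simp add: HH1_vanishes_def)
  then obtain X where X: "X \<in> carrier (Lam I)"
    "\<And>Y. Y \<in> carrier (Lam I) \<Longrightarrow> D Y = (X \<otimes>\<^bsub>Lam I\<^esub> Y) \<ominus>\<^bsub>Lam I\<^esub> (Y \<otimes>\<^bsub>Lam I\<^esub> X)"
    unfolding is_inner_derivation_def by blast
  obtain a where a: "X = cls I a" using cls_surj[OF X(1)] by blast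
  have "cls I (\<delta> t) = cls I (a * t - t * a)" for t
    using X(2)[OF cls_carrier[of t]] by (simp add: D a cls_minus cls_mult)
  then show ?thesis by (auto simp: cls_eq_iff)
qed

text \<open>A derivation of the quotient is lifted by choosing representatives, and such a choice
  need be neither additive nor multiplicative. This is why the laws for \<open>d\<close> are
  congruences modulo the ideal.\<close>

lemma HH1_vanishesI:
  assumes "\<And>d. (\<And>s t. d (s + t) - (d s + d t) \<in> jset I) \<Longrightarrow>
      (\<And>c t. d (scal c * t) - scal c * d t \<in> jset I) \<Longrightarrow>
      (\<And>s t. d (s * t) - (d s * t + s * d t) \<in> jset I) \<Longrightarrow>
      (\<And>t. t \<in> jset I \<Longrightarrow> d t \<in> jset I) \<Longrightarrow> \<exists>a. \<forall>t. d t - (a * t - t * a) \<in> jset I"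
  shows "HH1_vanishes (Lam I) (Lam_scal I)"
  unfolding HH1_vanishes_def
proof (intro allI impI)
  fix D assume D: "is_derivation (Lam I) (Lam_scal I) D"
  define d where "d t = (SOME s. D (cls I t) = cls I s)" for t
  have d: "D (cls I t) = cls I (d t)" for t
  proof -
    have "D (cls I t) \<in> carrier (Lam I)" using D cls_carrier unfolding is_derivation_def by blast
    then show ?thesis unfolding d_def by (metis (mono_tags, lifting) cls_surj someI_ex)
  qed
  have add: "d (s + t) - (d s + d t) \<in> jset I" for s t
    using D cls_carrier unfolding is_derivation_def cls_eq_iff[symmetric]
    by (simp add: d[symmetric] cls_add)
  have sc: "d (scal c * t) - scal c * d t \<in> jset I" for c t
  proof -
    have "D (Lam_scal I c \<otimes>\<^bsub>Lam I\<^esub> cls I t) = Lam_scal I c \<otimes>\<^bsub>Lam I\<^esub> D (cls I t)"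
      using D cls_carrier unfolding is_derivation_def by blast
    then show ?thesis unfolding cls_eq_iff[symmetric] by (simp add: d cls_mult[symmetric] Lam_scal_cls)
  qed
  have mult: "d (s * t) - (d s * t + s * d t) \<in> jset I" for s t
    using D cls_carrier unfolding is_derivation_def cls_eq_iff[symmetric]
    by (simp add: d[symmetric] cls_mult cls_add)
  have J: "d t \<in> jset I" if "t \<in> jset I" for t
  proof -
    have "cls I t = cls I 0" using that by (simp add: cls_eq_iff)
    then have "cls I (d t) = cls I (d 0)" by (metis d)
    then have "d t - d 0 \<in> jset I" by (simp add: cls_eq_iff)
    moreover have "d 0 \<in> jset I" using add[of 0 0] tri_idealD(5)[OF tri_ideal_jset] by fastforce
    ultimately show ?thesis using tri_idealD(2)[OF tri_ideal_jset] by fastforce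
  qed
  obtain a where a: "\<And>t. d t - (a * t - t * a) \<in> jset I" using assms[OF add sc mult J] by blast
  have "D (cls I t) = (cls I a \<otimes>\<^bsub>Lam I\<^esub> cls I t) \<ominus>\<^bsub>Lam I\<^esub> (cls I t \<otimes>\<^bsub>Lam I\<^esub> cls I a)" for t
    using a[of t] by (simp add: d cls_mult[symmetric] cls_minus[symmetric] cls_eq_iff)
  then show "is_inner_derivation (Lam I) D"
    unfolding is_inner_derivation_def using cls_carrier cls_surj by metis
qed

end

section \<open>Admissible ideals\<close>

text \<open>An admissible ideal is given by three exponents and a space of polynomials: its components
  are generated by \<open>\<beta>\<^sup>n\<close>, \<open>\<alpha>\<beta>\<^sup>m\<close> and \<open>\<beta>\<^sup>l\<gamma>\<close>, while \<open>W\<close> records the elements \<open>\<alpha>w(\<beta>)\<gamma>\<close>.\<close>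
definition shape :: "nat \<Rightarrow> nat \<Rightarrow> nat \<Rightarrow> 'k::field poly set \<Rightarrow> 'k tri set" where
  "shape n m l W = {t. c1 t = 0 \<and> c3 t = 0 \<and> monom 1 n dvd pB t \<and> monom 1 m dvd pA t \<and>
     monom 1 l dvd pG t \<and> pC t \<in> W}"

definition lin_closed :: "'k::field poly set \<Rightarrow> bool" where
  "lin_closed W \<longleftrightarrow> 0 \<in> W \<and> (\<forall>p\<in>W. \<forall>q\<in>W. p + q \<in> W) \<and> (\<forall>p\<in>W. \<forall>c. Polynomial.smult c p \<in> W)"

lemma lin_closedD:
  assumes "lin_closed W"
  shows "0 \<in> W" "p \<in> W \<Longrightarrow> q \<in> W \<Longrightarrow> p + q \<in> W" "p \<in> W \<Longrightarrow> Polynomial.smult c p \<in> W"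
    "p \<in> W \<Longrightarrow> - p \<in> W" "p \<in> W \<Longrightarrow> q \<in> W \<Longrightarrow> p - q \<in> W"
proof -
  show *: "p \<in> W \<Longrightarrow> - p \<in> W" for p
    using assms unfolding lin_closed_def by (metis smult_1_left smult_minus_left)
  show "0 \<in> W" "p \<in> W \<Longrightarrow> q \<in> W \<Longrightarrow> p + q \<in> W" "p \<in> W \<Longrightarrow> Polynomial.smult c p \<in> W"
    using assms by (auto simp: lin_closed_def)
  show "p \<in> W \<Longrightarrow> q \<in> W \<Longrightarrow> p - q \<in> W"
    using * assms unfolding lin_closed_def by (metis diff_conv_add_uminus)
qed

text \<open>If an element of \<open>K\<close> had its lowest term in degree i < n, with n the least
  exponent of a power of \<open>x\<close> in \<open>K\<close>, then scaling and shifting it would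
  give \<open>x^(n-1)\<close> plus a multiple of \<open>x^n\<close>, contradicting the choice of
  n.\<close>

lemma poly_ideal_monom:
  fixes K :: "'k::field poly set"
  assumes add: "\<And>p q. p \<in> K \<Longrightarrow> q \<in> K \<Longrightarrow> p + q \<in> K"
    and mult: "\<And>p q. p \<in> K \<Longrightarrow> q * p \<in> K"
    and N: "monom 1 N \<in> K"
  obtains n where "n \<le> N" "\<And>p. p \<in> K \<longleftrightarrow> monom 1 n dvd p"
proof
  define n where "n = (LEAST n. monom 1 n \<in> K)"
  have n: "monom 1 n \<in> K" unfolding n_def by (rule LeastI[of _ N]) (rule N)
  have least: "monom 1 i \<notin> K" if "i < n" for i
    using that not_less_Least unfolding n_def by blast
  show "n \<le> N" unfolding n_def by (rule Least_le) (rule N)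
  show "p \<in> K \<longleftrightarrow> monom 1 n dvd p" for p
  proof
    assume p: "p \<in> K"
    show "monom 1 n dvd p"
    proof (rule ccontr)
      assume nd: "\<not> monom 1 n dvd p"
      define i where "i = (LEAST i. coeff p i \<noteq> 0)"
      have ex: "\<exists>i<n. coeff p i \<noteq> 0" using nd unfolding monom_1_dvd_iff' by blast
      then have i: "coeff p i \<noteq> 0" unfolding i_def by (metis (mono_tags, lifting) LeastI_ex)
      have i_min: "coeff p j = 0" if "j < i" for j using that not_less_Least unfolding i_def by blast
      have "i < n" using ex unfolding i_def by (metis (mono_tags, lifting) Least_le le_less_trans)
      define q where "q = monom (1 / coeff p i) (n - 1 - i) * p"
      have qK: "q \<in> K" unfolding q_def by (rule mult[OF p])
      have "monom 1 n dvd monom 1 (n - 1) - q"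
        unfolding monom_1_dvd_iff' q_def using i i_min \<open>i < n\<close>
        by (auto simp: coeff_monom_mult)
      then obtain r where "monom 1 (n - 1) - q = monom 1 n * r" by (elim dvdE)
      then have "monom 1 (n - 1) = q + r * monom 1 n" by (simp add: algebra_simps)
      then have "monom 1 (n - 1) \<in> K" using add[OF qK mult[OF n]] by simp
      then show False using least[of "n - 1"] \<open>i < n\<close> by simp
    qed
  next
    assume "monom 1 n dvd p"
    then show "p \<in> K" using mult[OF n] by (metis dvd_def mult.commute)
  qed
qed

lemma monom_1_dvd_mono: "m \<le> n \<Longrightarrow> monom 1 n dvd p \<Longrightarrow> monom 1 m dvd (p :: 'k::field poly)"
  by (auto simp: monom_1_dvd_iff')

text \<open>Multiplying by idempotents on both sides splits the ideal into corners. Those at (2,2),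
  (1,2), (2,3) absorb \<open>k[x]\<close> and contain a power of \<open>x\<close>, hence are
  generated by one; the corner (1,3) absorbs only scalars. The lower bounds on the exponents hold
  because \<beta>^n, \<alpha>\<beta>^m and \<beta>^l\<gamma> must have length at least two.\<close>

lemma admissible_shape:
  fixes I :: "(path \<Rightarrow> 'k::field) set"
  assumes "admissible I"
  obtains n m l W where "2 \<le> n" "1 \<le> m" "m \<le> n" "1 \<le> l" "l \<le> n" "lin_closed W"
    "\<And>p. monom 1 m dvd p \<Longrightarrow> p \<in> W" "\<And>p. monom 1 l dvd p \<Longrightarrow> p \<in> W" "jset I = shape n m l W"
proof -
  from assms obtain N where I: "ideal I kQ" and N: "arrow_ideal_pow N \<subseteq> I" "I \<subseteq> arrow_ideal_pow 2"
    unfolding admissible_def by blast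
  let ?J = "jset I"
  note J = tri_idealD[OF tri_ideal_jset[OF I]]
  have deep: "t \<in> ?J" if "\<And>i. ilen i < N \<Longrightarrow> tcoeff t i = 0" for t
  proof -
    have "iota t p = 0" if p: "plen p < N" for p
    proof (rule ccontr)
      assume "iota t p \<noteq> 0"
      then obtain i where "p = pth i" "tcoeff t i \<noteq> 0" using iota_nonzeroD by blast
      then show False using p that[unfolded atomize_all] \<open>\<And>i. ilen i < N \<Longrightarrow> tcoeff t i = 0\<close> by simp
    qed
    then show ?thesis using N(1) unfolding arrow_ideal_pow_def jset_def by auto
  qed
  have low: "tcoeff t i = 0" if "t \<in> ?J" "ilen i < 2" for t i
  proof -
    have "iota t \<in> arrow_ideal_pow 2" using that(1) N(2) unfolding jset_def by blast
    then have "iota t (pth i) = 0"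
      using that(2) unfolding arrow_ideal_pow_def mem_Collect_eq by (metis plen_pth)
    then show ?thesis by simp
  qed
  have deep_monom: "Tri 0 0 (monom 1 N) 0 0 0 \<in> ?J" "Tri 0 0 0 (monom 1 N) 0 0 \<in> ?J"
    "Tri 0 0 0 0 (monom 1 N) 0 \<in> ?J"
    by (rule deep; case_tac i; simp)+
  have e: "Tri 0 0 1 0 0 0 * t * Tri 0 0 1 0 0 0 = Tri 0 0 (pB t) 0 0 0"
    "Tri 1 0 0 0 0 0 * t * Tri 0 0 1 0 0 0 = Tri 0 0 0 (pA t) 0 0"
    "Tri 0 0 1 0 0 0 * t * Tri 0 1 0 0 0 0 = Tri 0 0 0 0 (pG t) 0"
    "Tri 1 0 0 0 0 0 * t * Tri 0 1 0 0 0 0 = Tri 0 0 0 0 0 (pC t)" for t :: "'k tri"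
    by (simp_all add: times_tri_def)
  obtain n where n: "n \<le> N" "\<And>p. p \<in> {p. Tri 0 0 p 0 0 0 \<in> ?J} \<longleftrightarrow> monom 1 n dvd p"
  proof (rule poly_ideal_monom[where K = "{p. Tri 0 0 p 0 0 0 \<in> ?J}" and N = N])
    show "q * p \<in> {p. Tri 0 0 p 0 0 0 \<in> ?J}" if "p \<in> {p. Tri 0 0 p 0 0 0 \<in> ?J}" for p q
      using that J(4)[of "Tri 0 0 p 0 0 0" "Tri 0 0 q 0 0 0"] by (simp add: times_tri_def)
    show "p + q \<in> {p. Tri 0 0 p 0 0 0 \<in> ?J}"
      if "p \<in> {p. Tri 0 0 p 0 0 0 \<in> ?J}" "q \<in> {p. Tri 0 0 p 0 0 0 \<in> ?J}" for p q
      using that J(2)[of "Tri 0 0 p 0 0 0" "Tri 0 0 q 0 0 0"] by (simp add: plus_tri_def)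
  qed (use deep_monom in simp_all)
  obtain m where m: "m \<le> N" "\<And>p. p \<in> {p. Tri 0 0 0 p 0 0 \<in> ?J} \<longleftrightarrow> monom 1 m dvd p"
  proof (rule poly_ideal_monom[where K = "{p. Tri 0 0 0 p 0 0 \<in> ?J}" and N = N])
    show "q * p \<in> {p. Tri 0 0 0 p 0 0 \<in> ?J}" if "p \<in> {p. Tri 0 0 0 p 0 0 \<in> ?J}" for p q
      using that J(3)[of "Tri 0 0 0 p 0 0" "Tri 0 0 q 0 0 0"] by (simp add: times_tri_def mult.commute)
    show "p + q \<in> {p. Tri 0 0 0 p 0 0 \<in> ?J}"
      if "p \<in> {p. Tri 0 0 0 p 0 0 \<in> ?J}" "q \<in> {p. Tri 0 0 0 p 0 0 \<in> ?J}" for p q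
      using that J(2)[of "Tri 0 0 0 p 0 0" "Tri 0 0 0 q 0 0"] by (simp add: plus_tri_def)
  qed (use deep_monom in simp_all)
  obtain l where l: "l \<le> N" "\<And>p. p \<in> {p. Tri 0 0 0 0 p 0 \<in> ?J} \<longleftrightarrow> monom 1 l dvd p"
  proof (rule poly_ideal_monom[where K = "{p. Tri 0 0 0 0 p 0 \<in> ?J}" and N = N])
    show "q * p \<in> {p. Tri 0 0 0 0 p 0 \<in> ?J}" if "p \<in> {p. Tri 0 0 0 0 p 0 \<in> ?J}" for p q
      using that J(4)[of "Tri 0 0 0 0 p 0" "Tri 0 0 q 0 0 0"] by (simp add: times_tri_def)
    show "p + q \<in> {p. Tri 0 0 0 0 p 0 \<in> ?J}"
      if "p \<in> {p. Tri 0 0 0 0 p 0 \<in> ?J}" "q \<in> {p. Tri 0 0 0 0 p 0 \<in> ?J}" for p q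
      using that J(2)[of "Tri 0 0 0 0 p 0" "Tri 0 0 0 0 q 0"] by (simp add: plus_tri_def)
  qed (use deep_monom in simp_all)
  note nml = n(2)[unfolded mem_Collect_eq] m(2)[unfolded mem_Collect_eq] l(2)[unfolded mem_Collect_eq]
  define W where "W = {p. Tri 0 0 0 0 0 p \<in> ?J}"
  have gen: "Tri 0 0 (monom 1 n) 0 0 0 \<in> ?J" "Tri 0 0 0 (monom 1 m) 0 0 \<in> ?J" "Tri 0 0 0 0 (monom 1 l) 0 \<in> ?J"
    using nml by simp_all
  show thesis
  proof
    have "coeff (monom 1 n :: 'k poly) 0 = 0" "coeff (monom 1 n :: 'k poly) 1 = 0"
      using low[OF gen(1), of "IB 0"] low[OF gen(1), of "IB 1"] by simp_all
    then show "2 \<le> n" by (cases n; cases "n - 1") (auto split: if_splits)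
    have "coeff (monom 1 m :: 'k poly) 0 = 0" using low[OF gen(2), of "IA 0"] by simp
    then show "1 \<le> m" by (cases m) auto
    have "coeff (monom 1 l :: 'k poly) 0 = 0" using low[OF gen(3), of "IG 0"] by simp
    then show "1 \<le> l" by (cases l) auto
    \<comment> \<open>With \<beta>^n the ideal contains \<alpha>\<beta>^n and, for the bound on
      \<open>l\<close>, also \<beta>^n\<gamma>.\<close>
    have "Tri 0 0 0 (monom 1 n) 0 0 \<in> ?J"
      using J(4)[OF gen(1), of "Tri 0 0 0 1 0 0"] by (simp add: times_tri_def)
    then have "monom 1 m dvd (monom 1 n :: 'k poly)" using nml by simp
    then show "m \<le> n" by (simp add: monom_1_dvd_iff') (metis linorder_not_le one_neq_zero)
    have "Tri 0 0 0 0 (monom 1 n) 0 \<in> ?J"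
      using J(3)[OF gen(1), of "Tri 0 0 0 0 1 0"] by (simp add: times_tri_def)
    then have "monom 1 l dvd (monom 1 n :: 'k poly)" using nml by simp
    then show "l \<le> n" by (simp add: monom_1_dvd_iff') (metis linorder_not_le one_neq_zero)
    show "lin_closed W" unfolding lin_closed_def W_def mem_Collect_eq
    proof (intro conjI ballI allI)
      show "Tri 0 0 0 0 0 0 \<in> ?J" using J(1) by (simp add: zero_tri_def)
      show "Tri 0 0 0 0 0 (p + q) \<in> ?J"
        if "p \<in> {p. Tri 0 0 0 0 0 p \<in> ?J}" "q \<in> {p. Tri 0 0 0 0 0 p \<in> ?J}" for p q
        using that J(2)[of "Tri 0 0 0 0 0 p" "Tri 0 0 0 0 0 q"] by (simp add: plus_tri_def)
      show "Tri 0 0 0 0 0 (Polynomial.smult c p) \<in> ?J" if "p \<in> {p. Tri 0 0 0 0 0 p \<in> ?J}" for p c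
        using that J(4)[of "Tri 0 0 0 0 0 p" "Tri c 0 0 0 0 0"] by (simp add: times_tri_def)
    qed
    show "p \<in> W" if "monom 1 m dvd p" for p
      using that J(3)[of "Tri 0 0 0 p 0 0" "Tri 0 0 0 0 1 0"] nml by (simp add: times_tri_def W_def)
    show "p \<in> W" if "monom 1 l dvd p" for p
      using that J(4)[of "Tri 0 0 0 0 p 0" "Tri 0 0 0 1 0 0"] nml by (simp add: times_tri_def W_def)
    show "?J = shape n m l W"
    proof (intro equalityI subsetI)
      fix t assume t: "t \<in> ?J"
      have "tcoeff t I1 = 0" "tcoeff t I3 = 0" by (rule low[OF t]; simp)+
      then show "t \<in> shape n m l W"
        unfolding shape_def W_def using nml J(3)[OF J(4)[OF t]] e[of t] by (simp, metis)
    next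
      fix t assume t: "t \<in> shape n m l W"
      have "t = Tri 0 0 (pB t) 0 0 0 + Tri 0 0 0 (pA t) 0 0 + Tri 0 0 0 0 (pG t) 0 + Tri 0 0 0 0 0 (pC t)"
        using t by (cases t) (simp add: shape_def plus_tri_def)
      moreover have "\<dots> \<in> ?J"
        using t nml unfolding shape_def W_def by (intro J(2)) simp_all
      ultimately show "t \<in> ?J" by simp
    qed
  qed
qed

lemma tri_ideal_shape:
  assumes W: "lin_closed W" and le: "m \<le> n" "l \<le> n"
    and mW: "\<And>p. monom 1 m dvd p \<Longrightarrow> p \<in> W" and lW: "\<And>p. monom 1 l dvd p \<Longrightarrow> p \<in> W"
  shows "tri_ideal (shape n m l W)"
proof -
  note lin = lin_closedD[OF W]
  show ?thesis
    unfolding tri_ideal_def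
  proof (intro conjI ballI allI)
    show "0 \<in> shape n m l W" using lin by (simp add: shape_def)
    fix s assume s: "s \<in> shape n m l W"
    show "s + t \<in> shape n m l W" if "t \<in> shape n m l W" for t
      using s that lin by (simp add: shape_def)
    show "s * t \<in> shape n m l W" for t
    proof -
      have "monom 1 l dvd pB s" using s le by (auto simp: shape_def intro: monom_1_dvd_mono)
      then show ?thesis
        using s mW[of "pA s * pG t"] lin(2,3) by (auto simp: shape_def intro!: dvd_add dvd_smult)
    qed
    show "t * s \<in> shape n m l W" for t
    proof -
      have "monom 1 m dvd pB s" using s le by (auto simp: shape_def intro: monom_1_dvd_mono)
      then show ?thesis
        using s lW[of "pA t * pG s"] lin(2,3) by (auto simp: shape_def intro!: dvd_add dvd_smult)
    qed
  qed
qed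

lemma jset_image [simp]: "jset (iota ` S) = S"
  by (auto simp: jset_def)

lemma ideal_iota_image:
  fixes S :: "'k::field tri set"
  assumes "tri_ideal S"
  shows "ideal (iota ` S) kQ"
proof -
  note S = tri_idealD[OF assms]
  interpret ring "kQ :: (path \<Rightarrow> 'k) ring" by (rule ring_kQ)
  show ?thesis
  proof (rule idealI)
    have inv: "\<ominus>\<^bsub>kQ\<^esub> iota t = iota (- t)" for t :: "'k tri"
      by (rule minus_equality) (simp_all add: iota_add[symmetric] iota_zero[symmetric])
    show "subgroup (iota ` S) (add_monoid kQ)"
      by (rule add.subgroupI) (use S in \<open>auto simp: iota_add[symmetric] inv\<close>)
  qed (auto dest!: iota_surj simp: iota_mult[symmetric] S ring_kQ)
qed

lemma admissible_iota_shape: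
  fixes W :: "'k::field poly set"
  assumes W: "lin_closed W" and n: "2 \<le> n" and nW: "\<And>p. monom 1 n dvd p \<Longrightarrow> p \<in> W"
  shows "admissible (iota ` shape n n n W)"
  unfolding admissible_def
proof (intro conjI exI)
  show "ideal (iota ` shape n n n W) kQ"
    by (rule ideal_iota_image, rule tri_ideal_shape) (use assms in auto)
  \<comment> \<open>A path of length n + 2 contains at least n loops, since \<alpha> and \<gamma>
    occur at most once each.\<close>
  show "2 \<le> n + 2" by simp
  show "arrow_ideal_pow (n + 2) \<subseteq> iota ` shape n n n W"
  proof
    fix f :: "path \<Rightarrow> 'k" assume f: "f \<in> arrow_ideal_pow (n + 2)"
    then obtain t where t: "f = iota t" using iota_surj unfolding arrow_ideal_pow_def by blast
    have z: "tcoeff t i = 0" if "ilen i < n + 2" for i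
      using f that unfolding arrow_ideal_pow_def t
      by (metis (mono_tags, lifting) iota_pth mem_Collect_eq plen_pth)
    have "t \<in> shape n n n W"
      unfolding shape_def monom_1_dvd_iff'
      using z[of I1] z[of I3] z[of "IB _"] z[of "IA _"] z[of "IG _"] z[of "IC _"] nW[of "pC t"]
      by (auto simp: monom_1_dvd_iff')
    then show "f \<in> iota ` shape n n n W" using t by blast
  qed
  show "iota ` shape n n n W \<subseteq> arrow_ideal_pow 2"
  proof clarify
    fix t assume t: "t \<in> shape n n n W"
    have "tcoeff t i = 0" if "ilen i < 2" for i
      using t that n unfolding shape_def monom_1_dvd_iff' by (cases i) auto
    then show "iota t \<in> arrow_ideal_pow 2"
      unfolding arrow_ideal_pow_def using iota_nonzeroD by fastforce
  qed
qed

section \<open>Derivations of the quotients\<close>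

text \<open>The derivation with \<beta> \<mapsto> \<open>f\<close> (evaluated at \<beta>) and
  \<alpha> \<mapsto> \<open>\<alpha>g\<close> that vanishes on \<gamma> and on the
  idempotents.\<close>

definition der :: "'k::field poly \<Rightarrow> 'k poly \<Rightarrow> 'k tri \<Rightarrow> 'k tri" where
  "der f g t = Tri 0 0 (f * pderiv (pB t)) (f * pderiv (pA t) + pA t * g) (f * pderiv (pG t))
     (f * pderiv (pC t) + g * pC t)"

lemma der_sel [simp]: "c1 (der f g t) = 0" "c3 (der f g t) = 0" "pB (der f g t) = f * pderiv (pB t)"
  "pA (der f g t) = f * pderiv (pA t) + pA t * g" "pG (der f g t) = f * pderiv (pG t)"
  "pC (der f g t) = f * pderiv (pC t) + g * pC t"
  by (simp_all add: der_def)

lemma der_add: "der f g (s + t) = der f g s + der f g t"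
  by (rule tri.expand) (simp add: pderiv_add algebra_simps)

lemma der_mult: "der f g (s * t) = der f g s * t + s * der f g t"
  by (rule tri.expand) (simp add: pderiv_add pderiv_mult pderiv_smult algebra_simps smult_add_right)

lemma der_scal: "der f g (scal c * t) = scal c * der f g t"
proof -
  have "der f g (scal c) = 0" by (rule tri.expand) simp
  then show ?thesis by (simp add: der_mult)
qed

text \<open>The commutator of \<open>a\<close> with \<beta> has no component in the corner (2,2), as
  \<open>k[x]\<close> is commutative. With \<alpha> and \<gamma> it produces the factors
  \<open>c1 a - pB a\<close> and \<open>pB a - c3 a\<close>; adding the two congruences eliminates
  \<open>pB a\<close> and leaves a constant.\<close>

lemma HH1_vanishes_shape:
  fixes I :: "(path \<Rightarrow> 'k::field) set"
  assumes I: "ideal I kQ" and HH: "HH1_vanishes (Lam I) (Lam_scal I)"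
    and J: "jset I = shape n m l W"
    and pres: "\<And>t. t \<in> shape n m l W \<Longrightarrow> der f g t \<in> shape n m l W"
  shows "monom 1 n dvd f" "\<exists>c. monom 1 (min m l) dvd g - [:c:]"
proof -
  obtain a where a: "\<And>t. der f g t - (a * t - t * a) \<in> shape n m l W"
    using HH1_vanishesD[OF I HH der_add der_scal der_mult pres[folded J]] J by auto
  have "monom 1 n dvd f"
    using a[of "Tri 0 0 [:0, 1:] 0 0 0"] by (simp add: shape_def pderiv_pCons mult.commute)
  then show "monom 1 n dvd f" .
  have A: "monom 1 m dvd g - ([:c1 a:] - pB a)"
    using a[of "Tri 0 0 0 1 0 0"] by (simp add: shape_def)
  have G: "monom 1 l dvd pB a - [:c3 a:]"
    using a[of "Tri 0 0 0 0 1 0"] by (simp add: shape_def) (metis dvd_minus_iff minus_diff_eq)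
  have "monom 1 (min m l) dvd (g - ([:c1 a:] - pB a)) - (pB a - [:c3 a:])"
    by (rule dvd_diff) (rule monom_1_dvd_mono[OF _ A] monom_1_dvd_mono[OF _ G], simp)+
  also have "(g - ([:c1 a:] - pB a)) - (pB a - [:c3 a:]) = g - [:c1 a - c3 a:]"
    by (simp add: algebra_simps)
  finally show "\<exists>c. monom 1 (min m l) dvd g - [:c:]" by blast
qed

text \<open>As f(0) = 0, the operator \<open>f\<partial>\<close> is a multiple of the Euler operator
  \<open>x\<partial>\<close>, which is diagonal on monomials.\<close>

lemma monom_dvd_mult_pderiv:
  fixes f :: "'k::field poly"
  assumes "coeff f 0 = 0" "monom 1 n dvd b"
  shows "monom 1 n dvd f * pderiv b"
proof -
  obtain q where q: "f = [:0, 1:] * q" using assms(1) by (cases f) (auto simp: mult.commute)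
  have "coeff ([:0, 1:] * pderiv b) k = of_nat k * coeff b k" for k
    by (cases k) (simp_all add: coeff_pderiv)
  then have "monom 1 n dvd [:0, 1:] * pderiv b" using assms(2) by (simp add: monom_1_dvd_iff')
  then have "monom 1 n dvd q * ([:0, 1:] * pderiv b)" by (rule dvd_mult)
  then show ?thesis by (simp add: q ac_simps)
qed

text \<open>If \<open>m\<close> or \<open>l\<close> is below \<open>n\<close>, then \<open>W\<close>
  contains every multiple of \<open>x^(n-1)\<close>, so the derivation \<beta> \<mapsto>
  \<beta>^(n-1) preserves the ideal whatever \<open>W\<close> is. It is not inner, because
  \<beta>^(n-1) survives in the quotient.\<close>

lemma HH1_exponents_eq:
  fixes I :: "(path \<Rightarrow> 'k::field) set"
  assumes I: "ideal I kQ" and HH: "HH1_vanishes (Lam I) (Lam_scal I)"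
    and J: "jset I = shape n m l W" and n: "2 \<le> n" "m \<le> n" "l \<le> n"
    and mW: "\<And>p. monom 1 m dvd p \<Longrightarrow> p \<in> W" and lW: "\<And>p. monom 1 l dvd p \<Longrightarrow> p \<in> W"
  shows "m = n \<and> l = n"
proof (rule ccontr)
  assume neq: "\<not> (m = n \<and> l = n)"
  have W: "monom 1 (n - 1) * q \<in> W" for q
  proof -
    have dvd: "monom 1 (n - 1) dvd monom 1 (n - 1) * q" by (rule dvd_triv_left)
    have "m \<le> n - 1 \<or> l \<le> n - 1" using neq n by auto
    then show ?thesis
    proof
      assume "m \<le> n - 1"
      then show ?thesis by (intro mW monom_1_dvd_mono[OF _ dvd])
    next
      assume "l \<le> n - 1"
      then show ?thesis by (intro lW monom_1_dvd_mono[OF _ dvd])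
    qed
  qed
  have "monom 1 n dvd (monom 1 (n - 1) :: 'k poly)"
  proof (rule HH1_vanishes_shape(1)[OF I HH J])
    fix t assume t: "t \<in> shape n m l W"
    have "coeff (monom 1 (n - 1) :: 'k poly) 0 = 0" using n by simp
    note dvd = monom_dvd_mult_pderiv[OF this]
    show "der (monom 1 (n - 1)) 0 t \<in> shape n m l W"
      using t W[of "pderiv (pC t)"] dvd[of n "pB t"] dvd[of m "pA t"] dvd[of l "pG t"]
      by (simp only: shape_def der_sel mem_Collect_eq mult_zero_left mult_zero_right add_0_right simp_thms)
  qed
  then have "\<forall>k<n. coeff (monom 1 (n - 1) :: 'k poly) k = 0" by (simp only: monom_1_dvd_iff')
  moreover have "n - 1 < n" using n by simp
  ultimately have "coeff (monom 1 (n - 1) :: 'k poly) (n - 1) = 0" by blast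
  then show False by simp
qed

section \<open>Outer derivations for nilpotency degree two and three\<close>

lemma monom_1_dvd_small:
  "monom 1 2 dvd p \<longleftrightarrow> coeff p 0 = 0 \<and> coeff p (Suc 0) = 0"
  "monom 1 3 dvd p \<longleftrightarrow> coeff p 0 = 0 \<and> coeff p (Suc 0) = 0 \<and> coeff p (Suc (Suc 0)) = 0" for p :: "'k::field poly"
  by (auto simp: monom_1_dvd_iff' numeral_eq_Suc less_Suc_eq)

lemma coeff_mult_small:
  "coeff (p * q) 0 = coeff p 0 * coeff q 0"
  "coeff (p * q) (Suc 0) = coeff p 0 * coeff q (Suc 0) + coeff p (Suc 0) * coeff q 0"
  "coeff (p * q) (Suc (Suc 0)) = coeff p 0 * coeff q (Suc (Suc 0)) + coeff p (Suc 0) * coeff q (Suc 0) + coeff p (Suc (Suc 0)) * coeff q 0"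
  for p q :: "'k::field poly"
  by (simp_all add: coeff_mult)

text \<open>On \<open>k[x]/(x\<^sup>n)\<close> with \<open>n \<le> 3\<close> the operators \<open>f \<partial> + g\<close> outnumber the conditions for
  preserving a subspace.\<close>
lemma stabiliser_nontrivial:
  fixes W :: "'k::field poly set"
  assumes n: "n = 2 \<or> n = 3" and lin: "lin_closed W" and nW: "\<And>p. monom 1 n dvd p \<Longrightarrow> p \<in> W"
  obtains f g where "coeff f 0 = 0" "\<And>w. w \<in> W \<Longrightarrow> f * pderiv w + g * w \<in> W"
    "\<not> (monom 1 n dvd f \<and> (\<exists>c. monom 1 n dvd g - [:c:]))"
proof -
  note W = lin_closedD[OF lin]
  have mod: "p \<in> W" if "w \<in> W" "monom 1 n dvd p - w" for p w
    using W(2)[OF that(1) nW[OF that(2)]] by simp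
  note d = monom_1_dvd_small coeff_mult_small coeff_pderiv
  consider (two) "n = 2" | (three) "n = 3" using n by blast
  then show thesis
  proof cases
    case two
    show thesis
    proof (cases "[:0, 1:] \<in> W")
      case True
      \<comment> \<open>Modulo \<open>x^2\<close>, multiplication by \<open>x\<close> maps
        everything to multiples of \<open>x\<close>, which lie in \<open>W\<close>. The case of
        \<open>x^2\<close> below is the same.\<close>
      show thesis
      proof (rule that[of 0 "[:0, 1:]"])
        show "0 * pderiv w + [:0, 1:] * w \<in> W" for w
          by (rule mod[OF W(3)[OF True, of "coeff w 0"]]) (simp add: two d)
      qed (simp_all add: two d)
    next
      case False
      have *: "coeff w (Suc 0) = 0" if "w \<in> W" "coeff w 0 = 0" for w
      proof (rule ccontr)
        assume nz: "coeff w (Suc 0) \<noteq> 0"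
        have "[:0, 1:] \<in> W"
          by (rule mod[OF W(3)[OF that(1), of "1 / coeff w (Suc 0)"]]) (use that nz in \<open>simp add: two d\<close>)
        then show False using False by blast
      qed
      have "\<exists>x. \<forall>w\<in>W. coeff w (Suc 0) = x * coeff w 0"
      proof (cases "\<exists>u\<in>W. coeff u 0 \<noteq> 0")
        case True
        then obtain u where u: "u \<in> W" "coeff u 0 \<noteq> 0" by blast
        have "coeff w (Suc 0) = coeff u (Suc 0) / coeff u 0 * coeff w 0" if "w \<in> W" for w
          using *[OF W(5)[OF that W(3)[OF u(1), of "coeff w 0 / coeff u 0"]]] u(2) by (simp add: field_simps)
        then show ?thesis by blast
      qed (use * in auto)
      then obtain x where x: "\<And>w. w \<in> W \<Longrightarrow> coeff w (Suc 0) = x * coeff w 0" by blast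
      \<comment> \<open>Modulo \<open>x^2\<close>, \<open>W\<close> lies on the line through 1 + cx,
        where c is the constant just obtained; this line is annihilated by
        \<open>x\<partial> - cx\<close>.\<close>
      show thesis
      proof (rule that[of "[:0, 1:]" "[:0, - x:]"])
        show "[:0, 1:] * pderiv w + [:0, - x:] * w \<in> W" if "w \<in> W" for w
          by (rule nW) (use x[OF that] in \<open>simp add: two d\<close>)
      qed (simp_all add: two d)
    qed
  next
    case three
    show thesis
    proof (cases "[:0, 0, 1:] \<in> W")
      case True
      show thesis
      proof (rule that[of 0 "[:0, 0, 1:]"])
        show "0 * pderiv w + [:0, 0, 1:] * w \<in> W" for w
          by (rule mod[OF W(3)[OF True, of "coeff w 0"]]) (simp add: three d)
      qed (simp_all add: three d)
    next
      case F: False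
      have *: "coeff w (Suc (Suc 0)) = 0" if "w \<in> W" "coeff w 0 = 0" "coeff w (Suc 0) = 0" for w
      proof (rule ccontr)
        assume nz: "coeff w (Suc (Suc 0)) \<noteq> 0"
        have "[:0, 0, 1:] \<in> W"
          by (rule mod[OF W(3)[OF that(1), of "1 / coeff w (Suc (Suc 0))"]])
            (use that nz in \<open>simp add: three d\<close>)
        then show False using F by blast
      qed
      show thesis
      proof (cases "\<exists>a b. (a \<noteq> 0 \<or> b \<noteq> 0) \<and> (\<forall>w\<in>W. a * coeff w 0 + b * coeff w (Suc 0) = 0)")
        case True
        then obtain a b where ab: "a \<noteq> 0 \<or> b \<noteq> 0" "\<And>w. w \<in> W \<Longrightarrow> a * coeff w 0 + b * coeff w (Suc 0) = 0"
          by blast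
        \<comment> \<open>The operator sends w to \<open>(a w_0 + b w_1) x^2\<close> modulo
          \<open>x^3\<close>, which vanishes by the linear relation.\<close>
        show thesis
        proof (rule that[of "[:0, 0, b:]" "[:0, 0, a:]"])
          show "[:0, 0, b:] * pderiv w + [:0, 0, a:] * w \<in> W" if "w \<in> W" for w
            by (rule nW) (use ab(2)[OF that] in \<open>simp add: three d add.commute\<close>)
        qed (use ab in \<open>auto simp: three d\<close>)
      next
        case False
        then have nd: "\<exists>w\<in>W. a * coeff w 0 + b * coeff w (Suc 0) \<noteq> 0" if "a \<noteq> 0 \<or> b \<noteq> 0" for a b
          using that by blast
        \<comment> \<open>Without a linear relation the two lowest coefficients take arbitrary
          values on \<open>W\<close>. Elimination yields \<open>v\<close> in \<open>W\<close> with
          \<open>v = x + c x^2\<close> modulo \<open>x^3\<close>.\<close>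
        obtain p0 where p0: "p0 \<in> W" "coeff p0 (Suc 0) \<noteq> 0" using nd[of 0 1] by auto
        define p where "p = Polynomial.smult (1 / coeff p0 (Suc 0)) p0"
        have p: "p \<in> W" "coeff p (Suc 0) = 1" unfolding p_def using p0 W(3) by auto
        obtain q where q: "q \<in> W" "coeff q 0 - coeff p 0 * coeff q (Suc 0) \<noteq> 0"
          using nd[of 1 "- coeff p 0"] by auto
        define u where "u = Polynomial.smult (1 / (coeff q 0 - coeff p 0 * coeff q (Suc 0)))
            (q - Polynomial.smult (coeff q (Suc 0)) p)"
        have u: "u \<in> W" "coeff u 0 = 1" "coeff u (Suc 0) = 0"
          unfolding u_def using p q by (auto intro!: W(3,5) simp: mult.commute)
        define v where "v = p - Polynomial.smult (coeff p 0) u"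
        have v: "v \<in> W" "coeff v 0 = 0" "coeff v (Suc 0) = 1"
          unfolding v_def using p u by (auto intro!: W(3,5))
        \<comment> \<open>Modulo \<open>x^3\<close> the contributions of \<open>w_1\<close> cancel
          and w is sent to \<open>w_0 v\<close>.\<close>
        show thesis
        proof (rule that[of "[:0, 0, - 1:]" "[:0, 1, coeff v (Suc (Suc 0)):]"])
          show "[:0, 0, - 1:] * pderiv w + [:0, 1, coeff v (Suc (Suc 0)):] * w \<in> W" if "w \<in> W" for w
            by (rule mod[OF W(3)[OF v(1), of "coeff w 0"]])
              (use v in \<open>simp add: three d\<close>)
        qed (auto simp: three d)
      qed
    qed
  qed
qed

lemma HH1_vanishes_exponents:
  fixes I :: "(path \<Rightarrow> 'k::field) set"
  assumes adm: "admissible I" and HH: "HH1_vanishes (Lam I) (Lam_scal I)"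
  obtains n W where "4 \<le> n" "jset I = shape n n n W" "lin_closed W" "\<And>p. monom 1 n dvd p \<Longrightarrow> p \<in> W"
proof -
  have I: "ideal I kQ" using adm by (simp add: admissible_def)
  obtain n m l W where *: "2 \<le> n" "m \<le> n" "l \<le> n" "lin_closed W"
    "\<And>p. monom 1 m dvd p \<Longrightarrow> p \<in> W" "\<And>p. monom 1 l dvd p \<Longrightarrow> p \<in> W" "jset I = shape n m l W"
    using admissible_shape[OF adm] by metis
  have ml: "m = n" "l = n" using HH1_exponents_eq[OF I HH *(7,1,2,3,5,6)] by auto
  note J = *(7)[unfolded ml] and nW = *(5)[unfolded ml]
  have "\<not> n \<le> 3"
  proof
    assume "n \<le> 3"
    then have "n = 2 \<or> n = 3" using *(1) by auto
    then obtain f g where fg: "coeff f 0 = 0" "\<And>w. w \<in> W \<Longrightarrow> f * pderiv w + g * w \<in> W"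
      "\<not> (monom 1 n dvd f \<and> (\<exists>c. monom 1 n dvd g - [:c:]))"
      using stabiliser_nontrivial[OF _ *(4) nW] by metis
    have "der f g t \<in> shape n n n W" if "t \<in> shape n n n W" for t
      using that fg(2) by (auto simp: shape_def intro!: dvd_add monom_dvd_mult_pderiv[OF fg(1)])
    from HH1_vanishes_shape[OF I HH J this] show False using fg(3) by auto
  qed
  then show thesis using that[of n W] J * nW by auto
qed

section \<open>An admissible ideal with vanishing first Hochschild cohomology\<close>

definition der_mod :: "'k::field tri set \<Rightarrow> ('k tri \<Rightarrow> 'k tri) \<Rightarrow> bool" where
  "der_mod J d \<longleftrightarrow> (\<forall>s t. d (s + t) - (d s + d t) \<in> J) \<and> (\<forall>c t. d (scal c * t) - scal c * d t \<in> J) \<and>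
     (\<forall>s t. d (s * t) - (d s * t + s * d t) \<in> J) \<and> (\<forall>t\<in>J. d t \<in> J)"

lemma scal_central: "scal c * t = t * scal c"
  by (rule tri.expand) simp

lemma der_mod_diff_inner:
  assumes J: "tri_ideal J" and d: "der_mod J d"
  shows "der_mod J (\<lambda>t. d t - (a * t - t * a))"
  unfolding der_mod_def
proof (intro conjI allI ballI)
  fix s t c
  have "d (s + t) - (a * (s + t) - (s + t) * a) - (d s - (a * s - s * a) + (d t - (a * t - t * a)))
    = d (s + t) - (d s + d t)" by (simp add: algebra_simps)
  moreover have "d (s + t) - (d s + d t) \<in> J" using d unfolding der_mod_def by blast
  ultimately show "d (s + t) - (a * (s + t) - (s + t) * a) - (d s - (a * s - s * a) + (d t - (a * t - t * a))) \<in> J"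
    by (simp only:)
  have "a * (scal c * t) = scal c * (a * t)" by (metis mult.assoc scal_central)
  then have "d (scal c * t) - (a * (scal c * t) - scal c * t * a) - scal c * (d t - (a * t - t * a))
    = d (scal c * t) - scal c * d t" by (simp add: algebra_simps)
  moreover have "d (scal c * t) - scal c * d t \<in> J" using d unfolding der_mod_def by blast
  ultimately show "d (scal c * t) - (a * (scal c * t) - scal c * t * a) - scal c * (d t - (a * t - t * a)) \<in> J"
    by (simp only:)
  have "d (s * t) - (a * (s * t) - s * t * a) - ((d s - (a * s - s * a)) * t + s * (d t - (a * t - t * a)))
    = d (s * t) - (d s * t + s * d t)" by (simp add: algebra_simps)
  moreover have "d (s * t) - (d s * t + s * d t) \<in> J" using d unfolding der_mod_def by blast
  ultimately show "d (s * t) - (a * (s * t) - s * t * a) - ((d s - (a * s - s * a)) * t + s * (d t - (a * t - t * a))) \<in> J"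
    by (simp only:)
next
  fix t assume "t \<in> J"
  then show "d t - (a * t - t * a) \<in> J"
    using d tri_idealD[OF J] by (simp add: der_mod_def)
qed

abbreviation "te1 \<equiv> Tri 1 0 0 0 0 0"
abbreviation "te2 \<equiv> Tri 0 0 1 0 0 0"
abbreviation "te3 \<equiv> Tri 0 1 0 0 0 0"
abbreviation "ta \<equiv> Tri 0 0 0 1 0 0"
abbreviation "tb \<equiv> Tri 0 0 [:0, 1:] 0 0 0"
abbreviation "tg \<equiv> Tri 0 0 0 0 1 0"

lemma tri_sum_decomp: "t = scal (c1 t) * te1 + scal (c3 t) * te3 + Tri 0 0 (pB t) 0 0 0
    + ta * Tri 0 0 (pA t) 0 0 0 + Tri 0 0 (pG t) 0 0 0 * tg + ta * Tri 0 0 (pC t) 0 0 0 * tg"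
  by (rule tri.expand) simp

lemma tri_gen_induct:
  fixes P :: "'k::field tri \<Rightarrow> bool"
  assumes add: "\<And>s t. P s \<Longrightarrow> P t \<Longrightarrow> P (s + t)" and mult: "\<And>s t. P s \<Longrightarrow> P t \<Longrightarrow> P (s * t)"
    and sc: "\<And>c t. P t \<Longrightarrow> P (scal c * t)"
    and gen: "P te1" "P te2" "P te3" "P ta" "P tb" "P tg"
  shows "P t"
proof -
  have B: "P (Tri 0 0 p 0 0 0)" for p
  proof (induction p)
    case 0
    have "Tri 0 0 0 0 0 0 = scal (0 :: 'k) * te2" by (rule tri.expand) simp
    then show ?case using sc[OF gen(2), of 0] by (simp only:)
  next
    case (pCons a p)
    have "Tri 0 0 (pCons a p) 0 0 0 = scal a * te2 + tb * Tri 0 0 p 0 0 0"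
      by (rule tri.expand) simp
    then show ?case using add[OF sc[OF gen(2)] mult[OF gen(5) pCons(2)]] by (simp only:)
  qed
  show ?thesis
    by (subst tri_sum_decomp) (intro add mult sc gen B)
qed

text \<open>Two inner corrections suffice. The first makes the derivation vanish on the idempotents,
  so that every arrow stays in its own corner. The second, by h(\<beta>) in the corner (2,2),
  commutes with \<beta> and moves the value on \<gamma> over to \<alpha>.\<close>

lemma der_mod_normal_form:
  assumes J: "tri_ideal J" and d: "der_mod J d"
  shows "\<exists>a f g. \<forall>t. d t - (a * t - t * a) - der f g t \<in> J"
proof -
  note i = tri_idealD[OF J]
  \<comment> \<open>For an exact derivation and an idempotent e of the three,
    \<open>e d(e_i) e_i = d(e e_i) e_i - d(e) e_i\<close>; summing over i gives
    \<open>[a0, e] = d(e)\<close>.\<close>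
  define a0 where "a0 = d te1 * te1 + d te2 * te2 + d te3 * te3"
  have "d (0 + 0) - (d 0 + d 0) \<in> J" using d unfolding der_mod_def by blast
  then have d0: "d 0 \<in> J" using i(5) by fastforce
  have M: "d (s * t) - (d s * t + s * d t) \<in> J" for s t using d unfolding der_mod_def by blast
  define d1 where "d1 t = d t - (a0 * t - t * a0)" for t
  have d1: "der_mod J d1" unfolding d1_def by (rule der_mod_diff_inner[OF J d])
  have one: "te1 + te2 + te3 = (1 :: 'a tri)" by (rule tri.expand) simp
  have id: "te1 * te1 = (te1 :: 'a tri)" "te1 * te2 = (0 :: 'a tri)" "te1 * te3 = (0 :: 'a tri)"
    "te2 * te1 = (0 :: 'a tri)" "te2 * te2 = (te2 :: 'a tri)" "te2 * te3 = (0 :: 'a tri)"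
    "te3 * te1 = (0 :: 'a tri)" "te3 * te2 = (0 :: 'a tri)" "te3 * te3 = (te3 :: 'a tri)"
    by (simp_all add: times_tri_def zero_tri_def)
  have split: "x = x * te1 + x * te2 + x * te3" for x :: "'a tri"
    using one by (metis distrib_left mult.right_neutral)
  have step: "d e - (a0 * e - e * a0) \<in> J"
    if e: "(e * te1 = e \<and> e * te2 = 0 \<and> e * te3 = 0 \<and> e = te1) \<or> (e * te1 = 0 \<and> e * te2 = e \<and> e * te3 = 0 \<and> e = te2)
      \<or> (e * te1 = 0 \<and> e * te2 = 0 \<and> e * te3 = e \<and> e = te3)" for e
  proof -
    have k: "(d (e * t) - (d e * t + e * d t)) * t \<in> J" for t by (rule i(3)[OF M])
    have S: "(d (e * te1) - (d e * te1 + e * d te1)) * te1 + (d (e * te2) - (d e * te2 + e * d te2)) * te2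
      + (d (e * te3) - (d e * te3 + e * d te3)) * te3 \<in> J" by (intro i(2) k)
    have E: "(d (e * te1) - (d e * te1 + e * d te1)) * te1 + (d (e * te2) - (d e * te2 + e * d te2)) * te2
      + (d (e * te3) - (d e * te3 + e * d te3)) * te3
      = (d (e * te1) * te1 + d (e * te2) * te2 + d (e * te3) * te3) - (d e * te1 + d e * te2 + d e * te3) - e * a0"
      unfolding a0_def by (simp add: algebra_simps id)
    have A: "a0 * e = d e * e" using e unfolding a0_def by (auto simp: distrib_right mult.assoc id)
    have "(d (e * te1) * te1 + d (e * te2) * te2 + d (e * te3) * te3) - d e * e \<in> J"
      using e by (auto simp: id intro!: i(1,2,3) d0)
    from i(6)[OF this S[unfolded E split[symmetric]]] show ?thesis by (simp add: A algebra_simps)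
  qed
  have e1: "d1 te1 \<in> J" "d1 te2 \<in> J" "d1 te3 \<in> J"
    unfolding d1_def by (rule step; simp add: id)+
  \<comment> \<open>Expanding D on \<open>x = e x e'\<close>, all terms with \<open>D e\<close> or
    \<open>D e'\<close> lie in the ideal.\<close>
  have corner: "D x - e * D x * e' \<in> J"
    if D: "der_mod J D" and "D e \<in> J" "D e' \<in> J" "e * x = x" "x * e' = x" for D e e' x
  proof -
    have 1: "D (e * x) - (D e * x + e * D x) \<in> J" "D (x * e') - (D x * e' + x * D e') \<in> J"
      using D unfolding der_mod_def by blast+
    have "e * (D (x * e') - (D x * e' + x * D e')) + (D (e * x) - (D e * x + e * D x)) + D e * x + e * x * D e' \<in> J"
      by (intro i(2,3,4) 1 that)
    also have "e * (D (x * e') - (D x * e' + x * D e')) + (D (e * x) - (D e * x + e * D x)) + D e * x + e * x * D e'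
      = D (e * x) + e * D (x * e') - e * D x - e * D x * e'" by (simp add: algebra_simps)
    finally show ?thesis using that by simp
  qed
  define h where "h = pG (d1 tg)"
  define f where "f = pB (d1 tb)"
  define g where "g = pA (d1 ta)"
  define H where "H = Tri 0 0 h 0 0 0"
  define d2 where "d2 t = d1 t - (H * t - t * H)" for t
  have d2: "der_mod J d2" unfolding d2_def by (rule der_mod_diff_inner[OF J d1])
  have c: "d1 tb - Tri 0 0 f 0 0 0 \<in> J" "d1 ta - Tri 0 0 0 g 0 0 \<in> J" "d1 tg - Tri 0 0 0 0 h 0 \<in> J"
    using corner[OF d1 e1(2) e1(2), of tb] corner[OF d1 e1(1) e1(2), of ta] corner[OF d1 e1(2) e1(3), of tg]
    by (simp_all add: times_tri_def f_def g_def h_def)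
  have "H * te1 - te1 * H = 0" "H * te2 - te2 * H = 0" "H * te3 - te3 * H = 0" "H * tb - tb * H = 0"
    "H * ta - ta * H = Tri 0 0 0 (- h) 0 0" "H * tg - tg * H = Tri 0 0 0 0 h 0"
    by (simp_all add: H_def tri_ops mult.commute)
  then have g2: "d2 te1 \<in> J" "d2 te2 \<in> J" "d2 te3 \<in> J" "d2 tb - Tri 0 0 f 0 0 0 \<in> J"
    "d2 ta - Tri 0 0 0 (g + h) 0 0 \<in> J" "d2 tg \<in> J"
    using e1 c by (simp_all add: d2_def minus_tri_def algebra_simps)
  have der_e: "der f (g + h) te1 = 0" "der f (g + h) te2 = 0" "der f (g + h) te3 = 0"
    "der f (g + h) tb = Tri 0 0 f 0 0 0" "der f (g + h) ta = Tri 0 0 0 (g + h) 0 0" "der f (g + h) tg = 0"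
    by (simp_all add: der_def zero_tri_def pderiv_pCons)
  have "d2 t - der f (g + h) t \<in> J" for t
  proof (induction t rule: tri_gen_induct)
    case (1 s t)
    have "d2 (s + t) - (d2 s + d2 t) \<in> J" using d2 unfolding der_mod_def by blast
    from i(2)[OF this i(2)[OF 1]] show ?case by (simp add: der_add algebra_simps)
  next
    case (2 s t)
    have "d2 (s * t) - (d2 s * t + s * d2 t) \<in> J" using d2 unfolding der_mod_def by blast
    from i(2)[OF this i(2)[OF i(3)[OF 2(1)] i(4)[OF 2(2)]], of t s] show ?case
      by (simp add: der_mult algebra_simps)
  next
    case (3 c t)
    have "d2 (scal c * t) - scal c * d2 t \<in> J" using d2 unfolding der_mod_def by blast
    from i(2)[OF this i(4)[OF 3, of "scal c"]] show ?case by (simp add: der_scal algebra_simps)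
  qed (use g2 in \<open>simp_all add: der_e\<close>)
  then have "d t - ((a0 + H) * t - t * (a0 + H)) - der f (g + h) t \<in> J" for t
    by (simp add: d2_def d1_def algebra_simps)
  then show ?thesis by blast
qed

text \<open>Modulo \<open>x\<^sup>1\<^sup>0\<close> this is the span of \<open>1\<close>, \<open>x\<close> and \<open>v = x\<^sup>3 + x\<^sup>5 + x\<^sup>6\<close>. The vectors \<open>v'\<close>, \<open>xv'\<close>,
  \<open>vv'\<close>, \<open>xv - x\<^sup>2v'\<close> and \<open>v\<^sup>2 - xvv'\<close> are linearly independent modulo this span in every characteristic,
  which makes its stabiliser trivial.\<close>
definition rigid :: "'k::field poly set" where
  "rigid = {p. coeff p 2 = 0 \<and> coeff p 4 = 0 \<and> coeff p 5 = coeff p 3 \<and> coeff p 6 = coeff p 3 \<and>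
     coeff p 7 = 0 \<and> coeff p 8 = 0 \<and> coeff p 9 = 0}"

lemma all_less_10: "(\<forall>k<(10::nat). P k) \<longleftrightarrow> P 9 \<and> P 8 \<and> P 7 \<and> P 6 \<and> P 5 \<and> P 4 \<and> P 3 \<and> P 2 \<and> P 1 \<and> P 0"
  by (simp add: numeral_eq_Suc All_less_Suc)

lemma coeff_pCons_numeral: "coeff (pCons a p) (numeral w) = coeff p (pred_numeral w)"
  by (simp add: numeral_eq_Suc)

lemma lin_closed_rigid: "lin_closed rigid"
  by (simp add: lin_closed_def rigid_def)

lemma monom_dvd_rigid: "monom 1 10 dvd p \<Longrightarrow> p \<in> rigid"
  by (simp add: monom_1_dvd_iff' all_less_10 rigid_def)

text \<open>The space is tested on its generators 1, x and v. The tests on 1 and x express all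
  coefficients of \<open>f\<close> and \<open>g\<close> below degree 10 through
  \<open>coeff g 0\<close> and five unknowns; the test on v gives seven linear equations in the five
  unknowns, from which \<open>coeff g 0\<close> cancels because scalars always stabilise.\<close>

lemma rigid_stabiliser:
  fixes f g :: "'k::field poly"
  assumes st: "\<And>w. w \<in> rigid \<Longrightarrow> f * pderiv w + g * w \<in> rigid"
  shows "monom 1 10 dvd f" "monom 1 10 dvd g - [:coeff g 0:]"
proof -
  define v :: "'k poly" where "v = [:0, 0, 0, 1, 0, 1, 1:]"
  have v: "v \<in> rigid" "pderiv v = [:0, 0, 3, 0, 5, 6:]"
    by (simp_all add: v_def rigid_def pderiv_pCons coeff_pCons_numeral)
  have "1 \<in> rigid" by (simp add: rigid_def)
  from st[OF this] have g: "g \<in> rigid" by simp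
  have x: "[:0, 1:] \<in> rigid" by (simp add: rigid_def coeff_pCons_numeral)
  have f: "f + pCons 0 g \<in> rigid" using st[OF x] by (simp add: pderiv_pCons)
  have fv: "f * [:0, 0, 3, 0, 5, 6:] + g * v \<in> rigid" using st[OF v(1)] by (simp add: v(2))
  define s t r p q where "s = coeff f 0" and "t = coeff f (Suc 0)" and "r = coeff f 3" and "p = coeff g (Suc 0)"
    and "q = coeff g 3"
  have G: "coeff g (Suc 0) = p" "coeff g 2 = 0" "coeff g 3 = q" "coeff g 4 = 0" "coeff g 5 = q" "coeff g 6 = q"
    "coeff g 7 = 0" "coeff g 8 = 0" "coeff g 9 = 0"
    using g by (simp_all add: rigid_def p_def q_def)
  have F: "coeff f 0 = s" "coeff f (Suc 0) = t" "coeff f 2 = - p" "coeff f 3 = r" "coeff f 4 = - q" "coeff f 5 = r"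
    "coeff f 6 = r - q" "coeff f 7 = - q" "coeff f 8 = 0" "coeff f 9 = 0"
    using f G by (simp_all add: rigid_def coeff_pCons_numeral s_def t_def r_def algebra_simps eq_neg_iff_add_eq_0)
  define R where "R = f * [:0, 0, 3, 0, 5, 6:] + g * v"
  have R: "coeff R 2 = 3 * s" "coeff R 3 = 3 * t + coeff g 0" "coeff R 4 = 5 * s - 3 * p + p"
    "coeff R 5 = 3 * r + 5 * t + 6 * s + coeff g 0"
    "coeff R 6 = - 3 * q - 5 * p + 6 * t + q + p + coeff g 0"
    "coeff R 7 = 3 * r + 5 * r - 6 * p + p"
    "coeff R 8 = 3 * (r - q) - 5 * q + 6 * r + q + q" "coeff R 9 = - 3 * q + 5 * r - 6 * q + q + q"
    unfolding R_def v_def by (simp_all add: coeff_pCons_numeral F G)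
  have R': "coeff R 2 = 0" "coeff R 4 = 0" "coeff R 5 = coeff R 3" "coeff R 6 = coeff R 3"
    "coeff R 7 = 0" "coeff R 8 = 0" "coeff R 9 = 0"
    using fv unfolding R_def[symmetric] by (simp_all add: rigid_def)
  have E: "3 * s = 0" "5 * s - 2 * p = 0" "2 * t + 6 * s + 3 * r = 0" "3 * t - 4 * p - 2 * q = 0"
    "8 * r - 5 * p = 0" "9 * r - 6 * q = 0" "5 * r - 7 * q = 0"
    using R' unfolding R by (simp_all add: algebra_simps)
  text \<open>These seven integer relations generate all of \<open>\<int>\<^sup>5\<close>, so they force \<open>s, t, r, p, q\<close> to
    vanish in every characteristic.\<close>
  have
    "s = 1370 * (3 * s) - 577 * (5 * s - 2 * p) - 204 * (2 * t + 6 * s + 3 * r) + 136 * (3 * t - 4 * p - 2 * q)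
      + 122 * (8 * r - 5 * p) - 36 * (9 * r - 6 * q) - 8 * (5 * r - 7 * q)"
    "t = 749 * (3 * s) - 315 * (5 * s - 2 * p) - 112 * (2 * t + 6 * s + 3 * r) + 75 * (3 * t - 4 * p - 2 * q)
      + 66 * (8 * r - 5 * p) - 18 * (9 * r - 6 * q) - 6 * (5 * r - 7 * q)"
    "r = - 500 * (3 * s) + 210 * (5 * s - 2 * p) + 75 * (2 * t + 6 * s + 3 * r) - 50 * (3 * t - 4 * p - 2 * q)
      - 44 * (8 * r - 5 * p) + 12 * (9 * r - 6 * q) + 4 * (5 * r - 7 * q)"
    "p = - 684 * (3 * s) + 288 * (5 * s - 2 * p) + 102 * (2 * t + 6 * s + 3 * r) - 68 * (3 * t - 4 * p - 2 * q)
      - 61 * (8 * r - 5 * p) + 18 * (9 * r - 6 * q) + 4 * (5 * r - 7 * q)"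
    "q = - 1126 * (3 * s) + 474 * (5 * s - 2 * p) + 168 * (2 * t + 6 * s + 3 * r) - 112 * (3 * t - 4 * p - 2 * q)
      - 100 * (8 * r - 5 * p) + 29 * (9 * r - 6 * q) + 7 * (5 * r - 7 * q)"
    by (simp_all add: algebra_simps)
  then have z: "s = 0" "t = 0" "r = 0" "p = 0" "q = 0" unfolding E by simp_all
  show "monom 1 10 dvd f" "monom 1 10 dvd g - [:coeff g 0:]"
    using z F G by (simp_all add: monom_1_dvd_iff' all_less_10 coeff_pCons_numeral)
qed

theorem HH1_vanishes_rigid:
  "HH1_vanishes (Lam (iota ` shape 10 10 10 rigid)) (Lam_scal (iota ` shape 10 10 10 (rigid :: 'k::field poly set)))"
proof -
  let ?J = "shape 10 10 10 (rigid :: 'k poly set)"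
  have J: "tri_ideal ?J"
    by (rule tri_ideal_shape) (simp_all add: lin_closed_rigid monom_dvd_rigid)
  note i = tri_idealD[OF J]
  show ?thesis
  proof (rule HH1_vanishesI[OF ideal_iota_image[OF J]], unfold jset_image)
    fix d assume "\<And>s t. d (s + t) - (d s + d t) \<in> ?J" "\<And>c t. d (scal c * t) - scal c * d t \<in> ?J"
      "\<And>s t. d (s * t) - (d s * t + s * d t) \<in> ?J" "\<And>t. t \<in> ?J \<Longrightarrow> d t \<in> ?J"
    then have d: "der_mod ?J d" unfolding der_mod_def by blast
    obtain a f g where a: "\<And>t. d t - (a * t - t * a) - der f g t \<in> ?J"
      using der_mod_normal_form[OF J d] by blast
    have pres: "der f g t \<in> ?J" if "t \<in> ?J" for t
    proof -
      have "d t - (a * t - t * a) \<in> ?J"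
        using der_mod_diff_inner[OF J d, of a] that unfolding der_mod_def by blast
      from i(6)[OF this a[of t]] show ?thesis by simp
    qed
    have "f * pderiv w + g * w \<in> rigid" if "w \<in> rigid" for w
      using pres[of "Tri 0 0 0 0 0 w"] that by (simp add: shape_def)
    note fg = rigid_stabiliser[OF this]
    \<comment> \<open>The commutator with a multiple of \<open>e_1\<close> scales \<alpha> and every
      \<alpha>w(\<beta>)\<gamma> by that factor, which is what remains of \<open>der f g\<close>
      modulo the ideal.\<close>
    let ?k = "Tri (coeff g 0) 0 0 0 0 0"
    have "der f g t - (?k * t - t * ?k) \<in> ?J" for t
    proof -
      have A: "monom 1 10 dvd f * p + q * (g - [:coeff g 0:])" for p q
        using fg by (intro dvd_add dvd_mult dvd_mult2) auto
      have "f * p + q * (g - [:coeff g 0:]) = f * p + q * g - Polynomial.smult (coeff g 0) q" for p q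
        by (simp add: algebra_simps)
      note A' = A[unfolded this]
      show ?thesis
        using A'[of "pderiv (pA t)" "pA t"] A'[of "pderiv (pC t)" "pC t"] fg(1)
        by (simp add: shape_def monom_dvd_rigid mult.commute)
    qed
    then have "d t - ((a + ?k) * t - t * (a + ?k)) \<in> ?J" for t
      using i(2)[OF a[of t], of "der f g t - (?k * t - t * ?k)"] by (simp add: algebra_simps)
    then show "\<exists>a. \<forall>t. d t - (a * t - t * a) \<in> ?J" by blast
  qed
qed

section \<open>Modules as operators on coordinate functions\<close>

text \<open>A vector of length \<open>n\<close> is modelled by a function \<open>nat \<Rightarrow> 'k\<close> vanishing from \<open>n\<close> on; these form
  an additive group in the type class sense, unlike the vectors and matrices of fixed carrier.\<close>

definition fspace :: "nat \<Rightarrow> (nat \<Rightarrow> 'k::field) set" where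
  "fspace n = {f. \<forall>i\<ge>n. f i = 0}"

definition scl :: "'k::field \<Rightarrow> (nat \<Rightarrow> 'k) \<Rightarrow> nat \<Rightarrow> 'k" where
  "scl c f = (\<lambda>i. c * f i)"

definition flin :: "((nat \<Rightarrow> 'k::field) \<Rightarrow> nat \<Rightarrow> 'k) \<Rightarrow> bool" where
  "flin L \<longleftrightarrow> (\<forall>f g. L (f + g) = L f + L g) \<and> (\<forall>c f. L (scl c f) = scl c (L f))"

definition act :: "'k::field mat \<Rightarrow> (nat \<Rightarrow> 'k) \<Rightarrow> nat \<Rightarrow> 'k" where
  "act A f = (\<lambda>i. if i < dim_row A then \<Sum>j<dim_col A. A $$ (i, j) * f j else 0)"

definition funit :: "nat \<Rightarrow> nat \<Rightarrow> 'k::field" where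
  "funit j = (\<lambda>i. if i = j then 1 else 0)"

definition mat_of :: "nat \<Rightarrow> nat \<Rightarrow> ((nat \<Rightarrow> 'k::field) \<Rightarrow> nat \<Rightarrow> 'k) \<Rightarrow> 'k mat" where
  "mat_of n m L = mat n m (\<lambda>(i, j). L (funit j) i)"

lemma scl_apply: "scl c f i = c * f i"
  by (simp add: scl_def)

lemmas fun_app = plus_fun_apply zero_fun_apply scl_apply minus_apply uminus_apply

text \<open>Induction leaves function-valued terms eta-expanded, and the simplifier would then rewrite them
  pointwise below the abstraction.\<close>
declare fun_app [simp del]

lemma scl_simps [simp]: "scl 1 f = f" "scl 0 f = 0" "scl c 0 = 0" "scl c (scl d f) = scl (c * d) f"
  by (auto simp: fun_eq_iff fun_app)

lemma scl_distrib: "scl c (f + g) = scl c f + scl c g" "scl (c + d) f = scl c f + scl d f"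
  by (auto simp: fun_eq_iff fun_app algebra_simps)

lemma flinD:
  assumes "flin L"
  shows "L (f + g) = L f + L g" "L (scl c f) = scl c (L f)" "L 0 = 0"
proof -
  show *: "L (f + g) = L f + L g" "L (scl c f) = scl c (L f)" for f g c
    using assms by (auto simp: flin_def)
  show z: "L 0 = 0" using *(2)[of 0 0] by simp
qed

lemma flin_diff:
  assumes "flin L"
  shows "L (f - g) = L f - L g"
  using flinD(1)[OF assms, of "f - g" g] by simp

lemma flin_sum:
  assumes L: "flin L"
  shows "L (\<Sum>j\<in>S. h j) = (\<Sum>j\<in>S. L (h j))"
  by (induction S rule: infinite_finite_induct) (simp_all add: flinD[OF L])

lemma flin_pow: "flin L \<Longrightarrow> flin (L ^^ i)"
  by (induction i) (auto simp: flin_def)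

lemma fspaceI: "(\<And>i. n \<le> i \<Longrightarrow> f i = 0) \<Longrightarrow> f \<in> fspace n"
  by (simp add: fspace_def)

lemma fspace_closed [simp]:
  "0 \<in> fspace n" "f \<in> fspace n \<Longrightarrow> g \<in> fspace n \<Longrightarrow> f + g \<in> fspace n"
  "f \<in> fspace n \<Longrightarrow> scl c f \<in> fspace n" "f \<in> fspace n \<Longrightarrow> - f \<in> fspace n"
  "f \<in> fspace n \<Longrightarrow> g \<in> fspace n \<Longrightarrow> f - g \<in> fspace n"
  by (auto simp: fspace_def fun_app)

lemma funit_fspace [simp]: "j < n \<Longrightarrow> funit j \<in> fspace n"
  by (auto simp: fspace_def funit_def)

lemma flin_act: "flin (act A)"
  by (auto simp: flin_def act_def fun_eq_iff sum.distrib distrib_left sum_distrib_left mult.left_commute fun_app)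

lemma act_fspace: "A \<in> carrier_mat n m \<Longrightarrow> act A f \<in> fspace n"
  by (auto simp: fspace_def act_def)

lemma act_mult:
  assumes "A \<in> carrier_mat n m" "B \<in> carrier_mat m k"
  shows "act (A * B) f = act A (act B f)"
proof
  fix i
  show "act (A * B) f i = act A (act B f) i"
  proof (cases "i < n")
    case True
    have "act (A * B) f i = (\<Sum>j<k. \<Sum>l<m. A $$ (i, l) * B $$ (l, j) * f j)"
      using assms True by (simp add: act_def scalar_prod_def sum_distrib_right atLeast0LessThan)
    also have "\<dots> = (\<Sum>l<m. \<Sum>j<k. A $$ (i, l) * B $$ (l, j) * f j)" by (rule sum.swap)
    also have "\<dots> = act A (act B f) i"
      using assms True by (simp add: act_def sum_distrib_left mult.assoc)
    finally show ?thesis .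
  qed (use assms in \<open>simp add: act_def\<close>)
qed

lemma act_plus:
  assumes "A \<in> carrier_mat n m" "B \<in> carrier_mat n m"
  shows "act (A + B) f = act A f + act B f"
  using assms by (auto simp: act_def fun_eq_iff distrib_right sum.distrib fun_app)

lemma act_smult: "act (c \<cdot>\<^sub>m A) f = scl c (act A f)"
  by (auto simp: act_def fun_eq_iff sum_distrib_left ac_simps fun_app)

lemma act_one: "f \<in> fspace n \<Longrightarrow> act (1\<^sub>m n) f = f"
proof
  fix i assume f: "f \<in> fspace n"
  have "(\<Sum>j<n. 1\<^sub>m n $$ (i, j) * f j) = (\<Sum>j<n. if j = i then f j else 0)" if "i < n"
    by (rule sum.cong) (use that in auto)
  then show "act (1\<^sub>m n) f i = f i" using f by (auto simp: act_def fspace_def)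
qed

lemma act_zero: "act (0\<^sub>m n m) f = 0"
  by (auto simp: act_def fun_eq_iff fun_app)

lemma act_funit:
  "A \<in> carrier_mat n m \<Longrightarrow> j < m \<Longrightarrow> i < n \<Longrightarrow> act A (funit j) i = A $$ (i, j)"
  by (auto simp: act_def funit_def sum.delta if_distrib cong: if_cong)

lemma mat_eq_actI:
  assumes "A \<in> carrier_mat n m" "B \<in> carrier_mat n m" "\<And>f. f \<in> fspace m \<Longrightarrow> act A f = act B f"
  shows "A = B"
  using assms by (intro eq_matI) (auto simp flip: act_funit)

lemma mat_of_carrier [simp]: "mat_of n m L \<in> carrier_mat n m"
  by (simp add: mat_of_def)

lemma fspace_expand: "f \<in> fspace m \<Longrightarrow> f = (\<Sum>j<m. scl (f j) (funit j))"
proof -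
  assume f: "f \<in> fspace m"
  have "(\<Sum>j\<in>S. h j) i = (\<Sum>j\<in>S. h j i)" for S :: "nat set" and h :: "nat \<Rightarrow> nat \<Rightarrow> 'a" and i
    by (induction S rule: infinite_finite_induct) (auto simp: fun_app)
  then show ?thesis
    using f by (auto simp: fun_eq_iff funit_def fspace_def fun_app if_distrib cong: if_cong)
qed

lemma act_mat_of:
  assumes L: "flin L" and f: "f \<in> fspace m" and Lf: "\<And>h. h \<in> fspace m \<Longrightarrow> L h \<in> fspace n"
  shows "act (mat_of n m L) f = L f"
proof
  fix i
  have app: "(\<Sum>j\<in>S. h j) i = (\<Sum>j\<in>S. h j i)" for S :: "nat set" and h :: "nat \<Rightarrow> nat \<Rightarrow> 'a"
    by (induction S rule: infinite_finite_induct) (auto simp: fun_app)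
  have "L f = (\<Sum>j<m. L (scl (f j) (funit j)))"
    by (subst fspace_expand[OF f]) (rule flin_sum[OF L])
  then have "L f i = (\<Sum>j<m. f j * L (funit j) i)"
    by (simp add: app flinD(2)[OF L] fun_app)
  then show "act (mat_of n m L) f i = L f i"
    using Lf[OF f] by (auto simp: act_def mat_of_def fspace_def mult.commute)
qed

lemma fspace_vec: "f \<in> fspace n \<Longrightarrow> \<exists>v\<in>carrier_vec n. f = (\<lambda>i. if i < n then v $ i else 0)"
  by (intro bexI[of _ "vec n f"]) (auto simp: fspace_def fun_eq_iff)

lemma act_vec:
  assumes "A \<in> carrier_mat n m" "v \<in> carrier_vec m"
  shows "act A (\<lambda>i. if i < m then v $ i else 0) = (\<lambda>i. if i < n then (A *\<^sub>v v) $ i else 0)"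
  using assms by (auto simp: act_def fun_eq_iff scalar_prod_def atLeast0LessThan)

lemma vec_fun_eq_iff:
  assumes "v \<in> carrier_vec n" "w \<in> carrier_vec n"
  shows "(\<lambda>i. if i < n then v $ i else (0 :: 'k::field)) = (\<lambda>i. if i < n then w $ i else 0) \<longleftrightarrow> v = w"
  using assms by (auto simp: fun_eq_iff vec_eq_iff)

lemma vec_fun_zero_iff:
  fixes v :: "'k::field vec"
  assumes "v \<in> carrier_vec n"
  shows "(\<lambda>i. if i < n then v $ i else 0) = 0 \<longleftrightarrow> v = 0\<^sub>v n"
  using assms by (auto simp: fun_eq_iff vec_eq_iff fun_app)

lemma surj_mat_act:
  assumes T: "T \<in> carrier_mat n m"
  shows "surj_mat T \<longleftrightarrow> (\<forall>g\<in>fspace n. \<exists>f\<in>fspace m. act T f = g)"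
proof
  assume s: "surj_mat T"
  show "\<forall>g\<in>fspace n. \<exists>f\<in>fspace m. act T f = g"
  proof
    fix g :: "nat \<Rightarrow> 'a" assume "g \<in> fspace n"
    then obtain v where v: "v \<in> carrier_vec n" "g = (\<lambda>i. if i < n then v $ i else 0)"
      using fspace_vec by blast
    obtain u where u: "u \<in> carrier_vec m" "T *\<^sub>v u = v" using s v T unfolding surj_mat_def by auto
    show "\<exists>f\<in>fspace m. act T f = g"
      using act_vec[OF T u(1)] u v by (intro bexI[of _ "\<lambda>i. if i < m then u $ i else 0"]) (auto intro: fspaceI)
  qed
next
  assume *: "\<forall>g\<in>fspace n. \<exists>f\<in>fspace m. act T f = g"
  show "surj_mat T" unfolding surj_mat_def
  proof
    fix v :: "'a vec" assume "v \<in> carrier_vec (dim_row T)"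
    then have v: "v \<in> carrier_vec n" using T by auto
    have "(\<lambda>i. if i < n then v $ i else 0) \<in> fspace n" by (auto intro: fspaceI)
    then obtain f where f: "f \<in> fspace m" "act T f = (\<lambda>i. if i < n then v $ i else 0)" using * by blast
    obtain u where u: "u \<in> carrier_vec m" "f = (\<lambda>i. if i < m then u $ i else 0)"
      using fspace_vec[OF f(1)] by blast
    have "T *\<^sub>v u = v"
      using f(2) act_vec[OF T u(1)] vec_fun_eq_iff[OF _ v, of "T *\<^sub>v u"] T u by auto
    then show "\<exists>u\<in>carrier_vec (dim_col T). T *\<^sub>v u = v" using u T by auto
  qed
qed

lemma act_eq_zero_vec:
  assumes T: "T \<in> carrier_mat n m" and u: "u \<in> carrier_vec m"
  shows "act T (\<lambda>i. if i < m then u $ i else 0) = 0 \<longleftrightarrow> T *\<^sub>v u = 0\<^sub>v n"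
  unfolding act_vec[OF T u] by (rule vec_fun_zero_iff) (use T u in auto)

lemma inj_mat_act:
  assumes T: "T \<in> carrier_mat n m" and inj: "inj_mat T" and f: "f \<in> fspace m" "act T f = 0"
  shows "f = 0"
proof -
  obtain u where u: "u \<in> carrier_vec m" "f = (\<lambda>i. if i < m then u $ i else 0)"
    using fspace_vec[OF f(1)] by blast
  have "u = 0\<^sub>v m" using inj f u act_eq_zero_vec[OF T u(1)] T unfolding inj_mat_def by auto
  then show ?thesis using u by (auto simp: fun_eq_iff fun_app)
qed

lemma exact_at_act:
  assumes F: "F \<in> carrier_mat m k" and G: "G \<in> carrier_mat n m" and ex: "exact_at F G"
  shows "act G (act F f) = 0" "h \<in> fspace m \<Longrightarrow> act G h = 0 \<Longrightarrow> \<exists>f\<in>fspace k. act F f = h"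
proof -
  have "G * F = 0\<^sub>m n k" using ex F G unfolding exact_at_def by auto
  then show "act G (act F f) = 0" using act_mult[OF G F, of f] by (simp add: act_zero)
  assume h: "h \<in> fspace m" "act G h = 0"
  obtain v where v: "v \<in> carrier_vec m" "h = (\<lambda>i. if i < m then v $ i else 0)"
    using fspace_vec[OF h(1)] by blast
  have "G *\<^sub>v v = 0\<^sub>v n" using h v act_eq_zero_vec[OF G v(1)] by auto
  then obtain u where u: "u \<in> carrier_vec k" "F *\<^sub>v u = v" using ex v F G unfolding exact_at_def by auto
  show "\<exists>f\<in>fspace k. act F f = h"
    using act_vec[OF F u(1)] u v by (intro bexI[of _ "\<lambda>i. if i < k then u $ i else 0"]) (auto intro: fspaceI)
qed

interpretation fn: vector_space "scl :: 'k::field \<Rightarrow> (nat \<Rightarrow> 'k) \<Rightarrow> nat \<Rightarrow> 'k"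
  by unfold_locales (auto simp: fun_eq_iff fun_app algebra_simps)

text \<open>A basis of \<open>K\<close> together with \<open>x\<close> is independent, so values on
  it can be prescribed. Such functionals later provide homomorphisms onto simple modules.\<close>

lemma separating_functional:
  fixes K :: "(nat \<Rightarrow> 'k::field) set"
  assumes K: "0 \<in> K" "\<And>f g. f \<in> K \<Longrightarrow> g \<in> K \<Longrightarrow> f + g \<in> K" "\<And>c f. f \<in> K \<Longrightarrow> scl c f \<in> K"
    and x: "x \<notin> K"
  obtains \<phi> :: "(nat \<Rightarrow> 'k) \<Rightarrow> 'k" where "\<And>f g. \<phi> (f + g) = \<phi> f + \<phi> g" "\<And>c f. \<phi> (scl c f) = c * \<phi> f"
    "\<And>f. f \<in> K \<Longrightarrow> \<phi> f = 0" "\<phi> x = 1"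
proof -
  interpret k: vector_space "(*) :: 'k \<Rightarrow> 'k \<Rightarrow> 'k" by unfold_locales (auto simp: algebra_simps)
  interpret p: vector_space_pair "scl :: 'k \<Rightarrow> (nat \<Rightarrow> 'k) \<Rightarrow> nat \<Rightarrow> 'k" "(*) :: 'k \<Rightarrow> 'k \<Rightarrow> 'k" ..
  have sub: "fn.subspace K" by (rule fn.subspaceI) (use K in auto)
  obtain B where B: "B \<subseteq> K" "fn.independent B" "K \<subseteq> fn.span B" using fn.basis_exists by metis
  have "fn.span B \<subseteq> K" using fn.span_minimal[OF B(1) sub] .
  then have "x \<notin> fn.span B" using x by blast
  then have "fn.independent (insert x B)" using B(2) by (simp add: fn.independent_insert)
  then obtain \<phi> where \<phi>: "Vector_Spaces.linear scl (*) \<phi>" "\<forall>y\<in>insert x B. \<phi> y = (if y = x then 1 else 0)"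
    using p.linear_independent_extend[of _ "\<lambda>y. if y = x then 1 else 0"] by blast
  interpret l: Vector_Spaces.linear scl "(*)" \<phi> by (rule \<phi>(1))
  have "\<phi> y = 0" if "y \<in> B" for y using \<phi>(2) that B(1) x by auto
  then have "\<phi> f = 0" if "f \<in> K" for f using p.linear_eq_0_on_span[OF \<phi>(1)] that B(3) by blast
  then show thesis using that[of \<phi>] l.add l.scale \<phi>(2) by auto
qed

section \<open>Modules over the quotient algebra as operators\<close>

definition op :: "(path \<Rightarrow> 'k::field) set \<Rightarrow> ((path \<Rightarrow> 'k) set, 'k) fdmod \<Rightarrow> 'k tri \<Rightarrow> (nat \<Rightarrow> 'k) \<Rightarrow> nat \<Rightarrow> 'k" where
  "op I M t = act (snd M (cls I t))"

lemma flin_op: "flin (op I M t)"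
  unfolding op_def by (rule flin_act)

context
  fixes I :: "(path \<Rightarrow> 'k::field) set" and M
  assumes I: "ideal I kQ" and M: "is_fdmod (Lam I) (Lam_scal I) M"
begin

lemma fdmod_carrier: "snd M (cls I t) \<in> carrier_mat (fst M) (fst M)"
  using M cls_carrier[OF I] by (simp add: is_fdmod_def Let_def)

lemma op_fspace: "op I M t f \<in> fspace (fst M)"
  unfolding op_def by (rule act_fspace[OF fdmod_carrier])

lemma op_add: "op I M (s + t) f = op I M s f + op I M t f"
proof -
  have "snd M (cls I (s + t)) = snd M (cls I s) + snd M (cls I t)"
    using M cls_carrier[OF I] by (simp add: is_fdmod_def Let_def cls_add[OF I])
  then show ?thesis unfolding op_def using act_plus fdmod_carrier by metis
qed

lemma op_mult: "op I M (s * t) f = op I M s (op I M t f)"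
proof -
  have "snd M (cls I (s * t)) = snd M (cls I s) * snd M (cls I t)"
    using M cls_carrier[OF I] by (simp add: is_fdmod_def Let_def cls_mult[OF I])
  then show ?thesis unfolding op_def using act_mult fdmod_carrier by metis
qed

lemma op_scal: "op I M (scal c * t) f = scl c (op I M t f)"
proof -
  have "snd M (cls I (scal c * t)) = c \<cdot>\<^sub>m snd M (cls I t)"
    using M cls_carrier[OF I] by (simp add: is_fdmod_def Let_def cls_mult[OF I] flip: Lam_scal_cls)
  then show ?thesis unfolding op_def by (simp add: act_smult)
qed

lemma op_jset: "t \<in> jset I \<Longrightarrow> op I M t f = 0"
proof -
  assume "t \<in> jset I"
  then have "cls I t = cls I 0" by (simp add: cls_eq_iff[OF I])
  moreover have "op I M 0 f = 0" using op_add[of 0 0 f] by simp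
  ultimately show ?thesis by (simp add: op_def)
qed

lemma op_zero: "op I M 0 f = 0"
  using op_add[of 0 0 f] by simp

end

text \<open>The elements whose action \<open>T\<close> intertwines form a subalgebra, so the
  idempotents and the arrows suffice.\<close>

lemma is_mod_hom_iff_gens:
  fixes I :: "(path \<Rightarrow> 'k::field) set"
  assumes I: "ideal I kQ" and M: "is_fdmod (Lam I) (Lam_scal I) M" and M': "is_fdmod (Lam I) (Lam_scal I) M'"
    and T: "T \<in> carrier_mat (fst M') (fst M)"
  shows "is_mod_hom (Lam I) M M' T \<longleftrightarrow> (\<forall>t f. f \<in> fspace (fst M) \<longrightarrow> act T (op I M t f) = op I M' t (act T f))"
    and "is_mod_hom (Lam I) M M' T \<longleftrightarrow> (\<forall>t\<in>{te1, te2, te3, ta, tb, tg}. \<forall>f\<in>fspace (fst M).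
      act T (op I M t f) = op I M' t (act T f))"
proof -
  note c = fdmod_carrier[OF I M] fdmod_carrier[OF I M']
  show 1: "is_mod_hom (Lam I) M M' T \<longleftrightarrow> (\<forall>t f. f \<in> fspace (fst M) \<longrightarrow> act T (op I M t f) = op I M' t (act T f))"
  proof
    assume h: "is_mod_hom (Lam I) M M' T"
    show "\<forall>t f. f \<in> fspace (fst M) \<longrightarrow> act T (op I M t f) = op I M' t (act T f)"
    proof (intro allI impI)
      fix t f
      have "T * snd M (cls I t) = snd M' (cls I t) * T"
        using h cls_carrier[OF I] by (simp add: is_mod_hom_def)
      then have "act (T * snd M (cls I t)) f = act (snd M' (cls I t) * T) f" by simp
      then show "act T (op I M t f) = op I M' t (act T f)"
        unfolding op_def using act_mult[OF T c(1)] act_mult[OF c(2) T] by simp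
    qed
  next
    assume h: "\<forall>t f. f \<in> fspace (fst M) \<longrightarrow> act T (op I M t f) = op I M' t (act T f)"
    show "is_mod_hom (Lam I) M M' T"
      unfolding is_mod_hom_def
    proof (intro conjI T ballI)
      fix X assume "X \<in> carrier (Lam I)"
      then obtain t where X: "X = cls I t" using cls_surj[OF I] by blast
      show "T * snd M X = snd M' X * T"
        unfolding X
        by (rule mat_eq_actI[OF mult_carrier_mat[OF T c(1)] mult_carrier_mat[OF c(2) T]])
          (use h in \<open>simp add: act_mult[OF T c(1)] act_mult[OF c(2) T] op_def\<close>)
    qed
  qed
  show "is_mod_hom (Lam I) M M' T \<longleftrightarrow> (\<forall>t\<in>{te1, te2, te3, ta, tb, tg}. \<forall>f\<in>fspace (fst M).
      act T (op I M t f) = op I M' t (act T f))"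
    unfolding 1
  proof (intro iffI allI impI)
    fix t and f :: "nat \<Rightarrow> 'k"
    assume h: "\<forall>t\<in>{te1, te2, te3, ta, tb, tg}. \<forall>f\<in>fspace (fst M). act T (op I M t f) = op I M' t (act T f)"
      and f: "f \<in> fspace (fst M)"
    have "\<forall>f\<in>fspace (fst M). act T (op I M t f) = op I M' t (act T f)"
    proof (induction t rule: tri_gen_induct)
      case (3 c t)
      then show ?case
        by (simp add: op_scal[OF I M] op_scal[OF I M'] flinD[OF flin_act[of T]])
    qed (use h in \<open>auto simp: op_add[OF I M] op_add[OF I M'] op_mult[OF I M] op_mult[OF I M']
        op_fspace[OF I M] flinD[OF flin_act[of T]]\<close>)
    then show "act T (op I M t f) = op I M' t (act T f)" using f by blast
  qed auto
qed

lemma fdmod_of_ops: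
  fixes I :: "(path \<Rightarrow> 'k::field) set"
  assumes I: "ideal I kQ"
    and lin: "\<And>t. flin (L t)" and sp: "\<And>t f. f \<in> fspace N \<Longrightarrow> L t f \<in> fspace N"
    and one: "\<And>f. f \<in> fspace N \<Longrightarrow> L 1 f = f"
    and add: "\<And>s t f. L (s + t) f = L s f + L t f"
    and mult: "\<And>s t f. L (s * t) f = L s (L t f)"
    and sc: "\<And>c t f. f \<in> fspace N \<Longrightarrow> L (scal c * t) f = scl c (L t f)"
    and J: "\<And>t f. t \<in> jset I \<Longrightarrow> L t f = 0"
  obtains M where "is_fdmod (Lam I) (Lam_scal I) M" "fst M = N"
    "\<And>t f. f \<in> fspace N \<Longrightarrow> op I M t f = L t f"
proof -
  define \<rho> where "\<rho> X = mat_of N N (L (SOME t. X = cls I t))" for X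
  have \<rho>: "act (\<rho> (cls I t)) f = L t f" if f: "f \<in> fspace N" for t f
  proof -
    define s where "s = (SOME s. cls I t = cls I s)"
    have "cls I t = cls I s" unfolding s_def by (rule someI[where x = t]) simp
    then have "t - s \<in> jset I" by (simp add: cls_eq_iff[OF I])
    then have "L (t - s) f = 0" by (rule J)
    then have "L t f = L s f" using add[of "t - s" s f] by simp
    then show ?thesis unfolding \<rho>_def s_def[symmetric] using act_mat_of[OF lin f sp] by simp
  qed
  have car: "\<rho> X \<in> carrier_mat N N" for X by (simp add: \<rho>_def)
  have eq: "\<rho> (cls I t) = B" if "B \<in> carrier_mat N N" "\<And>f. f \<in> fspace N \<Longrightarrow> L t f = act B f" for t B
    by (rule mat_eq_actI[OF car that(1)]) (simp add: \<rho> that(2))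
  have mod: "is_fdmod (Lam I) (Lam_scal I) (N, \<rho>)"
    unfolding is_fdmod_def Let_def fst_conv snd_conv
  proof (intro conjI ballI allI)
    show "\<rho> X \<in> carrier_mat N N" for X by (rule car)
    show "\<rho> \<one>\<^bsub>Lam I\<^esub> = 1\<^sub>m N"
      unfolding cls_one[OF I, symmetric] by (rule eq) (simp_all add: one act_one)
    fix X Y assume "X \<in> carrier (Lam I)" "Y \<in> carrier (Lam I)"
    then obtain s t where XY: "X = cls I s" "Y = cls I t" using cls_surj[OF I] by metis
    show "\<rho> (X \<oplus>\<^bsub>Lam I\<^esub> Y) = \<rho> X + \<rho> Y"
      unfolding XY cls_add[OF I, symmetric]
      by (rule eq) (use car in \<open>simp_all add: add act_plus[OF car car] \<rho>\<close>)
    show "\<rho> (X \<otimes>\<^bsub>Lam I\<^esub> Y) = \<rho> X * \<rho> Y"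
      unfolding XY cls_mult[OF I, symmetric]
      by (rule eq) (use mult_carrier_mat[OF car car] in \<open>simp_all add: mult act_mult[OF car car] \<rho> sp\<close>)
  next
    fix c X assume "X \<in> carrier (Lam I)"
    then obtain t where X: "X = cls I t" using cls_surj[OF I] by metis
    show "\<rho> (Lam_scal I c \<otimes>\<^bsub>Lam I\<^esub> X) = c \<cdot>\<^sub>m \<rho> X"
      unfolding X Lam_scal_cls cls_mult[OF I, symmetric]
      by (rule eq) (use car in \<open>auto simp: sc act_smult \<rho>\<close>)
  qed
  show thesis by (rule that[OF mod]) (simp_all add: op_def \<rho>)
qed

section \<open>Polynomials in an operator and modules from quiver representations\<close>

definition pev :: "((nat \<Rightarrow> 'k::field) \<Rightarrow> nat \<Rightarrow> 'k) \<Rightarrow> 'k poly \<Rightarrow> (nat \<Rightarrow> 'k) \<Rightarrow> nat \<Rightarrow> 'k" where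
  "pev B p f = fold_coeffs (\<lambda>a h. scl a f + B h) p 0"

lemma pev_0 [simp]: "pev B 0 f = 0"
  by (simp add: pev_def)

context
  fixes B :: "(nat \<Rightarrow> 'k::field) \<Rightarrow> nat \<Rightarrow> 'k"
  assumes B: "flin B"
begin

lemma pev_pCons [simp]: "pev B (pCons a p) f = scl a f + B (pev B p f)"
  by (cases "p = 0 \<and> a = 0") (auto simp: pev_def flinD[OF B])

lemma pev_add: "pev B (p + q) f = pev B p f + pev B q f"
  by (induction p q rule: poly_induct2) (simp_all add: flinD[OF B] scl_distrib algebra_simps)

lemma pev_smult: "pev B (Polynomial.smult c p) f = scl c (pev B p f)"
  by (induction p) (simp_all add: flinD[OF B] scl_distrib)

lemma pev_mult: "pev B (p * q) f = pev B p (pev B q f)"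
  by (induction p) (simp_all add: pev_add pev_smult flinD[OF B] scl_distrib)

lemma pev_monom: "pev B (monom 1 n) f = (B ^^ n) f"
  by (induction n) (simp_all add: monom_Suc monom_0 flinD[OF B])

lemma flin_pev: "flin (pev B p)"
  by (induction p) (simp_all add: flin_def scl_distrib algebra_simps flinD[OF B])

lemma pev_commute: "flin E \<Longrightarrow> (\<And>f. E (B f) = B (E f)) \<Longrightarrow> E (pev B p f) = pev B p (E f)"
  by (induction p) (simp_all add: flinD[of E])

end

text \<open>The last axiom makes every \<alpha>w(\<beta>)\<gamma> act as zero, so these modules
  never see \<open>W\<close>, and only the three nilpotency conditions of an ideal remain to be
  checked. The operators live on all functions; the idempotents cut back to length
  \<open>N\<close>.\<close>

locale quiver_rep =
  fixes N :: nat and E1 E2 E3 A B G :: "(nat \<Rightarrow> 'k::field) \<Rightarrow> nat \<Rightarrow> 'k"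
  assumes lin: "flin E1" "flin E2" "flin E3" "flin A" "flin B" "flin G"
    and sp: "\<And>f. E1 f \<in> fspace N" "\<And>f. E2 f \<in> fspace N" "\<And>f. E3 f \<in> fspace N"
    and sum: "\<And>f. f \<in> fspace N \<Longrightarrow> E1 f + E2 f + E3 f = f"
    and orth: "\<And>f. E1 (E1 f) = E1 f" "\<And>f. E2 (E2 f) = E2 f" "\<And>f. E3 (E3 f) = E3 f"
      "\<And>f. E1 (E2 f) = 0" "\<And>f. E1 (E3 f) = 0" "\<And>f. E2 (E1 f) = 0" "\<And>f. E2 (E3 f) = 0"
      "\<And>f. E3 (E1 f) = 0" "\<And>f. E3 (E2 f) = 0"
    and arr: "\<And>f. E1 (A f) = A f" "\<And>f. A (E2 f) = A f" "\<And>f. E2 (B f) = B f" "\<And>f. B (E2 f) = B f"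
      "\<And>f. E2 (G f) = G f" "\<And>f. G (E3 f) = G f"
    and zero: "\<And>i f. A ((B ^^ i) (G f)) = 0"
begin

definition L :: "'k tri \<Rightarrow> (nat \<Rightarrow> 'k) \<Rightarrow> nat \<Rightarrow> 'k" where
  "L t f = scl (c1 t) (E1 f) + scl (c3 t) (E3 f) + pev B (pB t) (E2 f) + A (pev B (pA t) (E2 f))
     + pev B (pG t) (G f)"

lemma pev_E2: "E2 (pev B p f) = pev B p (E2 f)"
  by (rule pev_commute[OF lin(5) lin(2)]) (simp add: arr)

lemma A_pev_G: "A (pev B p (G f)) = 0"
proof -
  have "A ((B ^^ i) (pev B p (G f))) = 0" for i
  proof (induction p arbitrary: i)
    case (pCons a p)
    then show ?case
      using pCons(2)[of "Suc i"] zero[of i f]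
      by (simp add: lin flinD[OF lin(4)] flinD[OF flin_pow[OF lin(5)]] funpow_swap1 zero)
  qed (simp add: flinD[OF lin(4)] flinD[OF flin_pow[OF lin(5)]])
  from this[of 0] show ?thesis by simp
qed

lemma A_pev_pev_G: "A (pev B p (pev B q (G f))) = 0"
  using A_pev_G[of "p * q"] by (simp add: pev_mult[OF lin(5)])

lemma E_orth_arr: "E1 (G f) = 0" "E3 (G f) = 0" "E2 (A f) = 0" "E3 (A f) = 0" "E1 (pev B p (E2 f)) = 0"
  "E3 (pev B p (E2 f)) = 0" "E1 (pev B p (G f)) = 0" "E3 (pev B p (G f)) = 0" "G (A f) = 0"
  "G (pev B p (E2 f)) = 0" "G (pev B p (G f)) = 0" "G (E1 f) = 0" "G (E2 f) = 0"
proof -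
  show 1: "E1 (G f) = 0" "E3 (G f) = 0" "E2 (A f) = 0" "E3 (A f) = 0" for f
    by (metis orth arr)+
  show 2: "E1 (pev B p (E2 f)) = 0" "E3 (pev B p (E2 f)) = 0" for f
    by (metis pev_E2 orth)+
  show 3: "E1 (pev B p (G f)) = 0" "E3 (pev B p (G f)) = 0" for f
    using 2[of "G f"] by (simp_all add: arr)
  have G: "E3 h = 0 \<Longrightarrow> G h = 0" for h by (metis arr(6) flinD(3)[OF lin(6)])
  show "G (A f) = 0" "G (pev B p (E2 f)) = 0" "G (pev B p (G f)) = 0" "G (E1 f) = 0" "G (E2 f) = 0"
    by (rule G, simp add: 1 2 3 orth)+
qed

lemma L_mult: "L (s * t) f = L s (L t f)"
proof -
  note lins = flinD[OF lin(1)] flinD[OF lin(2)] flinD[OF lin(3)] flinD[OF lin(4)] flinD[OF lin(5)] flinD[OF lin(6)]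
    flinD[OF flin_pev[OF lin(5)]]
  have [simp]: "A (E1 f) = 0" "A (E3 f) = 0" "A (A f) = 0" for f
    by (metis arr(2) orth flinD(3)[OF lin(4)] E_orth_arr(3))+
  have [simp]: "G (E3 f) = G f" for f by (rule arr)
  show ?thesis
    unfolding L_def
    by (simp add: lins orth arr E_orth_arr pev_E2 A_pev_G A_pev_pev_G pev_add pev_mult pev_smult lin
        scl_distrib algebra_simps)
qed

lemma module_exists:
  assumes I: "ideal I kQ" and J: "jset I = shape n m l W"
    and nil: "\<And>f. (B ^^ n) f = 0" "\<And>f. A ((B ^^ m) f) = 0" "\<And>f. (B ^^ l) (G f) = 0"
  obtains M where "is_fdmod (Lam I) (Lam_scal I) M" "fst M = N"
    "\<And>f. f \<in> fspace N \<Longrightarrow> op I M te1 f = E1 f" "\<And>f. f \<in> fspace N \<Longrightarrow> op I M te2 f = E2 f"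
    "\<And>f. f \<in> fspace N \<Longrightarrow> op I M te3 f = E3 f" "\<And>f. f \<in> fspace N \<Longrightarrow> op I M ta f = A f"
    "\<And>f. f \<in> fspace N \<Longrightarrow> op I M tb f = B f" "\<And>f. f \<in> fspace N \<Longrightarrow> op I M tg f = G f"
proof -
  note lins = flinD[OF lin(1)] flinD[OF lin(2)] flinD[OF lin(3)] flinD[OF lin(4)] flinD[OF lin(5)] flinD[OF lin(6)]
    flinD[OF flin_pev[OF lin(5)]]
  have pevsp: "E2 h = h \<Longrightarrow> pev B p h \<in> fspace N" for p h by (metis pev_E2 sp(2))
  obtain M where M: "is_fdmod (Lam I) (Lam_scal I) M" "fst M = N"
    "\<And>t f. f \<in> fspace N \<Longrightarrow> op I M t f = L t f"
  proof (rule fdmod_of_ops[OF I, where L = L and N = N])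
    show "flin (L t)" for t
      unfolding flin_def L_def by (auto simp: lins scl_distrib algebra_simps mult.commute)
    show "L t f \<in> fspace N" for t f
      unfolding L_def by (intro fspace_closed sp pevsp) (simp_all add: orth arr, metis arr(1) sp(1))
    show "L 1 f = f" if "f \<in> fspace N" for f
    proof -
      have "pev B 1 h = h" for h using pev_monom[OF lin(5), of 0 h] by simp
      then show ?thesis using sum[OF that] by (simp add: L_def lins algebra_simps)
    qed
    show "L (s + t) f = L s f + L t f" for s t f
      by (simp add: L_def scl_distrib pev_add lin lins algebra_simps)
    show "L (s * t) f = L s (L t f)" for s t f by (rule L_mult)
    show "L (scal c * t) f = scl c (L t f)" for c t f
      by (simp add: L_def pev_smult lin lins scl_distrib)
    show "L t f = 0" if t: "t \<in> jset I" for t f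
    proof -
      from t obtain b a g where *: "c1 t = 0" "c3 t = 0" "pB t = monom 1 n * b" "pA t = monom 1 m * a"
        "pG t = monom 1 l * g" unfolding J shape_def by (auto elim!: dvdE)
      have "pev B (monom 1 l * g) h = pev B g (pev B (monom 1 l) h)" for h
        using pev_mult[OF lin(5), of g "monom 1 l"] by (simp add: mult.commute)
      then show ?thesis
        unfolding L_def * by (simp add: pev_mult[OF lin(5)] pev_monom[OF lin(5)] nil lins)
    qed
  qed (rule that)
  have tb: "L tb f = B f" for f
    by (simp add: L_def lin lins arr)
  have "pev B 1 h = h" for h using pev_monom[OF lin(5), of 0 h] by simp
  then have "L te1 f = E1 f" "L te2 f = E2 f" "L te3 f = E3 f" "L ta f = A f" "L tg f = G f" for f
    by (simp_all add: L_def lins arr)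
  then show thesis using that[of M] M tb by simp
qed

end

section \<open>Infinite global dimension\<close>

definition restr :: "nat set \<Rightarrow> (nat \<Rightarrow> 'k::field) \<Rightarrow> nat \<Rightarrow> 'k" where
  "restr S f = (\<lambda>i. if i \<in> S then f i else 0)"

text \<open>A nilpotent Jordan block on the coordinates a, ..., n - 1, each moving to the next;
  coordinates below \<open>a\<close> are killed.\<close>

definition shift :: "nat \<Rightarrow> nat \<Rightarrow> (nat \<Rightarrow> 'k::field) \<Rightarrow> nat \<Rightarrow> 'k" where
  "shift a n f = (\<lambda>i. if a < i \<and> i < n then f (i - 1) else 0)"

lemma flin_restr: "flin (restr S)"
  by (auto simp: flin_def restr_def fun_eq_iff fun_app)

lemma flin_shift: "flin (shift a n)"
  by (auto simp: flin_def shift_def fun_eq_iff fun_app)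

lemma flin_zero: "flin (\<lambda>_. 0)"
  by (auto simp: flin_def)

lemma fspace_shift: "n \<le> N \<Longrightarrow> shift a n f \<in> fspace N"
  by (simp add: fspace_def shift_def)

lemma shift_0: "shift a n f 0 = 0"
  by (simp add: shift_def)

text \<open>The exponent 0 is excluded because the identity does not truncate at
  \<open>n\<close>.\<close>

lemma shift_pow: "0 < k \<Longrightarrow> (shift a n ^^ k) f i = (if a + k \<le> i \<and> i < n then f (i - k) else 0)"
proof (induction k arbitrary: i)
  case (Suc k)
  then show ?case by (cases "k = 0") (auto simp: shift_def)
qed simp

text \<open>For X the space at the vertex 3 this is the submodule generated by \<gamma>X inside the
  space at the vertex 2, since \<beta>^l\<gamma> = 0. The coefficients \<open>v\<close> stay
  explicit because their uniqueness is what torsion-freeness means.\<close>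

definition Yset :: "nat \<Rightarrow> ((nat \<Rightarrow> 'k::field) \<Rightarrow> nat \<Rightarrow> 'k) \<Rightarrow> ((nat \<Rightarrow> 'k) \<Rightarrow> nat \<Rightarrow> 'k) \<Rightarrow>
    (nat \<Rightarrow> 'k) set \<Rightarrow> (nat \<Rightarrow> 'k) set" where
  "Yset l b g X = {\<Sum>j<l. (b ^^ j) (g (v j)) | v. \<forall>j<l. v j \<in> X}"

lemma YsetI: "(\<And>j. j < l \<Longrightarrow> v j \<in> X) \<Longrightarrow> (\<Sum>j<l. (b ^^ j) (g (v j))) \<in> Yset l b g X"
  by (auto simp: Yset_def)

lemma YsetE:
  assumes "y \<in> Yset l b g X"
  obtains v where "y = (\<Sum>j<l. (b ^^ j) (g (v j)))" "\<forall>j<l. v j \<in> X"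
  using assms by (auto simp: Yset_def)

text \<open>For \<open>p + q = n\<close> this says that multiplication by \<open>b\<^sup>p\<close> and \<open>b\<^sup>q\<close> is exact on \<open>X\<close> modulo \<open>Y\<close>,
  as it is on free \<open>k[x]/(x\<^sup>n)\<close>-modules for \<open>Y = 0\<close>.\<close>
definition exact_mod :: "((nat \<Rightarrow> 'k::field) \<Rightarrow> nat \<Rightarrow> 'k) \<Rightarrow> nat \<Rightarrow> nat \<Rightarrow> (nat \<Rightarrow> 'k) set \<Rightarrow>
    (nat \<Rightarrow> 'k) set \<Rightarrow> bool" where
  "exact_mod b p q Y X \<longleftrightarrow> (\<forall>x\<in>X. (b ^^ p) x \<in> Y \<longrightarrow> (\<exists>x'\<in>X. x - (b ^^ q) x' \<in> Y))"

definition sgrp :: "(nat \<Rightarrow> 'k::field) set \<Rightarrow> bool" where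
  "sgrp X \<longleftrightarrow> 0 \<in> X \<and> (\<forall>x\<in>X. \<forall>y\<in>X. x - y \<in> X)"

lemma sgrpD:
  assumes "sgrp X"
  shows "0 \<in> X" "x \<in> X \<Longrightarrow> y \<in> X \<Longrightarrow> x - y \<in> X" "x \<in> X \<Longrightarrow> - x \<in> X" "x \<in> X \<Longrightarrow> y \<in> X \<Longrightarrow> x + y \<in> X"
proof -
  show *: "0 \<in> X" "x \<in> X \<Longrightarrow> y \<in> X \<Longrightarrow> x - y \<in> X" for x y using assms by (auto simp: sgrp_def)
  show **: "x \<in> X \<Longrightarrow> - x \<in> X" for x using *(2)[OF *(1), of x] by simp
  show "x \<in> X \<Longrightarrow> y \<in> X \<Longrightarrow> x + y \<in> X" using *(2)[OF _ **, of x y] by simp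
qed

lemma sgrp_Yset:
  assumes lin: "flin b" "flin g" and X: "sgrp X"
  shows "sgrp (Yset l b g X)"
  unfolding sgrp_def
proof (intro conjI ballI)
  have "0 = (\<Sum>j<l. (b ^^ j) (g 0))" by (simp add: flinD[OF lin(2)] flinD[OF flin_pow[OF lin(1)]])
  then show "0 \<in> Yset l b g X"
    using YsetI[of l "\<lambda>_. 0" X b g] sgrpD(1)[OF X] by simp
  fix x y assume "x \<in> Yset l b g X" "y \<in> Yset l b g X"
  then obtain v w where v: "x = (\<Sum>j<l. (b ^^ j) (g (v j)))" "\<forall>j<l. v j \<in> X"
    and w: "y = (\<Sum>j<l. (b ^^ j) (g (w j)))" "\<forall>j<l. w j \<in> X" by (elim YsetE)
  have "x - y = (\<Sum>j<l. (b ^^ j) (g (v j - w j)))"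
    unfolding v(1) w(1) sum_subtractf[symmetric] flin_diff[OF lin(2)] flin_diff[OF flin_pow[OF lin(1)]] ..
  moreover have "\<forall>j<l. v j - w j \<in> X" using v w sgrpD(2)[OF X] by blast
  ultimately show "x - y \<in> Yset l b g X"
    using YsetI[of l "\<lambda>j. v j - w j"] by simp
qed

lemma Yset_mult:
  assumes lin: "flin b" "flin g" and X: "sgrp X" and nil: "\<And>v. v \<in> X \<Longrightarrow> (b ^^ l) (g v) = 0"
    and x: "x \<in> Yset l b g X"
  shows "(b ^^ i) x \<in> Yset l b g X"
proof -
  have step: "b x \<in> Yset l b g X" if x: "x \<in> Yset l b g X" for x
  proof -
    obtain v where v: "x = (\<Sum>j<l. (b ^^ j) (g (v j)))" "\<forall>j<l. v j \<in> X"
      using x by (rule YsetE)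
    \<comment> \<open>Applying \<open>b\<close> shifts the coefficients by one place; the one pushed
      out at the top dies by \<open>b^l g = 0\<close>.\<close>
    define w where "w j = (case j of 0 \<Rightarrow> 0 | Suc i \<Rightarrow> v i)" for j
    have "b x = (\<Sum>j<l. b ((b ^^ j) (g (v j))))"
      unfolding v(1) by (rule flin_sum[OF lin(1)])
    also have "\<dots> = (\<Sum>j<Suc l. (b ^^ j) (g (w j)))"
      unfolding sum.lessThan_Suc_shift by (simp add: w_def flinD[OF lin(2)])
    also have "\<dots> = (\<Sum>j<l. (b ^^ j) (g (w j)))"
    proof -
      have "(b ^^ l) (g (w l)) = 0"
        by (cases l) (use v sgrpD(1)[OF X] nil in \<open>auto simp: w_def flinD[OF lin(2)]\<close>)
      then show ?thesis by simp
    qed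
    finally have "b x = (\<Sum>j<l. (b ^^ j) (g (w j)))" .
    moreover have "\<forall>j<l. w j \<in> X"
      using v sgrpD(1)[OF X] by (auto simp: w_def split: nat.split)
    ultimately show ?thesis using YsetI[of l w X b g] by simp
  qed
  show ?thesis by (induction i) (use x step in auto)
qed

text \<open>With K the kernel of \<open>d\<close>, \<open>TF\<close> makes the sequence K
  \<rightarrow> X \<rightarrow> Z stay exact after dividing out the \<open>Yset\<close> parts: an
  element of that part of X lying in K already has its coefficients in K. In the resulting homology
  sequence for \<open>b^p\<close> and \<open>b^q\<close> the connecting map exchanges the two
  powers, so exactness of type (p, q) on X and of type (q, p) on K give type (p, q) on Z.\<close>

lemma exact_mod_chase:
  assumes lin: "flin b" "flin g" "flin b'" "flin g'" "flin d"
    and X: "sgrp X2" "sgrp X3" "\<And>x. x \<in> X2 \<Longrightarrow> b x \<in> X2" "\<And>v. v \<in> X3 \<Longrightarrow> g v \<in> X2"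
    and nil: "\<And>x. x \<in> X2 \<Longrightarrow> (b ^^ (p + q)) x = 0" "\<And>v. v \<in> X3 \<Longrightarrow> (b ^^ l) (g v) = 0"
    and d: "\<And>x. x \<in> X2 \<Longrightarrow> d (b x) = b' (d x)" "\<And>v. v \<in> X3 \<Longrightarrow> d (g v) = g' (d v)"
    and onto: "d ` X2 = Z2" "d ` X3 = Z3"
    and TF: "\<And>w. \<forall>j<l. w j \<in> Z3 \<Longrightarrow> (\<Sum>j<l. (b' ^^ j) (g' (w j))) = 0 \<Longrightarrow> \<forall>j<l. w j = 0"
    and HX: "exact_mod b p q (Yset l b g X3) X2"
    and HK: "exact_mod b q p (Yset l b g {v \<in> X3. d v = 0}) {x \<in> X2. d x = 0}"
  shows "exact_mod b' p q (Yset l b' g' Z3) Z2"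
  unfolding exact_mod_def
proof (intro ballI impI)
  fix z assume z: "z \<in> Z2" "(b' ^^ p) z \<in> Yset l b' g' Z3"
  let ?Y = "Yset l b g X3" and ?K2 = "{x \<in> X2. d x = 0}" and ?K3 = "{v \<in> X3. d v = 0}"
  note Y = sgrpD[OF sgrp_Yset[OF lin(1,2) X(2)]]
  have pow_X: "(b ^^ i) x \<in> X2" if "x \<in> X2" for i x by (induction i) (use that X in auto)
  have d_pow: "d ((b ^^ i) x) = (b' ^^ i) (d x)" if "x \<in> X2" for i x
    by (induction i) (use that d pow_X in auto)
  have d_Y: "d (\<Sum>j<l. (b ^^ j) (g (v j))) = (\<Sum>j<l. (b' ^^ j) (g' (d (v j))))" if "\<forall>j<l. v j \<in> X3" for v
    unfolding flin_sum[OF lin(5)] by (rule sum.cong) (use that X d d_pow in auto)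
  have YK: "y \<in> Yset l b g ?K3" if y: "y \<in> ?Y" "d y = 0" for y
  proof -
    obtain v where v: "y = (\<Sum>j<l. (b ^^ j) (g (v j)))" "\<forall>j<l. v j \<in> X3"
      using y(1) by (rule YsetE)
    have "\<forall>j<l. d (v j) = 0"
      by (rule TF) (use v y(2) d_Y[OF v(2)] onto in auto)
    then show ?thesis using YsetI[of l v ?K3 b g] v by simp
  qed
  have KY: "Yset l b g ?K3 \<subseteq> ?Y" by (auto simp: Yset_def)
  have Y_X: "?Y \<subseteq> X2"
  proof
    fix y assume "y \<in> ?Y"
    then obtain v where v: "y = (\<Sum>j<l. (b ^^ j) (g (v j)))" "\<forall>j<l. v j \<in> X3" by (rule YsetE)
    have "(\<Sum>j\<in>S. (b ^^ j) (g (v j))) \<in> X2" if "S \<subseteq> {..<l}" for S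
      using that v(2) X pow_X sgrpD[OF X(1)]
      by (induction S rule: infinite_finite_induct) auto
    then show "y \<in> X2" using v by blast
  qed
  obtain x where x: "x \<in> X2" "d x = z" using z(1) onto by blast
  obtain w where w: "(b' ^^ p) z = (\<Sum>j<l. (b' ^^ j) (g' (w j)))" "\<forall>j<l. w j \<in> Z3"
    using z(2) by (rule YsetE)
  have "\<exists>u. u \<in> X3 \<and> d u = w j" if "j < l" for j
  proof -
    have "w j \<in> d ` X3" using w(2) that onto(2) by simp
    then obtain u where "u \<in> X3" "w j = d u" by (rule imageE)
    then show ?thesis by auto
  qed
  then obtain v where v: "\<forall>j<l. v j \<in> X3 \<and> d (v j) = w j" by metis
  define y where "y = (\<Sum>j<l. (b ^^ j) (g (v j)))"
  have yY: "y \<in> ?Y" unfolding y_def using v by (intro YsetI) simp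
  have dy: "d y = (b' ^^ p) z" unfolding y_def w(1) using d_Y[of v] v by simp
  \<comment> \<open>The connecting map: \<open>b^p x\<close> and \<open>y\<close> lie over the same
    element, so their difference is in the kernel of \<open>d\<close>.\<close>
  define k where "k = (b ^^ p) x - y"
  have k: "k \<in> ?K2"
    using x dy yY Y_X pow_X sgrpD(2)[OF X(1)] by (auto simp: k_def flin_diff[OF lin(5)] d_pow)
  have "(b ^^ q) ((b ^^ p) x) = 0" using nil(1)[OF x(1)] by (simp add: funpow_add add.commute[of p q])
  then have bk: "(b ^^ q) k = - (b ^^ q) y"
    unfolding k_def flin_diff[OF flin_pow[OF lin(1)]] by simp
  have "(b ^^ q) k \<in> ?Y" unfolding bk by (rule Y(3)) (rule Yset_mult[OF lin(1,2) X(2) nil(2) yY])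
  moreover have "d ((b ^^ q) k) = 0"
  proof -
    have "d ((b ^^ q) k) = (b' ^^ q) (d k)" using k d_pow by blast
    then show ?thesis using k flinD(3)[OF flin_pow[OF lin(3)]] by simp
  qed
  ultimately have "(b ^^ q) k \<in> Yset l b g ?K3" by (rule YK)
  then obtain k' where k': "k' \<in> ?K2" "k - (b ^^ p) k' \<in> Yset l b g ?K3"
    using HK k unfolding exact_mod_def by blast
  \<comment> \<open>Subtracting \<open>k'\<close> does not change the image under \<open>d\<close>
    and brings \<open>b^p x\<close> into the generated part, so exactness on \<open>X2\<close>
    applies.\<close>
  have "(b ^^ p) (x - k') = y + (k - (b ^^ p) k')"
    by (simp add: k_def flin_diff[OF flin_pow[OF lin(1)]])
  also have "\<dots> \<in> ?Y" using Y(4)[OF yY] k'(2) KY by blast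
  finally obtain x' where x': "x' \<in> X2" "x - k' - (b ^^ q) x' \<in> ?Y"
    using HX x k' sgrpD(2)[OF X(1)] unfolding exact_mod_def by blast
  have "d (x - k' - (b ^^ q) x') = z - (b' ^^ q) (d x')"
    using k' x by (simp add: flin_diff[OF lin(5)] d_pow[OF x'(1)])
  moreover have "d (x - k' - (b ^^ q) x') \<in> Yset l b' g' Z3"
  proof -
    obtain u where u: "x - k' - (b ^^ q) x' = (\<Sum>j<l. (b ^^ j) (g (u j)))" "\<forall>j<l. u j \<in> X3"
      using x'(2) by (rule YsetE)
    have "d (u j) \<in> Z3" if "j < l" for j using u(2) onto(2) that by blast
    then show ?thesis unfolding u(1) d_Y[OF u(2)] by (rule YsetI)
  qed
  ultimately show "\<exists>x'\<in>Z2. z - (b' ^^ q) x' \<in> Yset l b' g' Z3" using x'(1) onto by auto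
qed

section \<open>Test modules and exactness for projective modules\<close>

definition vsp :: "(path \<Rightarrow> 'k::field) set \<Rightarrow> ((path \<Rightarrow> 'k) set, 'k) fdmod \<Rightarrow> 'k tri \<Rightarrow> (nat \<Rightarrow> 'k) set" where
  "vsp I M e = {f \<in> fspace (fst M). op I M e f = f}"

context
  fixes I :: "(path \<Rightarrow> 'k::field) set" and n m l :: nat and W
  assumes I: "ideal I kQ" and J: "jset I = shape n m l W" and n: "2 \<le> n" and l: "1 \<le> l" "l \<le> n"
begin

context
  fixes M
  assumes M: "is_fdmod (Lam I) (Lam_scal I) M"
begin

lemma op_paths:
  "op I M te1 (op I M te2 f) = 0" "op I M te1 (op I M te3 f) = 0" "op I M te2 (op I M te1 f) = 0"
  "op I M te2 (op I M te3 f) = 0" "op I M te3 (op I M te1 f) = 0" "op I M te3 (op I M te2 f) = 0"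
  "op I M te1 (op I M te1 f) = op I M te1 f" "op I M te2 (op I M te2 f) = op I M te2 f"
  "op I M te3 (op I M te3 f) = op I M te3 f"
  "op I M te2 (op I M tb f) = op I M tb f" "op I M tb (op I M te2 f) = op I M tb f"
  "op I M te2 (op I M tg f) = op I M tg f" "op I M tg (op I M te3 f) = op I M tg f"
  "op I M te3 (op I M tb f) = 0" "op I M te3 (op I M tg f) = 0" "op I M te2 (op I M ta f) = 0"
  "op I M te3 (op I M ta f) = 0" "op I M te1 (op I M ta f) = op I M ta f" "op I M ta (op I M te2 f) = op I M ta f"
  "op I M te1 (op I M tb f) = 0" "op I M te1 (op I M tg f) = 0" "op I M tb (op I M te3 f) = 0"
  "op I M tb (op I M te1 f) = 0"
  using op_zero[OF I M, of f]
  by (simp_all add: op_mult[OF I M, symmetric] times_tri_def zero_tri_def flip: one_pCons)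

lemma op_tb_pow: "0 < i \<Longrightarrow> (op I M tb ^^ i) f = op I M (Tri 0 0 (monom 1 i) 0 0 0) f"
proof (induction i)
  case (Suc i)
  show ?case
  proof (cases i)
    case 0
    then show ?thesis by (simp add: monom_Suc monom_0)
  next
    case (Suc j)
    then have "(op I M tb ^^ Suc i) f = op I M (tb * Tri 0 0 (monom 1 i) 0 0 0) f"
      using Suc.IH by (simp add: op_mult[OF I M] del: funpow.simps(2)) (simp add: Suc.IH Suc)
    also have "tb * Tri 0 0 (monom 1 i) 0 0 0 = (Tri 0 0 (monom 1 (Suc i)) 0 0 0 :: 'k tri)"
      by (simp add: times_tri_def monom_Suc)
    finally show ?thesis .
  qed
qed simp

lemma op_tb_pow_tg: "(op I M tb ^^ i) (op I M tg f) = op I M (Tri 0 0 0 0 (monom 1 i) 0) f"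
proof (induction i)
  case 0
  then show ?case by (simp add: monom_0 one_pCons)
next
  case (Suc i)
  have "tb * Tri 0 0 0 0 (monom 1 i) 0 = (Tri 0 0 0 0 (monom 1 (Suc i)) 0 :: 'k tri)"
    by (simp add: times_tri_def monom_Suc)
  then show ?case using Suc by (simp add: op_mult[OF I M, symmetric])
qed

lemma op_nil: "(op I M tb ^^ n) f = 0" "(op I M tb ^^ l) (op I M tg f) = 0"
proof -
  have "Tri 0 0 (monom 1 n) 0 0 0 \<in> jset I" "Tri 0 0 0 0 (monom 1 l) 0 \<in> jset I"
    if "0 \<in> W"
    using that by (simp_all add: J shape_def)
  moreover have "0 \<in> W" using tri_idealD(1)[OF tri_ideal_jset[OF I]] by (simp add: J shape_def)
  ultimately show "(op I M tb ^^ n) f = 0" "(op I M tb ^^ l) (op I M tg f) = 0"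
    using op_tb_pow[of n f] op_tb_pow_tg[of l f] n op_jset[OF I M] by auto
qed

lemma sgrp_vsp: "sgrp (vsp I M e)"
  by (auto simp: sgrp_def vsp_def flinD[OF flin_op[of I M e]] flin_diff[OF flin_op])

lemma vsp_arrows: "op I M tb f \<in> vsp I M te2" "op I M tg f \<in> vsp I M te2"
  by (simp_all add: vsp_def op_paths op_fspace[OF I M])

lemma vsp_te: "op I M te2 f \<in> vsp I M te2" "op I M te3 f \<in> vsp I M te3"
  by (simp_all add: vsp_def op_paths op_fspace[OF I M])

end

text \<open>This is \<open>k[x]/(x^r)\<close> placed at the vertex 2: the simple module for r = 1,
  and for r = n the module through which maps from projectives to the simple one are lifted.\<close>

lemma uniserial_exists:
  assumes r: "1 \<le> r" "r \<le> n"
  obtains U where "is_fdmod (Lam I) (Lam_scal I) U" "fst U = r"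
    "\<And>f. f \<in> fspace r \<Longrightarrow> op I U te1 f = 0" "\<And>f. f \<in> fspace r \<Longrightarrow> op I U te2 f = f"
    "\<And>f. f \<in> fspace r \<Longrightarrow> op I U te3 f = 0" "\<And>f. f \<in> fspace r \<Longrightarrow> op I U ta f = 0"
    "\<And>f. f \<in> fspace r \<Longrightarrow> op I U tb f = shift 0 r f" "\<And>f. f \<in> fspace r \<Longrightarrow> op I U tg f = 0"
proof -
  interpret R: quiver_rep r "\<lambda>_. 0" "restr {..<r}" "\<lambda>_. 0" "\<lambda>_. 0" "shift 0 r" "\<lambda>_. 0 :: nat \<Rightarrow> 'k"
    by unfold_locales
      (auto simp: flin_zero flin_restr flin_shift fspace_def restr_def shift_def fun_eq_iff fun_app)
  have id: "restr {..<r} f = f" if "f \<in> fspace r" for f :: "nat \<Rightarrow> 'k"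
    using that by (auto simp: restr_def fspace_def fun_eq_iff)
  have nil: "(shift 0 r ^^ n) f = 0" for f :: "nat \<Rightarrow> 'k"
    using n r by (auto simp: fun_eq_iff fun_app shift_pow)
  have nil': "(shift 0 r ^^ l) 0 = (0 :: nat \<Rightarrow> 'k)" by (rule flinD(3)[OF flin_pow[OF flin_shift]])
  show thesis
    by (rule R.module_exists[OF I J nil refl nil'], rule that, assumption, assumption) (simp_all add: id)
qed

text \<open>The quotient of \<open>\<Lambda>e\<^sub>3\<close> with basis \<open>e\<^sub>3, \<gamma>, \<beta>\<gamma>, \<dots>, \<beta>\<^sup>r\<^sup>-\<^sup>1\<gamma>\<close>.\<close>
lemma gamma_module_exists:
  assumes r: "r \<le> l"
  obtains V where "is_fdmod (Lam I) (Lam_scal I) V" "fst V = Suc r"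
    "\<And>f. f \<in> fspace (Suc r) \<Longrightarrow> op I V te1 f = 0"
    "\<And>f. f \<in> fspace (Suc r) \<Longrightarrow> op I V te2 f = restr {1..r} f"
    "\<And>f. f \<in> fspace (Suc r) \<Longrightarrow> op I V te3 f = restr {0} f" "\<And>f. f \<in> fspace (Suc r) \<Longrightarrow> op I V ta f = 0"
    "\<And>f. f \<in> fspace (Suc r) \<Longrightarrow> op I V tb f = shift 1 (Suc r) f"
    "\<And>f. f \<in> fspace (Suc r) \<Longrightarrow> op I V tg f = restr {1..r} (\<lambda>i. restr {1} (\<lambda>_. f 0) i)"
proof -
  \<comment> \<open>\<gamma> sends coordinate 0, which is \<open>e_3\<close>, to coordinate 1. The
    outer restriction suppresses this when r = 0, where only the simple module at the vertex 3 is
    left.\<close>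
  let ?G = "\<lambda>f :: nat \<Rightarrow> 'k. restr {1..r} (\<lambda>i. restr {1} (\<lambda>_. f 0) i)"
  interpret R: quiver_rep "Suc r" "\<lambda>_. 0" "restr {1..r}" "restr {0}" "\<lambda>_. 0" "shift 1 (Suc r)" ?G
    by unfold_locales
      (auto simp: flin_zero flin_restr flin_shift fspace_def restr_def shift_def fun_eq_iff fun_app flin_def)
  have nil: "(shift 1 (Suc r) ^^ n) f = 0" for f :: "nat \<Rightarrow> 'k"
    using n r l by (auto simp: fun_eq_iff fun_app shift_pow)
  have nil': "(shift 1 (Suc r) ^^ l) (?G f) = 0" for f :: "nat \<Rightarrow> 'k"
    using r l by (auto simp: fun_eq_iff fun_app restr_def shift_pow)
  show thesis
  proof (rule R.module_exists[OF I J])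
    show "(shift 1 (Suc r) ^^ n) f = 0" "(shift 1 (Suc r) ^^ l) (?G f) = 0" for f :: "nat \<Rightarrow> 'k"
      by (rule nil nil')+
  qed (rule refl, rule that)
qed

lemma mat_row_hom:
  fixes \<phi> :: "(nat \<Rightarrow> 'k) \<Rightarrow> 'k"
  assumes \<phi>: "\<And>f g. \<phi> (f + g) = \<phi> f + \<phi> g" "\<And>c f. \<phi> (scl c f) = c * \<phi> f" and f: "f \<in> fspace N"
  shows "act (mat_of (Suc 0) N (\<lambda>f. scl (\<phi> f) (funit 0))) f = scl (\<phi> f) (funit 0)"
proof (rule act_mat_of[OF _ f])
  show "flin (\<lambda>f. scl (\<phi> f) (funit 0))"
    unfolding flin_def by (simp add: \<phi> scl_distrib)
qed simp

lemma row0_surj: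
  assumes "1 \<le> N"
  shows "f \<in> fspace N \<Longrightarrow> act (mat_of (Suc 0) N (\<lambda>f. scl (f 0) (funit 0))) f = scl (f 0) (funit 0 :: nat \<Rightarrow> 'k)"
    and "surj_mat (mat_of (Suc 0) N (\<lambda>f :: nat \<Rightarrow> 'k. scl (f 0) (funit 0)))"
proof -
  show 1: "act (mat_of (Suc 0) N (\<lambda>f. scl (f 0) (funit 0))) f = scl (f 0) (funit 0 :: nat \<Rightarrow> 'k)" if "f \<in> fspace N" for f :: "nat \<Rightarrow> 'k"
    by (rule mat_row_hom[OF _ _ that]) (simp_all add: fun_app)
  have "\<exists>f\<in>fspace N. act (mat_of (Suc 0) N (\<lambda>f :: nat \<Rightarrow> 'k. scl (f 0) (funit 0))) f = g" if "g \<in> fspace 1" for g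
  proof (intro bexI)
    have g: "g \<in> fspace N" using that assms by (auto simp: fspace_def)
    show "g \<in> fspace N" by (rule g)
    show "act (mat_of (Suc 0) N (\<lambda>f :: nat \<Rightarrow> 'k. scl (f 0) (funit 0))) g = g"
      unfolding 1[OF g] using that by (auto simp: fspace_def fun_eq_iff funit_def fun_app)
  qed
  then show "surj_mat (mat_of (Suc 0) N (\<lambda>f :: nat \<Rightarrow> 'k. scl (f 0) (funit 0)))"
    by (simp add: surj_mat_act[OF mat_of_carrier])
qed

context
  fixes P
  assumes P: "is_projective (Lam I) (Lam_scal I) P"
begin

lemma projective_fdmod: "is_fdmod (Lam I) (Lam_scal I) P"
  using P by (simp add: is_projective_def)

lemma projective_lift:
  assumes "is_fdmod (Lam I) (Lam_scal I) M" "is_fdmod (Lam I) (Lam_scal I) M'"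
    "is_mod_hom (Lam I) M M' g" "surj_mat g" "is_mod_hom (Lam I) P M' f"
  obtains h where "h \<in> carrier_mat (fst M) (fst P)"
    "\<And>t x. x \<in> fspace (fst P) \<Longrightarrow> act h (op I P t x) = op I M t (act h x)"
    "\<And>x. act g (act h x) = act f x"
proof -
  obtain h where h: "is_mod_hom (Lam I) P M h" "g * h = f" using P assms unfolding is_projective_def by blast
  have c: "h \<in> carrier_mat (fst M) (fst P)" "g \<in> carrier_mat (fst M') (fst M)"
    using h(1) assms(3) by (simp_all add: is_mod_hom_def)
  show thesis
    using that[OF c(1)] is_mod_hom_iff_gens(1)[OF I projective_fdmod assms(1) c(1)] h act_mult[OF c(2,1)] by metis
qed

text \<open>An \<open>x\<close> outside the span \<open>K\<close> of the images of \<beta> and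
  \<gamma> is detected by a map to the simple module at the vertex 2. Lifted to
  \<open>k[x]/(x^n)\<close>, it sends \<open>x\<close> to a unit, so \<beta>^(n-1)x survives; but
  \<gamma> acts there as zero, so the part generated at the vertex 3 goes to 0.\<close>

lemma projective_exact_mod:
  "exact_mod (op I P tb) (n - 1) 1 (Yset l (op I P tb) (op I P tg) (vsp I P te3)) (vsp I P te2)"
  unfolding exact_mod_def
proof (intro ballI impI)
  note PM = projective_fdmod
  note lin = flinD[OF flin_op[of I P]]
  let ?Y = "Yset l (op I P tb) (op I P tg) (vsp I P te3)"
  fix x assume x: "x \<in> vsp I P te2" and bx: "(op I P tb ^^ (n - 1)) x \<in> ?Y"
  define K where "K = {op I P tb y + op I P tg v | y v. y \<in> vsp I P te2 \<and> v \<in> vsp I P te3}"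
  have xN: "x \<in> fspace (fst P)" "op I P te2 x = x" using x by (simp_all add: vsp_def)
  have "x \<in> K"
  proof (rule ccontr)
    assume nK: "x \<notin> K"
    have K_I: "op I P tb f \<in> K" "op I P tg f \<in> K" for f
    proof -
      have "op I P tb (op I P te2 f) + op I P tg 0 \<in> K" "op I P tb 0 + op I P tg (op I P te3 f) \<in> K"
        unfolding K_def using vsp_te[OF PM] sgrpD(1)[OF sgrp_vsp[OF PM]] by blast+
      then show "op I P tb f \<in> K" "op I P tg f \<in> K" by (simp_all add: op_paths[OF PM] lin)
    qed
    obtain \<phi> :: "(nat \<Rightarrow> 'k) \<Rightarrow> 'k" where \<phi>: "\<And>f g. \<phi> (f + g) = \<phi> f + \<phi> g" "\<And>c f. \<phi> (scl c f) = c * \<phi> f"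
      "\<And>f. f \<in> K \<Longrightarrow> \<phi> f = 0" "\<phi> x = 1"
    proof (rule separating_functional[OF _ _ _ nK])
      show "0 \<in> K" using K_I(1)[of 0] by (simp add: lin)
      fix f g assume "f \<in> K" "g \<in> K"
      then obtain y v y' v' where *: "f = op I P tb y + op I P tg v" "g = op I P tb y' + op I P tg v'"
        "y \<in> vsp I P te2" "v \<in> vsp I P te3" "y' \<in> vsp I P te2" "v' \<in> vsp I P te3" unfolding K_def by blast
      have "f + g = op I P tb (y + y') + op I P tg (v + v')" by (simp add: * lin algebra_simps)
      then show "f + g \<in> K" unfolding K_def using * sgrpD(4)[OF sgrp_vsp[OF PM]] by blast
    next
      fix c f assume "f \<in> K"
      then obtain y v where *: "f = op I P tb y + op I P tg v"
        "y \<in> vsp I P te2" "v \<in> vsp I P te3" unfolding K_def by blast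
      have "scl c f = op I P tb (scl c y) + op I P tg (scl c v)" by (simp add: * lin scl_distrib)
      moreover have "scl c y \<in> vsp I P te2" "scl c v \<in> vsp I P te3" using * by (simp_all add: vsp_def lin)
      ultimately show "scl c f \<in> K" unfolding K_def by blast
    qed blast
    have \<phi>0: "\<phi> 0 = 0" using \<phi>(2)[of 0 0] by simp
    obtain S where S: "is_fdmod (Lam I) (Lam_scal I) S" "fst S = 1"
      "\<And>f. f \<in> fspace 1 \<Longrightarrow> op I S te1 f = 0" "\<And>f. f \<in> fspace 1 \<Longrightarrow> op I S te2 f = f"
      "\<And>f. f \<in> fspace 1 \<Longrightarrow> op I S te3 f = 0" "\<And>f. f \<in> fspace 1 \<Longrightarrow> op I S ta f = 0"
      "\<And>f. f \<in> fspace 1 \<Longrightarrow> op I S tb f = shift 0 1 f" "\<And>f. f \<in> fspace 1 \<Longrightarrow> op I S tg f = 0"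
      using uniserial_exists[of 1] n by auto
    obtain U where U: "is_fdmod (Lam I) (Lam_scal I) U" "fst U = n"
      "\<And>f. f \<in> fspace n \<Longrightarrow> op I U te1 f = 0" "\<And>f. f \<in> fspace n \<Longrightarrow> op I U te2 f = f"
      "\<And>f. f \<in> fspace n \<Longrightarrow> op I U te3 f = 0" "\<And>f. f \<in> fspace n \<Longrightarrow> op I U ta f = 0"
      "\<And>f. f \<in> fspace n \<Longrightarrow> op I U tb f = shift 0 n f" "\<And>f. f \<in> fspace n \<Longrightarrow> op I U tg f = 0"
      using uniserial_exists[of n] n by auto
    have sh: "shift 0 (Suc 0) f = 0" for f :: "nat \<Rightarrow> 'k" by (auto simp: shift_def fun_eq_iff fun_app)
    have u0: "scl c (funit 0) \<in> fspace 1" for c :: 'k by simp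
    let ?g = "mat_of (Suc 0) n (\<lambda>f :: nat \<Rightarrow> 'k. scl (f 0) (funit 0))"
    let ?\<psi> = "\<lambda>f. \<phi> (op I P te2 f)"
    let ?f = "mat_of (Suc 0) (fst P) (\<lambda>f. scl (?\<psi> f) (funit 0))"
    have 1: "1 \<le> n" using n by simp
    note g = row0_surj[OF 1]
    have f: "act ?f y = scl (?\<psi> y) (funit 0)" if "y \<in> fspace (fst P)" for y
      by (rule mat_row_hom[OF _ _ that]) (simp_all add: lin \<phi>)
    have g_hom: "is_mod_hom (Lam I) U S ?g"
      by (subst is_mod_hom_iff_gens(2)[OF I U(1) S(1)])
        (auto simp: U S g(1) sh flinD[OF flin_act[of ?g]] shift_0 fun_app fspace_shift)
    have f_hom: "is_mod_hom (Lam I) P S ?f"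
      by (subst is_mod_hom_iff_gens(2)[OF I PM S(1)])
        (auto simp: S f sh op_fspace[OF I PM] u0 op_paths[OF PM] \<phi> \<phi>0 K_I)
    obtain h where h: "h \<in> carrier_mat (fst U) (fst P)"
      "\<And>t x. x \<in> fspace (fst P) \<Longrightarrow> act h (op I P t x) = op I U t (act h x)" "\<And>x. act ?g (act h x) = act ?f x"
      using projective_lift[OF U(1) S(1) g_hom g(2) f_hom] by blast
    have hsp: "act h y \<in> fspace n" for y using act_fspace[OF h(1)] U(2) by simp
    have "scl (act h x 0) (funit 0) = scl 1 (funit 0)"
      using h(3)[of x] g(1)[OF hsp] f[OF xN(1)] xN(2) \<phi>(4) by simp
    then have hx: "act h x 0 = 1" by (metis funit_def mult.right_neutral scl_apply)
    have hb: "act h ((op I P tb ^^ i) y) = (shift 0 n ^^ i) (act h y)" if "y \<in> fspace (fst P)" for i y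
    proof (induction i)
      case (Suc i)
      have "(op I P tb ^^ i) y \<in> fspace (fst P)" by (cases i) (simp_all add: that op_fspace[OF I PM])
      then have "act h ((op I P tb ^^ Suc i) y) = shift 0 n (act h ((op I P tb ^^ i) y))"
        by (simp add: h(2) U(7) hsp)
      then show ?case using Suc by simp
    qed simp
    obtain v where v: "(op I P tb ^^ (n - 1)) x = (\<Sum>j<l. (op I P tb ^^ j) (op I P tg (v j)))"
      "\<forall>j<l. v j \<in> vsp I P te3" using bx by (rule YsetE)
    have "act h ((op I P tb ^^ (n - 1)) x) = (\<Sum>j<l. act h ((op I P tb ^^ j) (op I P tg (v j))))"
      unfolding v(1) by (rule flin_sum[OF flin_act])
    also have "\<dots> = (\<Sum>j<l. 0)"
    proof (rule sum.cong)
      fix j assume "j \<in> {..<l}"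
      then have vj: "v j \<in> fspace (fst P)" using v(2) by (simp add: vsp_def)
      show "act h ((op I P tb ^^ j) (op I P tg (v j))) = 0"
        unfolding hb[OF op_fspace[OF I PM]] h(2)[OF vj] U(8)[OF hsp] by (rule flinD(3)[OF flin_pow[OF flin_shift]])
    qed simp
    finally have "act h ((op I P tb ^^ (n - 1)) x) (n - 1) = 0" by (simp add: fun_app)
    moreover have "act h ((op I P tb ^^ (n - 1)) x) (n - 1) = 1"
      unfolding hb[OF xN(1)] using n hx by (simp add: shift_pow)
    ultimately show False by simp
  qed
  then obtain y v where yv: "x = op I P tb y + op I P tg v" "y \<in> vsp I P te2" "v \<in> vsp I P te3"
    unfolding K_def by blast
  \<comment> \<open>\<gamma>v is the term with j = 0, an admissible index because
    \<open>1 \<le> l\<close>.\<close>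
  let ?w = "\<lambda>j. if j = 0 then v else 0 :: nat \<Rightarrow> 'k"
  have "x - (op I P tb ^^ 1) y = op I P tg v" by (simp add: yv)
  also have "\<dots> = (\<Sum>j\<in>{0}. (op I P tb ^^ j) (op I P tg (?w j)))" by simp
  also have "\<dots> = (\<Sum>j<l. (op I P tb ^^ j) (op I P tg (?w j)))"
    by (rule sum.mono_neutral_left) (use l in \<open>auto simp: lin flinD[OF flin_pow[OF flin_op]]\<close>)
  also have "\<dots> \<in> ?Y"
    by (rule YsetI) (use yv(3) sgrpD(1)[OF sgrp_vsp[OF PM]] in simp)
  finally show "\<exists>x'\<in>vsp I P te2. x - (op I P tb ^^ 1) x' \<in> ?Y" using yv(2) by blast
qed

text \<open>Factors \<beta> are split off one at a time by the previous lemma: if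
  \<open>x = \<beta>^i x'\<close> modulo the generated part and i < n - 1, then \<beta>^(n-1)x' is
  congruent to a positive power of \<beta> applied to \<open>x\<close>, hence lies in that
  part.\<close>

lemma projective_exact_mod':
  "exact_mod (op I P tb) 1 (n - 1) (Yset l (op I P tb) (op I P tg) (vsp I P te3)) (vsp I P te2)"
  unfolding exact_mod_def
proof (intro ballI impI)
  note PM = projective_fdmod
  let ?b = "op I P tb"
  let ?Y = "Yset l ?b (op I P tg) (vsp I P te3)"
  note linb = flin_op[of I P tb] and ling = flin_op[of I P tg]
  note Y = sgrpD[OF sgrp_Yset[OF linb ling sgrp_vsp[OF PM]]]
  have Ym: "(?b ^^ i) y \<in> ?Y" if "y \<in> ?Y" for i y
    by (rule Yset_mult[OF linb ling sgrp_vsp[OF PM] op_nil(2)[OF PM] that])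
  fix x assume x: "x \<in> vsp I P te2" "(?b ^^ 1) x \<in> ?Y"
  have "\<exists>x'\<in>vsp I P te2. x - (?b ^^ i) x' \<in> ?Y" if "i \<le> n - 1" for i
    using that
  proof (induction i)
    case 0
    then show ?case using x(1) Y(1) by (intro bexI[of _ x]) simp_all
  next
    case (Suc i)
    then obtain x' where x': "x' \<in> vsp I P te2" "x - (?b ^^ i) x' \<in> ?Y" by auto
    have "(?b ^^ (n - 1)) x' = (?b ^^ (n - 1 - i)) ((?b ^^ i) x')"
      using Suc.prems funpow_add[of "n - 1 - i" i ?b] by simp
    also have "\<dots> = (?b ^^ (n - 1 - i)) x - (?b ^^ (n - 1 - i)) (x - (?b ^^ i) x')"
      by (simp add: flin_diff[OF flin_pow[OF linb]])
    also have "\<dots> \<in> ?Y"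
    proof (rule Y(2)[OF _ Ym[OF x'(2)]])
      have "n - 1 - i = Suc (n - 2 - i)" using Suc.prems by simp
      then have "(?b ^^ (n - 1 - i)) x = (?b ^^ (n - 2 - i)) ((?b ^^ 1) x)" by (simp add: funpow_swap1)
      then show "(?b ^^ (n - 1 - i)) x \<in> ?Y" using Ym[OF x(2)] by simp
    qed
    finally obtain x'' where x'': "x'' \<in> vsp I P te2" "x' - (?b ^^ 1) x'' \<in> ?Y"
      using projective_exact_mod x'(1) unfolding exact_mod_def by blast
    have eq: "x - (?b ^^ Suc i) x'' = (x - (?b ^^ i) x') + (?b ^^ i) (x' - (?b ^^ 1) x'')"
      by (simp add: flin_diff[OF flin_pow[OF linb]] funpow_swap1)
    have "x - (?b ^^ Suc i) x'' \<in> ?Y" unfolding eq by (rule Y(4)[OF x'(2) Ym[OF x''(2)]])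
    then show ?case using x''(1) by blast
  qed
  then show "\<exists>x'\<in>vsp I P te2. x - (?b ^^ (n - 1)) x' \<in> ?Y" by blast
qed

text \<open>A functional that is 1 on a nonzero \<open>v i\<close> gives a map to the simple module
  at the vertex 3. It lifts to the module with basis \<open>e_3\<close>, \<gamma>, ...,
  \<beta>^(l-1)\<gamma>, where the terms of the sum land on distinct basis vectors and the
  coefficient of \<beta>^i\<gamma> is 1.\<close>

lemma projective_torsionfree:
  assumes v: "\<forall>j<l. v j \<in> vsp I P te3" and sum: "(\<Sum>j<l. (op I P tb ^^ j) (op I P tg (v j))) = 0"
  shows "\<forall>j<l. v j = 0"
proof (rule ccontr)
  note PM = projective_fdmod
  note lin = flinD[OF flin_op[of I P]]
  assume "\<not> (\<forall>j<l. v j = 0)"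
  then obtain i where i: "i < l" "v i \<noteq> 0" by blast
  obtain \<phi> :: "(nat \<Rightarrow> 'k) \<Rightarrow> 'k" where \<phi>: "\<And>f g. \<phi> (f + g) = \<phi> f + \<phi> g" "\<And>c f. \<phi> (scl c f) = c * \<phi> f"
    "\<phi> (v i) = 1"
    by (rule separating_functional[of "{0}" "v i"]) (use i in auto)
  have \<phi>0: "\<phi> 0 = 0" using \<phi>(2)[of 0 0] by simp
  let ?R = "\<lambda>r (f :: nat \<Rightarrow> 'k). restr {1..r} (\<lambda>i. restr {1} (\<lambda>_. f 0) i)"
  obtain S where S: "is_fdmod (Lam I) (Lam_scal I) S" "fst S = Suc 0"
    "\<And>f. f \<in> fspace (Suc 0) \<Longrightarrow> op I S te1 f = 0"
    "\<And>f. f \<in> fspace (Suc 0) \<Longrightarrow> op I S te2 f = restr {1..0} f"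
    "\<And>f. f \<in> fspace (Suc 0) \<Longrightarrow> op I S te3 f = restr {0} f" "\<And>f. f \<in> fspace (Suc 0) \<Longrightarrow> op I S ta f = 0"
    "\<And>f. f \<in> fspace (Suc 0) \<Longrightarrow> op I S tb f = shift 1 (Suc 0) f"
    "\<And>f. f \<in> fspace (Suc 0) \<Longrightarrow> op I S tg f = ?R 0 f"
    using gamma_module_exists[of 0] by auto
  obtain V where V: "is_fdmod (Lam I) (Lam_scal I) V" "fst V = Suc l"
    "\<And>f. f \<in> fspace (Suc l) \<Longrightarrow> op I V te1 f = 0"
    "\<And>f. f \<in> fspace (Suc l) \<Longrightarrow> op I V te2 f = restr {1..l} f"
    "\<And>f. f \<in> fspace (Suc l) \<Longrightarrow> op I V te3 f = restr {0} f" "\<And>f. f \<in> fspace (Suc l) \<Longrightarrow> op I V ta f = 0"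
    "\<And>f. f \<in> fspace (Suc l) \<Longrightarrow> op I V tb f = shift 1 (Suc l) f"
    "\<And>f. f \<in> fspace (Suc l) \<Longrightarrow> op I V tg f = ?R l f"
    using gamma_module_exists[of l] by auto
  have sh: "shift (Suc 0) (Suc 0) f = 0" "restr {Suc 0..0} f = 0" "restr {} f = 0"
    "f \<in> fspace (Suc 0) \<Longrightarrow> restr {0} f = f"
    "restr {Suc 0..l} f \<in> fspace (Suc l)" "restr {0} f \<in> fspace (Suc l)"
    "restr {Suc 0..l} f 0 = 0" "restr {0} f 0 = f 0" for f :: "nat \<Rightarrow> 'k"
    by (auto simp: shift_def restr_def fun_eq_iff fun_app fspace_def)
  have u0: "scl c (funit 0) \<in> fspace (Suc 0)" for c :: 'k by simp
  let ?g = "mat_of (Suc 0) (Suc l) (\<lambda>f :: nat \<Rightarrow> 'k. scl (f 0) (funit 0))"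
  let ?\<psi> = "\<lambda>f. \<phi> (op I P te3 f)"
  let ?f = "mat_of (Suc 0) (fst P) (\<lambda>f. scl (?\<psi> f) (funit 0))"
  have 1: "1 \<le> Suc l" by simp
  note g = row0_surj[OF 1]
  have f: "act ?f y = scl (?\<psi> y) (funit 0)" if "y \<in> fspace (fst P)" for y
    by (rule mat_row_hom[OF _ _ that]) (simp_all add: lin \<phi>)
  have g_hom: "is_mod_hom (Lam I) V S ?g"
    by (subst is_mod_hom_iff_gens(2)[OF I V(1) S(1)])
      (auto simp: V S g(1) sh flinD[OF flin_act[of ?g]] shift_0 fun_app fspace_shift)
  have f_hom: "is_mod_hom (Lam I) P S ?f"
    by (subst is_mod_hom_iff_gens(2)[OF I PM S(1)])
      (auto simp: S f sh op_fspace[OF I PM] u0 op_paths[OF PM] \<phi> \<phi>0)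
  obtain h where h: "h \<in> carrier_mat (fst V) (fst P)"
    "\<And>t x. x \<in> fspace (fst P) \<Longrightarrow> act h (op I P t x) = op I V t (act h x)" "\<And>x. act ?g (act h x) = act ?f x"
    using projective_lift[OF V(1) S(1) g_hom g(2) f_hom] by blast
  have hsp: "act h y \<in> fspace (Suc l)" for y using act_fspace[OF h(1)] V(2) by simp
  have hv: "act h (v j) 0 = \<phi> (v j)" if "j < l" for j
  proof -
    have "v j \<in> fspace (fst P)" "op I P te3 (v j) = v j" using v that by (simp_all add: vsp_def)
    then have "scl (act h (v j) 0) (funit 0) = scl (\<phi> (v j)) (funit 0)"
      using h(3)[of "v j"] g(1)[OF hsp] f by simp
    then have "scl (act h (v j) 0) (funit 0) 0 = scl (\<phi> (v j)) (funit 0) 0" by (rule fun_cong)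
    then show ?thesis by (simp add: fun_app funit_def)
  qed
  have hb: "act h ((op I P tb ^^ i) y) = (shift 1 (Suc l) ^^ i) (act h y)" if "y \<in> fspace (fst P)" for i y
  proof (induction i)
    case (Suc i)
    have "(op I P tb ^^ i) y \<in> fspace (fst P)" by (cases i) (simp_all add: that op_fspace[OF I PM])
    then have "act h ((op I P tb ^^ Suc i) y) = shift 1 (Suc l) (act h ((op I P tb ^^ i) y))"
      by (simp add: h(2) V(7) hsp)
    then show ?case using Suc by simp
  qed simp
  \<comment> \<open>Coordinate 0 is \<open>e_3\<close>, so \<beta>^i\<gamma> sits at coordinate
    \<open>Suc i\<close>.\<close>
  have pw: "(shift 1 (Suc l) ^^ j) (?R l z) (Suc i) = (if j = i then z 0 else 0)" if "j < l" for z j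
    using that i by (cases "j = 0") (auto simp: shift_pow restr_def)
  have app: "(\<Sum>j\<in>T. k j) i = (\<Sum>j\<in>T. k j i)" for T :: "nat set" and k :: "nat \<Rightarrow> nat \<Rightarrow> 'k" and i
    by (induction T rule: infinite_finite_induct) (auto simp: fun_app)
  have "0 = act h (\<Sum>j<l. (op I P tb ^^ j) (op I P tg (v j)))"
    unfolding sum by (simp add: flinD[OF flin_act])
  also have "\<dots> = (\<Sum>j<l. act h ((op I P tb ^^ j) (op I P tg (v j))))" by (rule flin_sum[OF flin_act])
  also have "\<dots> = (\<Sum>j<l. (shift 1 (Suc l) ^^ j) (?R l (act h (v j))))"
  proof (rule sum.cong)
    fix j assume "j \<in> {..<l}"
    then have vj: "v j \<in> fspace (fst P)" using v by (simp add: vsp_def)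
    show "act h ((op I P tb ^^ j) (op I P tg (v j))) = (shift 1 (Suc l) ^^ j) (?R l (act h (v j)))"
      unfolding hb[OF op_fspace[OF I PM]] h(2)[OF vj] V(8)[OF hsp] ..
  qed simp
  finally have "0 = (\<Sum>j<l. (shift 1 (Suc l) ^^ j) (?R l (act h (v j)))) (Suc i)"
    by (metis zero_fun_apply)
  also have "\<dots> = (\<Sum>j<l. if j = i then act h (v j) 0 else 0)"
    unfolding app by (rule sum.cong) (use pw in auto)
  also have "\<dots> = 1" using i hv[of i] \<phi>(3) by simp
  finally show False by simp
qed

end

text \<open>Downward induction from the last kernel, which is zero, to the kernel of the
  augmentation. Both orders of the powers 1 and n - 1 are carried along because every step exchanges
  them. Each later image lies in a projective and so is torsion-free; the simple module is so
  trivially, its space at the vertex 3 being zero.\<close>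

lemma infinite_global_dimension_shape: "infinite_global_dimension (Lam I) (Lam_scal I)"
  unfolding infinite_global_dimension_def
proof
  fix r
  obtain S where S: "is_fdmod (Lam I) (Lam_scal I) S" "fst S = 1"
    "\<And>f. f \<in> fspace 1 \<Longrightarrow> op I S te1 f = 0" "\<And>f. f \<in> fspace 1 \<Longrightarrow> op I S te2 f = f"
    "\<And>f. f \<in> fspace 1 \<Longrightarrow> op I S te3 f = 0" "\<And>f. f \<in> fspace 1 \<Longrightarrow> op I S ta f = 0"
    "\<And>f. f \<in> fspace 1 \<Longrightarrow> op I S tb f = shift 0 1 f" "\<And>f. f \<in> fspace 1 \<Longrightarrow> op I S tg f = 0"
    using uniserial_exists[of 1] n by auto
  have "\<not> proj_dim_le (Lam I) (Lam_scal I) S r"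
  proof
    assume "proj_dim_le (Lam I) (Lam_scal I) S r"
    then obtain P d where P: "\<And>i. i \<le> r \<Longrightarrow> is_projective (Lam I) (Lam_scal I) (P i)"
      and d0: "is_mod_hom (Lam I) (P 0) S (d 0)"
      and d: "\<And>i. i \<in> {1..r} \<Longrightarrow> is_mod_hom (Lam I) (P i) (P (i - 1)) (d i)"
      and ex: "surj_mat (d 0)" "\<And>i. i < r \<Longrightarrow> exact_at (d (i + 1)) (d i)" "inj_mat (d r)"
      unfolding proj_dim_le_def by blast
    \<comment> \<open>The target of \<open>d i\<close>, so that the augmentation is treated like the
      other maps.\<close>
    define T where "T i = (if i = 0 then S else P (i - 1))" for i
    have TM: "is_fdmod (Lam I) (Lam_scal I) (T i)" if "i \<le> r" for i
      using that S(1) projective_fdmod[OF P] by (simp add: T_def)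
    note PM = projective_fdmod[OF P]
    have hom: "is_mod_hom (Lam I) (P i) (T i) (d i)" if "i \<le> r" for i
      using that d0 d[of i] by (simp add: T_def)
    have car: "d i \<in> carrier_mat (fst (T i)) (fst (P i))" if "i \<le> r" for i
      using hom[OF that] by (simp add: is_mod_hom_def)
    have comm: "act (d i) (op I (P i) t f) = op I (T i) t (act (d i) f)"
      if "i \<le> r" "f \<in> fspace (fst (P i))" for i t f
      using is_mod_hom_iff_gens(1)[OF I PM[OF that(1)] TM[OF that(1)] car[OF that(1)]] hom[OF that(1)] that(2) by blast
    define K where "K i e = {x \<in> vsp I (P i) e. act (d i) x = 0}" for i e
    define Z where "Z i e = act (d i) ` vsp I (P i) e" for i e
    have Zsub: "Z i e \<subseteq> vsp I (T i) e" if "i \<le> r" for i e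
    proof
      fix z assume "z \<in> Z i e"
      then obtain x where x: "x \<in> fspace (fst (P i))" "op I (P i) e x = x" "z = act (d i) x"
        by (auto simp: Z_def vsp_def)
      show "z \<in> vsp I (T i) e"
        using comm[OF that x(1), of e] act_fspace[OF car[OF that], of x] x(2,3) by (simp add: vsp_def)
    qed
    have ZI: "act (d i) f \<in> Z i e" if "i \<le> r" "e * e = e" "f \<in> fspace (fst (P i))" "act (d i) f \<in> vsp I (T i) e" for i e f
    proof -
      have "op I (P i) e f \<in> vsp I (P i) e"
        using op_mult[OF I PM[OF that(1)], of e e f] that(2) op_fspace[OF I PM[OF that(1)]] by (simp add: vsp_def)
      moreover have "act (d i) (op I (P i) e f) = act (d i) f"
        using comm[OF that(1,3), of e] that(4) by (simp add: vsp_def)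
      ultimately show ?thesis unfolding Z_def by (metis imageI)
    qed
    have Z0: "Z 0 e = vsp I S e" if "e * e = e" for e
    proof
      show "Z 0 e \<subseteq> vsp I S e" using Zsub[of 0 e] by (simp add: T_def)
      show "vsp I S e \<subseteq> Z 0 e"
      proof
        fix z assume z: "z \<in> vsp I S e"
        then obtain f where f: "f \<in> fspace (fst (P 0))" "act (d 0) f = z"
          using ex(1) surj_mat_act[OF car[of 0]] by (auto simp: vsp_def T_def)
        then show "z \<in> Z 0 e" using ZI[of 0 e f] that z by (simp add: T_def)
      qed
    qed
    have ZS: "Z (Suc i) e = K i e" if i: "Suc i \<le> r" and e: "e * e = e" for i e
    proof -
      have T: "T (Suc i) = P i" by (simp add: T_def)
      have c: "d (Suc i) \<in> carrier_mat (fst (P i)) (fst (P (Suc i)))" "d i \<in> carrier_mat (fst (T i)) (fst (P i))"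
        using car[of "Suc i"] car[of i] i T by simp_all
      have "exact_at (d (Suc i)) (d i)" using ex(2)[of i] i by simp
      note exact = exact_at_act[OF c this]
      show ?thesis
      proof
        show "Z (Suc i) e \<subseteq> K i e"
          using Zsub[OF i, of e] exact(1) unfolding K_def T by (auto simp: Z_def)
        show "K i e \<subseteq> Z (Suc i) e"
        proof
          fix x assume x: "x \<in> K i e"
          then obtain f where f: "f \<in> fspace (fst (P (Suc i)))" "act (d (Suc i)) f = x"
            using exact(2)[of x] by (auto simp: K_def vsp_def)
          show "x \<in> Z (Suc i) e" using ZI[OF i e f(1)] f(2) x T by (simp add: K_def)
        qed
      qed
    qed
    have idem: "te2 * te2 = (te2 :: 'k tri)" "te3 * te3 = (te3 :: 'k tri)" by (simp_all add: times_tri_def)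
    have chase: "exact_mod (op I (T i) tb) p q (Yset l (op I (T i) tb) (op I (T i) tg) (Z i te3)) (Z i te2)"
      if i: "i \<le> r" and pq: "p + q = n"
        and HP: "exact_mod (op I (P i) tb) p q (Yset l (op I (P i) tb) (op I (P i) tg) (vsp I (P i) te3)) (vsp I (P i) te2)"
        and HK: "exact_mod (op I (P i) tb) q p (Yset l (op I (P i) tb) (op I (P i) tg) (K i te3)) (K i te2)"
        and TF: "\<And>w. \<forall>j<l. w j \<in> Z i te3 \<Longrightarrow> (\<Sum>j<l. (op I (T i) tb ^^ j) (op I (T i) tg (w j))) = 0 \<Longrightarrow> \<forall>j<l. w j = 0"
      for i p q
    proof (rule exact_mod_chase[where d = "act (d i)" and ?X2.0 = "vsp I (P i) te2" and ?X3.0 = "vsp I (P i) te3"])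
      note PM' = PM[OF i]
      show "sgrp (vsp I (P i) te2)" "sgrp (vsp I (P i) te3)" by (rule sgrp_vsp[OF PM'])+
      show "op I (P i) tb x \<in> vsp I (P i) te2" "op I (P i) tg x \<in> vsp I (P i) te2" for x
        by (rule vsp_arrows[OF PM'])+
      show "(op I (P i) tb ^^ (p + q)) x = 0" for x unfolding pq by (rule op_nil(1)[OF PM'])
      show "(op I (P i) tb ^^ l) (op I (P i) tg v) = 0" for v by (rule op_nil(2)[OF PM'])
      show "act (d i) (op I (P i) tb x) = op I (T i) tb (act (d i) x)" if "x \<in> vsp I (P i) te2" for x
        using comm[OF i] that by (simp add: vsp_def)
      show "act (d i) (op I (P i) tg x) = op I (T i) tg (act (d i) x)" if "x \<in> vsp I (P i) te3" for x
        using comm[OF i] that by (simp add: vsp_def)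
      show "act (d i) ` vsp I (P i) te2 = Z i te2" "act (d i) ` vsp I (P i) te3 = Z i te3" by (simp_all add: Z_def)
      show "exact_mod (op I (P i) tb) q p (Yset l (op I (P i) tb) (op I (P i) tg)
          {v \<in> vsp I (P i) te3. act (d i) v = 0}) {x \<in> vsp I (P i) te2. act (d i) x = 0}"
        using HK unfolding K_def .
    qed (rule flin_op flin_act HP TF; assumption)+
    have pq: "1 + (n - 1) = n" "(n - 1) + 1 = n" using n by simp_all
    define Q where "Q i \<longleftrightarrow> exact_mod (op I (P i) tb) 1 (n - 1) (Yset l (op I (P i) tb) (op I (P i) tg) (K i te3)) (K i te2) \<and>
      exact_mod (op I (P i) tb) (n - 1) 1 (Yset l (op I (P i) tb) (op I (P i) tg) (K i te3)) (K i te2)" for i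
    have "Q 0"
    proof (rule inc_induct[of 0 r])
      have K0: "x = 0" if "x \<in> K r e" for x e
        using inj_mat_act[OF car[OF order_refl] ex(3)] that by (auto simp: K_def vsp_def)
      have K: "sgrp (K r e)" for e
        by (auto simp: sgrp_def K_def vsp_def flinD[OF flin_op[of I "P r"]] flin_diff[OF flin_op]
            flinD[OF flin_act[of "d r"]] flin_diff[OF flin_act])
      have "exact_mod (op I (P r) tb) p q (Yset l (op I (P r) tb) (op I (P r) tg) (K r te3)) (K r te2)" for p q
        unfolding exact_mod_def
      proof (intro ballI impI bexI)
        fix x assume "x \<in> K r te2"
        then have "x = 0" by (rule K0)
        then have "x - (op I (P r) tb ^^ q) 0 = 0"
          by (simp add: flinD(3)[OF flin_pow[OF flin_op]])
        then show "x - (op I (P r) tb ^^ q) 0 \<in> Yset l (op I (P r) tb) (op I (P r) tg) (K r te3)"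
          using sgrpD(1)[OF sgrp_Yset[OF flin_op flin_op K]] by (simp only:)
      qed (rule sgrpD(1)[OF K])
      then show "Q r" unfolding Q_def by blast
    next
      fix i assume i: "i < r" and Q: "Q (Suc i)"
      have Si: "Suc i \<le> r" and T: "T (Suc i) = P i" using i by (simp_all add: T_def)
      have TF: "\<forall>j<l. w j = 0" if "\<forall>j<l. w j \<in> Z (Suc i) te3"
        "(\<Sum>j<l. (op I (T (Suc i)) tb ^^ j) (op I (T (Suc i)) tg (w j))) = 0" for w
        using projective_torsionfree[OF P[of i], of w] that i Zsub[OF Si, of te3] unfolding T by auto
      show "Q i"
        unfolding Q_def ZS[OF Si idem(1), symmetric] ZS[OF Si idem(2), symmetric]
      proof
        show "exact_mod (op I (P i) tb) 1 (n - 1) (Yset l (op I (P i) tb) (op I (P i) tg) (Z (Suc i) te3)) (Z (Suc i) te2)"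
          using chase[OF Si pq(1) projective_exact_mod'[OF P[OF Si]] Q[unfolded Q_def, THEN conjunct2] TF] unfolding T .
        show "exact_mod (op I (P i) tb) (n - 1) 1 (Yset l (op I (P i) tb) (op I (P i) tg) (Z (Suc i) te3)) (Z (Suc i) te2)"
          using chase[OF Si pq(2) projective_exact_mod[OF P[OF Si]] Q[unfolded Q_def, THEN conjunct1] TF] unfolding T .
      qed
    qed simp
    have "\<forall>x\<in>vsp I S te3. x = 0"
      using S by (auto simp: vsp_def)
    then have Z3: "\<forall>x\<in>Z 0 te3. x = 0" using Z0[OF idem(2)] by simp
    have "exact_mod (op I (T 0) tb) 1 (n - 1) (Yset l (op I (T 0) tb) (op I (T 0) tg) (Z 0 te3)) (Z 0 te2)"
      by (rule chase[OF _ pq(1) projective_exact_mod'[OF P]]) (use \<open>Q 0\<close> Z3 in \<open>auto simp: Q_def\<close>)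
    then have E: "exact_mod (op I S tb) 1 (n - 1) (Yset l (op I S tb) (op I S tg) (Z 0 te3)) (vsp I S te2)"
      by (simp add: T_def Z0[OF idem(1)])
    have Y0: "y = 0" if y: "y \<in> Yset l (op I S tb) (op I S tg) (Z 0 te3)" for y
    proof -
      obtain v where v: "y = (\<Sum>j<l. (op I S tb ^^ j) (op I S tg (v j)))" "\<forall>j<l. v j \<in> Z 0 te3"
        using y by (rule YsetE)
      have "(op I S tb ^^ j) (op I S tg (v j)) = 0" if "j < l" for j
      proof -
        have "v j = 0" using v(2) Z3 that by blast
        then show ?thesis by (simp add: flinD[OF flin_op[of I S]] flinD[OF flin_pow[OF flin_op[of I S]]])
      qed
      then show ?thesis unfolding v(1) by simp
    qed
    have sh: "op I S tb f = 0" if "f \<in> fspace 1" for f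
      using S(7)[OF that] by (auto simp: shift_def fun_eq_iff fun_app)
    have u: "funit 0 \<in> vsp I S te2" using S by (simp add: vsp_def)
    have "0 \<in> Yset l (op I S tb) (op I S tg) (Z 0 te3)"
      by (rule sgrpD(1)[OF sgrp_Yset[OF flin_op flin_op]]) (simp add: Z0[OF idem(2)] sgrp_vsp[OF S(1)])
    then have "(op I S tb ^^ 1) (funit 0) \<in> Yset l (op I S tb) (op I S tg) (Z 0 te3)" by (simp add: sh)
    then obtain x where x: "x \<in> vsp I S te2"
      "funit 0 - (op I S tb ^^ (n - 1)) x \<in> Yset l (op I S tb) (op I S tg) (Z 0 te3)"
      using E u unfolding exact_mod_def by blast
    \<comment> \<open>\<beta> kills the simple module, so exactness asks its generator to be a
      multiple of \<beta>^(n-1), a positive power that is zero as well.\<close>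
    have "n - 1 = Suc (n - 2)" using n by simp
    then have "(op I S tb ^^ (n - 1)) x = (op I S tb ^^ (n - 2)) (op I S tb x)" by (simp add: funpow_swap1)
    also have "\<dots> = 0"
      using sh[of x] x(1) S(2) by (simp add: vsp_def flinD[OF flin_pow[OF flin_op]])
    finally have "funit 0 = (0 :: nat \<Rightarrow> 'k)" using Y0[OF x(2)] by simp
    then have "funit 0 0 = (0 :: nat \<Rightarrow> 'k) 0" by (rule fun_cong)
    then show False by (simp add: funit_def fun_app)
  qed
  then show "\<exists>M. is_fdmod (Lam I) (Lam_scal I) M \<and> \<not> proj_dim_le (Lam I) (Lam_scal I) M r" using S(1) by blast
qed

end

section \<open>Infinite representation type\<close>

text \<open>The centraliser of the block is the local ring \<open>k[x]/(x^m)\<close>. Its residue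
  map, the coefficient of \<open>funit 0\<close> in \<open>e (funit 0)\<close>, takes an idempotent
  to 0 or 1. If it is 0, then \<open>e\<close> increases the number of leading zero coordinates, and
  an idempotent doing so is zero; if it is 1, the same holds for 1 - e.\<close>

lemma jordan_block_idempotent:
  fixes e :: "(nat \<Rightarrow> 'k::field) \<Rightarrow> nat \<Rightarrow> 'k"
  assumes m: "0 < m" and lin: "flin e" and sp: "\<And>f. f \<in> fspace m \<Longrightarrow> e f \<in> fspace m"
    and comm: "\<And>f. f \<in> fspace m \<Longrightarrow> e (shift 0 m f) = shift 0 m (e f)"
    and idem: "\<And>f. f \<in> fspace m \<Longrightarrow> e (e f) = e f"
  shows "(\<forall>f\<in>fspace m. e f = 0) \<or> (\<forall>f\<in>fspace m. e f = f)"
proof -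
  have ex: "\<exists>g. g \<in> fspace m \<and> f = scl (f 0) (funit 0) + shift 0 m g \<and>
      (\<forall>j. g j = (if Suc j < m then f (Suc j) else 0))"
    if "f \<in> fspace m" for f :: "nat \<Rightarrow> 'k"
  proof (intro exI conjI)
    let ?g = "\<lambda>j. if Suc j < m then f (Suc j) else 0"
    show "?g \<in> fspace m" by (auto simp: fspace_def)
    show "f = scl (f 0) (funit 0) + shift 0 m ?g"
      using that m by (auto simp: fun_eq_iff fun_app funit_def shift_def fspace_def)
  qed auto
  have at0: "e f 0 = f 0 * e (funit 0) 0"
    if e: "flin e" "\<And>f. f \<in> fspace m \<Longrightarrow> e (shift 0 m f) = shift 0 m (e f)" and f: "f \<in> fspace m"
    for e :: "(nat \<Rightarrow> 'k) \<Rightarrow> nat \<Rightarrow> 'k" and f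
  proof -
    obtain g where g: "g \<in> fspace m" "f = scl (f 0) (funit 0) + shift 0 m g" using ex[OF f] by blast
    have "e f = scl (f 0) (e (funit 0)) + shift 0 m (e g)"
      by (subst g(2)) (simp only: flinD[OF e(1)] e(2)[OF g(1)])
    then show ?thesis by (simp add: fun_app shift_0)
  qed
  have vanish: "\<forall>f\<in>fspace m. e f = 0"
    if e: "flin e" "\<And>f. f \<in> fspace m \<Longrightarrow> e f \<in> fspace m"
      "\<And>f. f \<in> fspace m \<Longrightarrow> e (shift 0 m f) = shift 0 m (e f)"
      "\<And>f. f \<in> fspace m \<Longrightarrow> e (e f) = e f" and e0: "e (funit 0) 0 = 0"
    for e :: "(nat \<Rightarrow> 'k) \<Rightarrow> nat \<Rightarrow> 'k"
  proof
    have level: "f \<in> fspace m \<Longrightarrow> \<forall>j<i. f j = 0 \<Longrightarrow> \<forall>j<Suc i. e f j = 0" for f i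
    proof (induction i arbitrary: f)
      case 0
      then show ?case using at0[OF e(1,3)] e0 by simp
    next
      case (Suc i)
      obtain g where g: "g \<in> fspace m" "f = scl (f 0) (funit 0) + shift 0 m g"
        "\<And>j. g j = (if Suc j < m then f (Suc j) else 0)"
        using ex[OF Suc(2)] by blast
      have "f = shift 0 m g" using g(2) Suc(3) by (simp add: scl_simps)
      then have "e f = shift 0 m (e g)" using e(3)[OF g(1)] by metis
      moreover have "\<forall>j<Suc i. e g j = 0" by (rule Suc.IH[OF g(1)]) (use Suc(3) g(3) in simp)
      ultimately show ?case by (auto simp: shift_def)
    qed
    fix f :: "nat \<Rightarrow> 'k" assume f: "f \<in> fspace m"
    have "\<forall>j<i. e f j = 0" for i
    proof (induction i)
      case (Suc i)
      show ?case using level[OF e(2)[OF f] Suc] e(4)[OF f] by simp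
    qed simp
    then show "e f = 0" by (metis ext lessI zero_fun_apply)
  qed
  have u: "funit 0 \<in> fspace m" using m by simp
  define c where "c = e (funit 0) 0"
  have "c * c = c"
    using at0[OF lin comm sp[OF u]] idem[OF u] by (simp add: c_def)
  then consider "c = 0" | "c = 1" by (metis mult_cancel_right1 mult_eq_0_iff)
  then show ?thesis
  proof cases
    case 1
    then show ?thesis using vanish[OF lin sp comm idem] by (simp add: c_def)
  next
    case 2
    define e' where "e' f = f - e f" for f
    have "\<forall>f\<in>fspace m. e' f = 0"
    proof (rule vanish)
      show "flin e'"
        by (auto simp: e'_def flin_def flinD[OF lin] scl_distrib algebra_simps fun_eq_iff fun_app)
      show "e' f \<in> fspace m" if "f \<in> fspace m" for f using that sp by (simp add: e'_def)
      show "e' (shift 0 m f) = shift 0 m (e' f)" if "f \<in> fspace m" for f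
        using that comm by (simp add: e'_def flin_diff[OF flin_shift])
      show "e' (e' f) = e' f" if "f \<in> fspace m" for f
        using that idem by (simp add: e'_def flin_diff[OF lin])
      show "e' (funit 0) 0 = 0" using 2 by (simp add: e'_def fun_app c_def funit_def)
    qed
    then show ?thesis by (simp add: e'_def)
  qed
qed

text \<open>Padding both matrices to size c makes the left inverse two-sided, but the padded
  \<open>T\<close> never reaches coordinate r.\<close>

lemma no_retract_smaller:
  fixes T S :: "'k::field mat"
  assumes T: "T \<in> carrier_mat r c" and S: "S \<in> carrier_mat c r" and ST: "S * T = 1\<^sub>m c"
  shows "c \<le> r"
proof (rule ccontr)
  assume "\<not> c \<le> r"
  then have rc: "r < c" by simp
  have sub: "fspace r \<subseteq> (fspace c :: (nat \<Rightarrow> 'k) set)" using rc by (auto simp: fspace_def)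
  define T' where "T' = mat_of c c (act T)"
  define S' where "S' = mat_of c c (act S)"
  have T': "act T' f = act T f" if "f \<in> fspace c" for f
    unfolding T'_def by (rule act_mat_of[OF flin_act that]) (use sub act_fspace[OF T] in blast)
  have S': "act S' f = act S f" if "f \<in> fspace c" for f
    unfolding S'_def by (rule act_mat_of[OF flin_act that]) (rule act_fspace[OF S])
  have c: "T' \<in> carrier_mat c c" "S' \<in> carrier_mat c c" by (simp_all add: T'_def S'_def)
  have "S' * T' = 1\<^sub>m c"
  proof (rule mat_eq_actI)
    fix f :: "nat \<Rightarrow> 'k" assume f: "f \<in> fspace c"
    have "act T f \<in> fspace c" using sub act_fspace[OF T] by blast
    then have "act (S' * T') f = act (S * T) f"
      by (simp add: act_mult[OF c(2,1)] act_mult[OF S T] T' S' f)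
    then show "act (S' * T') f = act (1\<^sub>m c) f" by (simp add: ST)
  qed (use c in auto)
  then have "T' * S' = 1\<^sub>m c" using mat_mult_left_right_inverse[OF c(2,1)] by blast
  then have "act T' (act S' (funit r)) = funit r"
    using act_mult[OF c, of "funit r"] rc by (simp add: act_one)
  then have "act T (act S (funit r)) = (funit r :: nat \<Rightarrow> 'k)"
    using S' T' act_fspace[OF S] rc by simp
  then have "funit r \<in> (fspace r :: (nat \<Rightarrow> 'k) set)" using act_fspace[OF T] by metis
  then have "funit r r = (0 :: 'k)" unfolding fspace_def mem_Collect_eq by blast
  then show False by (simp add: funit_def)
qed

text \<open>Eight blocks of length \<open>m\<close>, interleaved.\<close>
definition tup :: "nat \<Rightarrow> (nat \<Rightarrow> 'k::field) \<Rightarrow> (nat \<Rightarrow> 'k) \<Rightarrow> (nat \<Rightarrow> 'k) \<Rightarrow> (nat \<Rightarrow> 'k) \<Rightarrow> (nat \<Rightarrow> 'k) \<Rightarrow>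
    (nat \<Rightarrow> 'k) \<Rightarrow> (nat \<Rightarrow> 'k) \<Rightarrow> (nat \<Rightarrow> 'k) \<Rightarrow> nat \<Rightarrow> 'k" where
  "tup m s p q r u t v w = (\<lambda>i. if i < 8 * m then ([s, p, q, r, u, t, v, w] ! (i mod 8)) (i div 8) else 0)"

definition blk :: "nat \<Rightarrow> nat \<Rightarrow> (nat \<Rightarrow> 'k::field) \<Rightarrow> nat \<Rightarrow> 'k" where
  "blk m b f = (\<lambda>j. if j < m then f (8 * j + b) else 0)"

lemma flin_blk: "flin (blk m b)"
  by (auto simp: flin_def blk_def fun_eq_iff fun_app)

lemma blk_fspace [simp]: "blk m b f \<in> fspace m"
  by (simp add: blk_def fspace_def)

lemma tup_fspace [simp]: "tup m s p q r u t v w \<in> fspace (8 * m)"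
  by (simp add: tup_def fspace_def)

lemma less_8_cases: "(i :: nat) < 8 \<Longrightarrow> i \<in> {0, 1, 2, 3, 4, 5, 6, 7}"
  by auto

lemma blk_tup':
  "b < 8 \<Longrightarrow> blk m b (tup m s p q r u t v w) = (\<lambda>j. if j < m then ([s, p, q, r, u, t, v, w] ! b) j else 0)"
  by (auto simp: blk_def tup_def fun_eq_iff)

lemma blk_tup:
  "s \<in> fspace m \<Longrightarrow> blk m 0 (tup m s p q r u t v w) = s"
  "p \<in> fspace m \<Longrightarrow> blk m (Suc 0) (tup m s p q r u t v w) = p"
  "q \<in> fspace m \<Longrightarrow> blk m 2 (tup m s p q r u t v w) = q"
  "r \<in> fspace m \<Longrightarrow> blk m 3 (tup m s p q r u t v w) = r"
  "u \<in> fspace m \<Longrightarrow> blk m 4 (tup m s p q r u t v w) = u"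
  "t \<in> fspace m \<Longrightarrow> blk m 5 (tup m s p q r u t v w) = t"
  "v \<in> fspace m \<Longrightarrow> blk m 6 (tup m s p q r u t v w) = v"
  "w \<in> fspace m \<Longrightarrow> blk m 7 (tup m s p q r u t v w) = w"
  by (subst blk_tup', simp, simp add: fspace_def fun_eq_iff)+

lemma tup_inject:
  assumes "tup m s p q r u t v w = tup m s' p' q' r' u' t' v' w'"
    and "s \<in> fspace m" "p \<in> fspace m" "q \<in> fspace m" "r \<in> fspace m" "u \<in> fspace m" "t \<in> fspace m"
      "v \<in> fspace m" "w \<in> fspace m"
    and "s' \<in> fspace m" "p' \<in> fspace m" "q' \<in> fspace m" "r' \<in> fspace m" "u' \<in> fspace m" "t' \<in> fspace m"
      "v' \<in> fspace m" "w' \<in> fspace m"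
  shows "s = s' \<and> p = p' \<and> q = q' \<and> r = r' \<and> u = u' \<and> t = t' \<and> v = v' \<and> w = w'"
proof -
  have "blk m i (tup m s p q r u t v w) = blk m i (tup m s' p' q' r' u' t' v' w')" for i
    by (simp only: assms(1))
  from this[of 0] this[of "Suc 0"] this[of 2] this[of 3] this[of 4] this[of 5] this[of 6] this[of 7]
  show ?thesis using assms(2-) by (simp add: blk_tup)
qed

lemma tup_blk:
  assumes "f \<in> fspace (8 * m)"
  shows "tup m (blk m 0 f) (blk m 1 f) (blk m 2 f) (blk m 3 f) (blk m 4 f) (blk m 5 f) (blk m 6 f)
    (blk m 7 f) = f"
proof
  fix i :: nat
  define j b where "j = i div 8" and "b = i mod 8"
  have i: "i = 8 * j + b" "b < 8" by (simp_all add: j_def b_def)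
  have "b \<in> {0, 1, 2, 3, 4, 5, 6, 7}" by (rule less_8_cases[OF i(2)])
  moreover have "i div 8 = j" "i mod 8 = b" "i < 8 * m \<longleftrightarrow> j < m" using i by auto
  ultimately show "tup m (blk m 0 f) (blk m 1 f) (blk m 2 f) (blk m 3 f) (blk m 4 f) (blk m 5 f)
      (blk m 6 f) (blk m 7 f) i = f i"
    using assms i(1) by (auto simp: tup_def blk_def fspace_def)
qed

lemma tup_add: "tup m s p q r u t v w + tup m s' p' q' r' u' t' v' w'
  = tup m (s + s') (p + p') (q + q') (r + r') (u + u') (t + t') (v + v') (w + w')"
proof
  fix i :: nat
  have "i mod 8 \<in> {0, 1, 2, 3, 4, 5, 6, 7}" by (rule less_8_cases) simp
  then show "(tup m s p q r u t v w + tup m s' p' q' r' u' t' v' w') i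
    = tup m (s + s') (p + p') (q + q') (r + r') (u + u') (t + t') (v + v') (w + w') i"
    by (auto simp: tup_def fun_app)
qed

lemma scl_tup: "scl a (tup m s p q r u t v w)
  = tup m (scl a s) (scl a p) (scl a q) (scl a r) (scl a u) (scl a t) (scl a v) (scl a w)"
proof
  fix i :: nat
  have "i mod 8 \<in> {0, 1, 2, 3, 4, 5, 6, 7}" by (rule less_8_cases) simp
  then show "scl a (tup m s p q r u t v w) i
    = tup m (scl a s) (scl a p) (scl a q) (scl a r) (scl a u) (scl a t) (scl a v) (scl a w) i"
    by (auto simp: tup_def fun_app)
qed

lemma tup_zero: "tup m 0 0 0 0 0 0 0 0 = 0"
  using scl_tup[of 0 m 0 0 0 0 0 0 0 0] by simp

text \<open>The push-down of a representation of the extended Dynkin quiver \<open>D\<^sub>5\<close> inside the universal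
  cover \<open>\<cdots> \<rightarrow> 2 \<rightarrow> 2 \<rightarrow> 2 \<rightarrow> \<cdots>\<close>, whose two middle spaces are \<open>k\<^sup>m \<oplus> k\<^sup>m\<close>: the four outer vertices give two
  subspaces and two quotients, in relative position prescribed by a nilpotent Jordan block. The blocks are
  the spaces \<open>s \<rightarrow> (p, q) \<rightarrow> (r, u) \<rightarrow> t\<close> at the vertex 2 and \<open>v\<close>, \<open>w\<close> at the vertices 1, 3.\<close>

definition dE1 where "dE1 m f = tup m 0 0 0 0 0 0 (blk m 6 f) 0"
definition dE2 where "dE2 m f = tup m (blk m 0 f) (blk m 1 f) (blk m 2 f) (blk m 3 f) (blk m 4 f) (blk m 5 f) 0 0"
definition dE3 where "dE3 m f = tup m 0 0 0 0 0 0 0 (blk m 7 f)"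
definition dA where "dA m f = tup m 0 0 0 0 0 0 (blk m 1 f) 0"
text \<open>After identifying the two middle spaces, the images of \<open>s\<close> and
  \<open>w\<close> and the kernels of the maps to \<open>v\<close> and \<open>t\<close> are
  \<open>k^m + 0\<close>, the diagonal, \<open>0 + k^m\<close> and the graph of the Jordan block: a
  classical quadruple of subspaces.\<close>

definition dB where "dB m f = tup m 0 (blk m 0 f) 0 (blk m 1 f) (blk m 2 f) (blk m 4 f - shift 0 m (blk m 3 f)) 0 0"
definition dG where "dG m f = tup m 0 0 0 (blk m 7 f) (blk m 7 f) 0 0 0"

lemmas d_defs = dE1_def dE2_def dE3_def dA_def dB_def dG_def

lemma flin_d: "flin (dE1 m)" "flin (dE2 m)" "flin (dE3 m)" "flin (dA m)" "flin (dB m)" "flin (dG m)"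
  unfolding flin_def d_defs
  by (simp_all add: tup_add scl_tup flinD[OF flin_blk[of m]] flinD[OF flin_shift[of 0 m]] flin_diff[OF flin_shift[of 0 m]]
      fn.scale_right_diff_distrib algebra_simps)

lemma shift_fspace_self [simp]: "shift a m f \<in> fspace m"
  by (rule fspace_shift) simp

lemma d_tup:
  assumes "s \<in> fspace m" "p \<in> fspace m" "q \<in> fspace m" "r \<in> fspace m" "u \<in> fspace m" "t \<in> fspace m"
    "v \<in> fspace m" "w \<in> fspace m"
  shows "dE1 m (tup m s p q r u t v w) = tup m 0 0 0 0 0 0 v 0"
    "dE2 m (tup m s p q r u t v w) = tup m s p q r u t 0 0"
    "dE3 m (tup m s p q r u t v w) = tup m 0 0 0 0 0 0 0 w"
    "dA m (tup m s p q r u t v w) = tup m 0 0 0 0 0 0 p 0"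
    "dB m (tup m s p q r u t v w) = tup m 0 s 0 p q (u - shift 0 m r) 0 0"
    "dG m (tup m s p q r u t v w) = tup m 0 0 0 w w 0 0 0"
  using assms by (simp_all add: d_defs blk_tup)

lemma d_fspace: "dE1 m f \<in> fspace (8 * m)" "dE2 m f \<in> fspace (8 * m)" "dE3 m f \<in> fspace (8 * m)"
  "dA m f \<in> fspace (8 * m)" "dB m f \<in> fspace (8 * m)" "dG m f \<in> fspace (8 * m)"
  by (simp_all add: d_defs)

text \<open>\<beta> runs through the four layers s, (p, q), (r, u), t; this is the source of the
  bound 4 \<le> n.\<close>

lemma dB_pow4: "4 \<le> i \<Longrightarrow> (dB m ^^ i) f = 0"
proof -
  assume "4 \<le> i"
  have "(dB m ^^ 4) f = 0"
    by (simp add: numeral_eq_Suc) (simp add: dB_def[of m f] d_tup tup_zero flinD[OF flin_shift])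
  moreover have "(dB m ^^ i) f = (dB m ^^ (i - 4)) ((dB m ^^ 4) f)"
    using \<open>4 \<le> i\<close> by (metis comp_apply funpow_add le_add_diff_inverse2)
  ultimately show ?thesis using flinD(3)[OF flin_pow[OF flin_d(5)]] by simp
qed

lemma d5_quiver_rep: "quiver_rep (8 * m) (dE1 m) (dE2 m) (dE3 m) (dA m) (dB m) (dG m)"
proof
  show "dE1 m f + dE2 m f + dE3 m f = f" if "f \<in> fspace (8 * m)" for f :: "nat \<Rightarrow> 'a"
    using tup_blk[OF that] by (simp add: d_defs tup_add)
  show "dA m ((dB m ^^ i) (dG m f)) = 0" for i and f :: "nat \<Rightarrow> 'a"
  proof -
    have "blk m 0 ((dB m ^^ i) (dG m f)) = 0 \<and> blk m 1 ((dB m ^^ i) (dG m f)) = 0"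
    proof (induction i)
      case 0
      then show ?case by (simp add: dG_def blk_tup)
    next
      case (Suc i)
      have "blk m 0 (dB m h) = 0" "blk m 1 (dB m h) = blk m 0 h" for h :: "nat \<Rightarrow> 'a"
        by (simp_all add: dB_def blk_tup)
      then show ?case using Suc by (simp)
    qed
    then show ?thesis by (simp add: dA_def tup_zero)
  qed
qed (simp_all add: flin_d d_fspace dE1_def[of m] dE2_def[of m] dE3_def[of m] dA_def[of m] dB_def[of m] dG_def[of m]
    blk_tup tup_zero)

section \<open>Endomorphisms of the pushed-down modules\<close>

definition d5_endo :: "nat \<Rightarrow> ((nat \<Rightarrow> 'k::field) \<Rightarrow> nat \<Rightarrow> 'k) \<Rightarrow> bool" where
  "d5_endo m e \<longleftrightarrow> flin e \<and> (\<forall>f\<in>fspace (8 * m). e f \<in> fspace (8 * m) \<and> e (dE1 m f) = dE1 m (e f) \<and>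
     e (dE2 m f) = dE2 m (e f) \<and> e (dE3 m f) = dE3 m (e f) \<and> e (dA m f) = dA m (e f) \<and>
     e (dB m f) = dB m (e f) \<and> e (dG m f) = dG m (e f))"

text \<open>The block \<open>\<epsilon>\<close> at the vertex 3 determines an endomorphism up to a nilpotent one.\<close>
lemma d5_endo_structure:
  fixes e :: "(nat \<Rightarrow> 'k::field) \<Rightarrow> nat \<Rightarrow> 'k"
  assumes e: "d5_endo m e"
  shows "\<exists>\<epsilon>. flin \<epsilon> \<and> (\<forall>x. \<epsilon> x \<in> fspace m) \<and>
    (\<forall>x\<in>fspace m. e (tup m 0 0 0 0 0 0 0 x) = tup m 0 0 0 0 0 0 0 (\<epsilon> x)) \<and>
    (\<forall>x\<in>fspace m. \<epsilon> (shift 0 m x) = shift 0 m (\<epsilon> x)) \<and>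
    ((\<forall>x\<in>fspace m. \<epsilon> x = 0) \<longrightarrow> (\<forall>f\<in>fspace (8 * m). e (e (e (e f))) = 0))"
proof -
  have lin: "flin e" using e by (simp add: d5_endo_def)
  have sp: "f \<in> fspace (8 * m) \<Longrightarrow> e f \<in> fspace (8 * m)"
    and cE2: "f \<in> fspace (8 * m) \<Longrightarrow> e (dE2 m f) = dE2 m (e f)"
    and cE3: "f \<in> fspace (8 * m) \<Longrightarrow> e (dE3 m f) = dE3 m (e f)"
    and cA: "f \<in> fspace (8 * m) \<Longrightarrow> e (dA m f) = dA m (e f)"
    and cB: "f \<in> fspace (8 * m) \<Longrightarrow> e (dB m f) = dB m (e f)"
    and cG: "f \<in> fspace (8 * m) \<Longrightarrow> e (dG m f) = dG m (e f)" for f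
    using e by (simp_all add: d5_endo_def)
  have s0: "shift 0 m 0 = (0 :: nat \<Rightarrow> 'k)" by (rule flinD(3)[OF flin_shift])
  define \<epsilon> where "\<epsilon> x = blk m 7 (e (tup m 0 0 0 0 0 0 0 x))" for x
  \<comment> \<open>An endomorphism need not respect the grading by the cover, so components between
    different layers have to be tracked as well.\<close>
  define a where "a x = blk m 0 (e (tup m x 0 0 0 0 0 0 0))" for x
  define b where "b x = blk m 1 (e (tup m x 0 0 0 0 0 0 0))" for x
  define c where "c x = blk m 2 (e (tup m x 0 0 0 0 0 0 0))" for x
  define y where "y i x = blk m i (e (tup m 0 0 x 0 0 0 0 0))" for i x
  have [simp]: "\<epsilon> x \<in> fspace m" "a x \<in> fspace m" "b x \<in> fspace m" "c x \<in> fspace m" "y i x \<in> fspace m" for x i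
    by (simp_all add: \<epsilon>_def a_def b_def c_def y_def)
  have lin_\<epsilon>: "flin \<epsilon>"
    unfolding flin_def
  proof (intro conjI allI)
    show "\<epsilon> (f + g) = \<epsilon> f + \<epsilon> g" for f g
    proof -
      have "tup m 0 0 0 0 0 0 0 (f + g) = tup m 0 0 0 0 0 0 0 f + tup m 0 0 0 0 0 0 0 g" by (simp add: tup_add)
      then show ?thesis unfolding \<epsilon>_def by (simp only: flinD[OF lin] flinD[OF flin_blk])
    qed
    show "\<epsilon> (scl k f) = scl k (\<epsilon> f)" for k f
    proof -
      have "tup m 0 0 0 0 0 0 0 (scl k f) = scl k (tup m 0 0 0 0 0 0 0 f)" by (simp add: scl_tup)
      then show ?thesis unfolding \<epsilon>_def by (simp only: flinD[OF lin] flinD[OF flin_blk])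
    qed
  qed
  have W: "e (tup m 0 0 0 0 0 0 0 x) = tup m 0 0 0 0 0 0 0 (\<epsilon> x)" if "x \<in> fspace m" for x
  proof -
    have "e (tup m 0 0 0 0 0 0 0 x) = dE3 m (e (tup m 0 0 0 0 0 0 0 x))"
      using cE3[OF tup_fspace, of 0 0 0 0 0 0 0 x] that by (simp add: d_tup)
    then show ?thesis unfolding \<epsilon>_def dE3_def .
  qed
  have RU: "e (tup m 0 0 0 x x 0 0 0) = tup m 0 0 0 (\<epsilon> x) (\<epsilon> x) 0 0 0" if "x \<in> fspace m" for x
    using cG[OF tup_fspace, of 0 0 0 0 0 0 0 x] that by (simp add: d_tup W)
  have S: "\<exists>r u t. r \<in> fspace m \<and> u \<in> fspace m \<and> t \<in> fspace m \<and>
      e (tup m x 0 0 0 0 0 0 0) = tup m (a x) (b x) (c x) r u t 0 0" if "x \<in> fspace m" for x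
  proof -
    have "e (tup m x 0 0 0 0 0 0 0) = dE2 m (e (tup m x 0 0 0 0 0 0 0))"
      using cE2[OF tup_fspace, of x 0 0 0 0 0 0 0] that by (simp add: d_tup)
    then show ?thesis unfolding dE2_def a_def b_def c_def by (intro exI conjI) (assumption | rule blk_fspace)+
  qed
  have P: "\<exists>t. t \<in> fspace m \<and> e (tup m 0 x 0 0 0 0 0 0) = tup m 0 (a x) 0 (b x) (c x) t 0 0"
    if x: "x \<in> fspace m" for x
  proof -
    obtain r u t where *: "r \<in> fspace m" "u \<in> fspace m" "t \<in> fspace m"
      "e (tup m x 0 0 0 0 0 0 0) = tup m (a x) (b x) (c x) r u t 0 0" using S[OF x] by blast
    have "e (tup m 0 x 0 0 0 0 0 0) = tup m 0 (a x) 0 (b x) (c x) (u - shift 0 m r) 0 0"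
      using cB[OF tup_fspace, of x 0 0 0 0 0 0 0] x * by (simp add: d_tup s0)
    then show ?thesis using * by (metis fspace_closed(5) shift_fspace_self)
  qed
  have V: "e (tup m 0 0 0 0 0 0 x 0) = tup m 0 0 0 0 0 0 (a x) 0" if x: "x \<in> fspace m" for x
  proof -
    obtain t where t: "t \<in> fspace m" "e (tup m 0 x 0 0 0 0 0 0) = tup m 0 (a x) 0 (b x) (c x) t 0 0"
      using P[OF x] by blast
    show ?thesis using cA[OF tup_fspace, of 0 x 0 0 0 0 0 0] x t by (simp add: d_tup)
  qed
  have R: "e (tup m 0 0 0 x 0 0 0 0) = tup m 0 0 0 (a x) 0 (c x - shift 0 m (b x)) 0 0" if x: "x \<in> fspace m" for x
  proof -
    obtain t where t: "t \<in> fspace m" "e (tup m 0 x 0 0 0 0 0 0) = tup m 0 (a x) 0 (b x) (c x) t 0 0"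
      using P[OF x] by blast
    show ?thesis using cB[OF tup_fspace, of 0 x 0 0 0 0 0 0] x t by (simp add: d_tup s0)
  qed
  have Q: "\<exists>r u t. r \<in> fspace m \<and> u \<in> fspace m \<and> t \<in> fspace m \<and>
      e (tup m 0 0 x 0 0 0 0 0) = tup m (y 0 x) (y (Suc 0) x) (y 2 x) r u t 0 0" if "x \<in> fspace m" for x
  proof -
    have "e (tup m 0 0 x 0 0 0 0 0) = dE2 m (e (tup m 0 0 x 0 0 0 0 0))"
      using cE2[OF tup_fspace, of 0 0 x 0 0 0 0 0] that by (simp add: d_tup)
    then show ?thesis unfolding dE2_def y_def One_nat_def
      by (intro exI conjI) (assumption | rule blk_fspace)+
  qed
  have U: "\<exists>t. t \<in> fspace m \<and> e (tup m 0 0 0 0 x 0 0 0) = tup m 0 (y 0 x) 0 (y (Suc 0) x) (y 2 x) t 0 0"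
    if x: "x \<in> fspace m" for x
  proof -
    obtain r u t where *: "r \<in> fspace m" "u \<in> fspace m" "t \<in> fspace m"
      "e (tup m 0 0 x 0 0 0 0 0) = tup m (y 0 x) (y (Suc 0) x) (y 2 x) r u t 0 0" using Q[OF x] by blast
    have "e (tup m 0 0 0 0 x 0 0 0) = tup m 0 (y 0 x) 0 (y (Suc 0) x) (y 2 x) (u - shift 0 m r) 0 0"
      using cB[OF tup_fspace, of 0 0 x 0 0 0 0 0] x * by (simp add: d_tup s0)
    then show ?thesis using * by (metis fspace_closed(5) shift_fspace_self)
  qed
  \<comment> \<open>\<alpha> kills the block q, hence also its image under \<open>e\<close>.\<close>
  have y1: "y (Suc 0) x = 0" if x: "x \<in> fspace m" for x
  proof -
    obtain r u t where *: "r \<in> fspace m" "u \<in> fspace m" "t \<in> fspace m"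
      "e (tup m 0 0 x 0 0 0 0 0) = tup m (y 0 x) (y (Suc 0) x) (y 2 x) r u t 0 0" using Q[OF x] by blast
    have "e (tup m 0 0 0 0 0 0 0 0) = tup m 0 0 0 0 0 0 (y (Suc 0) x) 0"
      using cA[OF tup_fspace, of 0 0 x 0 0 0 0 0] x * by (simp add: d_tup)
    then have "tup m 0 0 0 0 0 0 (y (Suc 0) x) 0 = tup m 0 0 0 0 0 0 0 0"
      by (simp add: tup_zero flinD(3)[OF lin])
    then show ?thesis using tup_inject by fastforce
  qed
  \<comment> \<open>The image of \<gamma> is the diagonal of the blocks r and u. Comparing
    \<open>e\<close> there with the sum of its values on r and on u forces the diagonal components
    to agree with \<open>\<epsilon>\<close>.\<close>
  have aq: "a x = \<epsilon> x \<and> y 2 x = \<epsilon> x \<and> y 0 x = 0" if x: "x \<in> fspace m" for x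
  proof -
    obtain t where t: "t \<in> fspace m" "e (tup m 0 0 0 0 x 0 0 0) = tup m 0 (y 0 x) 0 (y (Suc 0) x) (y 2 x) t 0 0"
      using U[OF x] by blast
    have "tup m 0 0 0 0 x 0 0 0 + tup m 0 0 0 x 0 0 0 0 = tup m 0 0 0 x x 0 0 0"
      by (simp add: tup_add)
    then have "e (tup m 0 0 0 0 x 0 0 0) + e (tup m 0 0 0 x 0 0 0 0) = tup m 0 0 0 (\<epsilon> x) (\<epsilon> x) 0 0 0"
      using RU[OF x] by (metis flinD(1)[OF lin])
    then have "tup m 0 (y 0 x) 0 (a x) (y 2 x) (t + (c x - shift 0 m (b x))) 0 0 = tup m 0 0 0 (\<epsilon> x) (\<epsilon> x) 0 0 0"
      unfolding t(2) R[OF x] y1[OF x] by (simp add: tup_add)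
    from tup_inject[OF this] show ?thesis using t(1) by simp
  qed
  have T: "e (tup m 0 0 0 0 0 x 0 0) = tup m 0 0 0 0 0 (\<epsilon> x) 0 0" if x: "x \<in> fspace m" for x
  proof -
    obtain t where t: "t \<in> fspace m" "e (tup m 0 0 0 0 x 0 0 0) = tup m 0 (y 0 x) 0 (y (Suc 0) x) (y 2 x) t 0 0"
      using U[OF x] by blast
    show ?thesis
      using cB[OF tup_fspace, of 0 0 0 0 x 0 0 0] x t y1[OF x] aq[OF x] by (simp add: d_tup s0)
  qed
  \<comment> \<open>\<beta> maps the block r to t by minus the Jordan block, and \<open>e\<close>
    acts diagonally by \<open>\<epsilon>\<close> on both.\<close>
  have J: "\<epsilon> (shift 0 m x) = shift 0 m (\<epsilon> x)" if x: "x \<in> fspace m" for x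
  proof -
    have "e (tup m 0 0 0 0 0 (0 - shift 0 m x) 0 0) = tup m 0 0 0 0 0 (0 - shift 0 m (a x)) 0 0"
      using cB[OF tup_fspace, of 0 0 0 x 0 0 0 0] x R[OF x] by (simp add: d_tup s0)
    then have "tup m 0 0 0 0 0 (\<epsilon> (0 - shift 0 m x)) 0 0 = tup m 0 0 0 0 0 (0 - shift 0 m (a x)) 0 0"
      using T[of "0 - shift 0 m x"] by simp
    from tup_inject[OF this] have "\<epsilon> (0 - shift 0 m x) = 0 - shift 0 m (a x)" by simp
    then show ?thesis using aq[OF x] flin_diff[OF lin_\<epsilon>, of 0 "shift 0 m x"] by (simp add: flinD(3)[OF lin_\<epsilon>])
  qed
  \<comment> \<open>When \<open>\<epsilon>\<close> vanishes, so do all diagonal components, and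
    \<open>e\<close> moves every layer of s, (p, q), (r, u), t strictly to the right; v and w are
    killed. Four applications exhaust the layers.\<close>
  have nil: "e (e (e (e f))) = 0" if z: "\<forall>x\<in>fspace m. \<epsilon> x = 0" and f: "f \<in> fspace (8 * m)" for f
  proof -
    have zero: "\<epsilon> x = 0" "a x = 0" "y 2 x = 0" "y 0 x = 0" "y (Suc 0) x = 0" if "x \<in> fspace m" for x
      using z aq[OF that] y1[OF that] that by auto
    have 4: "e (tup m 0 0 0 0 0 t 0 0) = 0" if "t \<in> fspace m" for t
      using T[OF that] zero[OF that] by (simp add: tup_zero)
    have 3: "\<exists>t'. t' \<in> fspace m \<and> e (tup m 0 0 0 r u t 0 0) = tup m 0 0 0 0 0 t' 0 0"
      if r: "r \<in> fspace m" and u: "u \<in> fspace m" and t: "t \<in> fspace m" for r u t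
    proof -
      obtain t1 where t1: "t1 \<in> fspace m" "e (tup m 0 0 0 0 u 0 0 0) = tup m 0 0 0 0 0 t1 0 0"
        using U[OF u] unfolding zero[OF u] by blast
      have eq: "tup m 0 0 0 r u t 0 0 = tup m 0 0 0 r 0 0 0 0 + tup m 0 0 0 0 u 0 0 0 + tup m 0 0 0 0 0 t 0 0"
        by (simp add: tup_add)
      have "e (tup m 0 0 0 r u t 0 0) = tup m 0 0 0 0 0 (c r - shift 0 m (b r) + t1) 0 0"
        unfolding eq flinD(1)[OF lin] R[OF r] t1(2) T[OF t] zero[OF r] zero[OF t] by (simp add: tup_add)
      then show ?thesis using t1(1) by (intro exI[of _ "c r - shift 0 m (b r) + t1"]) simp
    qed
    have 2: "\<exists>r' u' t'. r' \<in> fspace m \<and> u' \<in> fspace m \<and> t' \<in> fspace m \<and>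
        e (tup m 0 p q r u t 0 0) = tup m 0 0 0 r' u' t' 0 0"
      if p: "p \<in> fspace m" and q: "q \<in> fspace m" and rut: "r \<in> fspace m" "u \<in> fspace m" "t \<in> fspace m" for p q r u t
    proof -
      obtain t1 where t1: "t1 \<in> fspace m" "e (tup m 0 p 0 0 0 0 0 0) = tup m 0 0 0 (b p) (c p) t1 0 0"
        using P[OF p] unfolding zero[OF p] by blast
      obtain r2 u2 t2 where t2: "r2 \<in> fspace m" "u2 \<in> fspace m" "t2 \<in> fspace m"
        "e (tup m 0 0 q 0 0 0 0 0) = tup m 0 0 0 r2 u2 t2 0 0"
        using Q[OF q] unfolding zero[OF q] by blast
      obtain t3 where t3: "t3 \<in> fspace m" "e (tup m 0 0 0 r u t 0 0) = tup m 0 0 0 0 0 t3 0 0"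
        using 3[OF rut] by blast
      have eq: "tup m 0 p q r u t 0 0 = tup m 0 p 0 0 0 0 0 0 + tup m 0 0 q 0 0 0 0 0 + tup m 0 0 0 r u t 0 0"
        by (simp add: tup_add)
      have "e (tup m 0 p q r u t 0 0) = tup m 0 0 0 (b p + r2) (c p + u2) (t1 + t2 + t3) 0 0"
        unfolding eq flinD(1)[OF lin] t1(2) t2(4) t3(2) by (simp add: tup_add)
      then show ?thesis using t1 t2 t3
        by (intro exI[of _ "b p + r2"] exI[of _ "c p + u2"] exI[of _ "t1 + t2 + t3"]) simp
    qed
    have 1: "\<exists>p' q' r' u' t'. p' \<in> fspace m \<and> q' \<in> fspace m \<and> r' \<in> fspace m \<and> u' \<in> fspace m \<and> t' \<in> fspace m \<and>
        e (tup m s p q r u t v w) = tup m 0 p' q' r' u' t' 0 0"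
      if s: "s \<in> fspace m" and pqrut: "p \<in> fspace m" "q \<in> fspace m" "r \<in> fspace m" "u \<in> fspace m" "t \<in> fspace m"
        and v: "v \<in> fspace m" and w: "w \<in> fspace m" for s p q r u t v w
    proof -
      obtain r1 u1 t1 where t1: "r1 \<in> fspace m" "u1 \<in> fspace m" "t1 \<in> fspace m"
        "e (tup m s 0 0 0 0 0 0 0) = tup m 0 (b s) (c s) r1 u1 t1 0 0"
        using S[OF s] unfolding zero[OF s] by blast
      obtain r2 u2 t2 where t2: "r2 \<in> fspace m" "u2 \<in> fspace m" "t2 \<in> fspace m"
        "e (tup m 0 p q r u t 0 0) = tup m 0 0 0 r2 u2 t2 0 0"
        using 2[OF pqrut] by blast
      have eq: "tup m s p q r u t v w = tup m s 0 0 0 0 0 0 0 + tup m 0 p q r u t 0 0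
          + tup m 0 0 0 0 0 0 v 0 + tup m 0 0 0 0 0 0 0 w"
        by (simp add: tup_add)
      have "e (tup m s p q r u t v w) = tup m 0 (b s) (c s) (r1 + r2) (u1 + u2) (t1 + t2) 0 0"
        unfolding eq flinD(1)[OF lin] t1(4) t2(4) V[OF v] W[OF w] zero[OF v] zero[OF w] by (simp add: tup_add)
      then show ?thesis using t1 t2
        by (intro exI[of _ "b s"] exI[of _ "c s"] exI[of _ "r1 + r2"] exI[of _ "u1 + u2"] exI[of _ "t1 + t2"]) simp
    qed
    obtain p q r u t where f1: "p \<in> fspace m" "q \<in> fspace m" "r \<in> fspace m" "u \<in> fspace m" "t \<in> fspace m"
      "e f = tup m 0 p q r u t 0 0"
      using 1[OF blk_fspace blk_fspace blk_fspace blk_fspace blk_fspace blk_fspace blk_fspace blk_fspace,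
          of 0 f 1 f 2 f 3 f 4 f 5 f 6 f 7 f]
      unfolding tup_blk[OF f] by blast
    obtain r' u' t' where f2: "r' \<in> fspace m" "u' \<in> fspace m" "t' \<in> fspace m"
      "e (e f) = tup m 0 0 0 r' u' t' 0 0"
      using 2[OF f1(1-5)] unfolding f1(6) by blast
    obtain t'' where f3: "t'' \<in> fspace m" "e (e (e f)) = tup m 0 0 0 0 0 t'' 0 0"
      using 3[OF f2(1-3)] unfolding f2(4) by blast
    show ?thesis using 4[OF f3(1)] f3(2) by simp
  qed
  show ?thesis
    by (intro exI[of _ \<epsilon>] conjI allI ballI impI) (simp_all add: lin_\<epsilon> W J nil)
qed

text \<open>\<open>\<epsilon>\<close> is an idempotent commuting with the Jordan block, hence 0 or
  the identity. If it is 0, then e = e^4 = 0; otherwise the same reasoning applies to 1 - e.\<close>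

lemma d5_indecomposable:
  fixes e :: "(nat \<Rightarrow> 'k::field) \<Rightarrow> nat \<Rightarrow> 'k"
  assumes m: "0 < m" and e: "d5_endo m e" and idem: "\<And>f. f \<in> fspace (8 * m) \<Longrightarrow> e (e f) = e f"
  shows "(\<forall>f\<in>fspace (8 * m). e f = 0) \<or> (\<forall>f\<in>fspace (8 * m). e f = f)"
proof -
  have lin: "flin e" using e by (simp add: d5_endo_def)
  have sp: "f \<in> fspace (8 * m) \<Longrightarrow> e f \<in> fspace (8 * m)" for f using e by (simp add: d5_endo_def)
  obtain \<epsilon> where \<epsilon>: "flin \<epsilon>" "\<forall>x. \<epsilon> x \<in> fspace m"
    "\<forall>x\<in>fspace m. e (tup m 0 0 0 0 0 0 0 x) = tup m 0 0 0 0 0 0 0 (\<epsilon> x)"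
    "\<forall>x\<in>fspace m. \<epsilon> (shift 0 m x) = shift 0 m (\<epsilon> x)"
    "(\<forall>x\<in>fspace m. \<epsilon> x = 0) \<longrightarrow> (\<forall>f\<in>fspace (8 * m). e (e (e (e f))) = 0)"
    using d5_endo_structure[OF e] by (elim exE conjE)
  have "\<epsilon> (\<epsilon> x) = \<epsilon> x" if x: "x \<in> fspace m" for x
  proof -
    have "tup m 0 0 0 0 0 0 0 (\<epsilon> (\<epsilon> x)) = tup m 0 0 0 0 0 0 0 (\<epsilon> x)"
      using idem[OF tup_fspace, of 0 0 0 0 0 0 0 x] \<epsilon>(2,3) x by simp
    from tup_inject[OF this] show ?thesis using \<epsilon>(2) by simp
  qed
  with jordan_block_idempotent[OF m \<epsilon>(1)] \<epsilon>(2,4)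
  have "(\<forall>x\<in>fspace m. \<epsilon> x = 0) \<or> (\<forall>x\<in>fspace m. \<epsilon> x = x)" by simp
  then show ?thesis
  proof
    assume "\<forall>x\<in>fspace m. \<epsilon> x = 0"
    then have "e (e (e (e f))) = 0" if "f \<in> fspace (8 * m)" for f using \<epsilon>(5) that by blast
    then show ?thesis using idem sp by simp
  next
    assume id: "\<forall>x\<in>fspace m. \<epsilon> x = x"
    define e' where "e' f = f - e f" for f
    have lin': "flin e'"
      by (auto simp: e'_def flin_def flinD[OF lin] scl_distrib algebra_simps fun_eq_iff fun_app)
    have idem': "e' (e' f) = e' f" if "f \<in> fspace (8 * m)" for f
      using that idem by (simp add: e'_def flin_diff[OF lin])
    have e': "d5_endo m e'"
      using e unfolding d5_endo_def
      by (auto simp: lin' e'_def flin_diff[OF flin_d(1)] flin_diff[OF flin_d(2)] flin_diff[OF flin_d(3)]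
          flin_diff[OF flin_d(4)] flin_diff[OF flin_d(5)] flin_diff[OF flin_d(6)])
    then have sp': "f \<in> fspace (8 * m) \<Longrightarrow> e' f \<in> fspace (8 * m)" for f by (simp add: d5_endo_def)
    obtain \<epsilon>' where \<epsilon>': "\<forall>x. \<epsilon>' x \<in> fspace m"
      "\<forall>x\<in>fspace m. e' (tup m 0 0 0 0 0 0 0 x) = tup m 0 0 0 0 0 0 0 (\<epsilon>' x)"
      "(\<forall>x\<in>fspace m. \<epsilon>' x = 0) \<longrightarrow> (\<forall>f\<in>fspace (8 * m). e' (e' (e' (e' f))) = 0)"
      using d5_endo_structure[OF e'] by (elim exE conjE)
    have "\<epsilon>' x = 0" if x: "x \<in> fspace m" for x
    proof -
      have "tup m 0 0 0 0 0 0 0 (\<epsilon>' x) = tup m 0 0 0 0 0 0 0 0"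
        using \<epsilon>'(2) \<epsilon>(3) id x by (simp add: e'_def tup_zero)
      from tup_inject[OF this] show ?thesis using \<epsilon>'(1) by simp
    qed
    then have "e' (e' (e' (e' f))) = 0" if "f \<in> fspace (8 * m)" for f using \<epsilon>'(3) that by blast
    then have "e' f = 0" if "f \<in> fspace (8 * m)" for f using that idem' sp' by simp
    then show ?thesis by (simp add: e'_def)
  qed
qed

lemma infinite_rep_type_shape:
  fixes I :: "(path \<Rightarrow> 'k::field) set"
  assumes I: "ideal I kQ" and J: "jset I = shape n n n W" and n: "4 \<le> n"
  shows "infinite_rep_type (Lam I) (Lam_scal I)"
  unfolding infinite_rep_type_def
proof (intro allI impI)
  fix F :: "((path \<Rightarrow> 'k) set, 'k) fdmod set"
  assume F: "finite F"
  obtain b where b: "\<And>N. N \<in> F \<Longrightarrow> fst N < b"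
    using finite_nat_set_iff_bounded[of "fst ` F"] F by auto
  \<comment> \<open>Makes 8m exceed every dimension occurring in \<open>F\<close>, so that
    isomorphism is excluded by dimension alone.\<close>
  define m where "m = Suc b"
  have m: "0 < m" by (simp add: m_def)
  interpret R: quiver_rep "8 * m" "dE1 m" "dE2 m" "dE3 m" "dA m" "dB m" "dG m :: (nat \<Rightarrow> 'k) \<Rightarrow> nat \<Rightarrow> 'k"
    by (rule d5_quiver_rep)
  obtain M where M: "is_fdmod (Lam I) (Lam_scal I) M" "fst M = 8 * m"
    and ops: "\<And>f. f \<in> fspace (8 * m) \<Longrightarrow> op I M te1 f = dE1 m f"
    "\<And>f. f \<in> fspace (8 * m) \<Longrightarrow> op I M te2 f = dE2 m f" "\<And>f. f \<in> fspace (8 * m) \<Longrightarrow> op I M te3 f = dE3 m f"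
    "\<And>f. f \<in> fspace (8 * m) \<Longrightarrow> op I M ta f = dA m f" "\<And>f. f \<in> fspace (8 * m) \<Longrightarrow> op I M tb f = dB m f"
    "\<And>f. f \<in> fspace (8 * m) \<Longrightarrow> op I M tg f = dG m f"
  proof (rule R.module_exists[OF I J])
    show "(dB m ^^ n) f = 0" "dA m ((dB m ^^ n) f) = 0" "(dB m ^^ n) (dG m f) = 0" for f :: "nat \<Rightarrow> 'k"
      by (simp_all add: dB_pow4[OF n] flinD[OF flin_d(4)])
  qed (rule that)
  have "indecomposable (Lam I) M"
    unfolding indecomposable_def
  proof (intro conjI allI impI)
    show "0 < fst M" using M m by simp
    fix E assume E: "is_mod_hom (Lam I) M M E \<and> E * E = E"
    then have c: "E \<in> carrier_mat (8 * m) (8 * m)" using M by (simp add: is_mod_hom_def)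
    have comm: "act E (op I M t f) = op I M t (act E f)" if "f \<in> fspace (8 * m)" for t f
      using is_mod_hom_iff_gens(1)[OF I M(1) M(1)] c E that M(2) by metis
    have Esp: "act E f \<in> fspace (8 * m)" for f by (rule act_fspace[OF c])
    have EE: "act E (act E f) = act E f" for f using act_mult[OF c c, of f] E by simp
    have "(\<forall>f\<in>fspace (8 * m). act E f = 0) \<or> (\<forall>f\<in>fspace (8 * m). act E f = f)"
    proof (rule d5_indecomposable[OF m])
      show "d5_endo m (act E)"
        unfolding d5_endo_def
      proof (intro conjI ballI flin_act Esp)
        fix f :: "nat \<Rightarrow> 'k" assume f: "f \<in> fspace (8 * m)"
        show "act E (dE1 m f) = dE1 m (act E f)" "act E (dE2 m f) = dE2 m (act E f)"
          "act E (dE3 m f) = dE3 m (act E f)" "act E (dA m f) = dA m (act E f)"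
          "act E (dB m f) = dB m (act E f)" "act E (dG m f) = dG m (act E f)"
          using comm[OF f, of te1] comm[OF f, of te2] comm[OF f, of te3] comm[OF f, of ta] comm[OF f, of tb]
            comm[OF f, of tg] by (simp_all add: ops f Esp)
      qed
    qed (rule EE)
    then show "E = 0\<^sub>m (fst M) (fst M) \<or> E = 1\<^sub>m (fst M)"
    proof
      assume "\<forall>f\<in>fspace (8 * m). act E f = 0"
      then have "E = 0\<^sub>m (8 * m) (8 * m)" by (intro mat_eq_actI[OF c]) (auto simp: act_zero)
      then show ?thesis using M by simp
    next
      assume "\<forall>f\<in>fspace (8 * m). act E f = f"
      then have "E = 1\<^sub>m (8 * m)" by (intro mat_eq_actI[OF c]) (auto simp: act_one)
      then show ?thesis using M by simp
    qed
  qed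
  moreover have "\<not> mod_iso (Lam I) M N" if "N \<in> F" for N
  proof
    assume "mod_iso (Lam I) M N"
    then obtain T S where TS: "is_mod_hom (Lam I) M N T" "is_mod_hom (Lam I) N M S" "S * T = 1\<^sub>m (fst M)"
      unfolding mod_iso_def by blast
    have "T \<in> carrier_mat (fst N) (8 * m)" "S \<in> carrier_mat (8 * m) (fst N)" "S * T = 1\<^sub>m (8 * m)"
      using TS M(2) by (simp_all add: is_mod_hom_def)
    then have "8 * m \<le> fst N" by (rule no_retract_smaller)
    then show False using b[OF that] by (simp add: m_def)
  qed
  ultimately show "\<exists>M. is_fdmod (Lam I) (Lam_scal I) M \<and> indecomposable (Lam I) M \<and> (\<forall>N\<in>F. \<not> mod_iso (Lam I) M N)"
    using M(1) by blast
qed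

theorem mainTheorem1:
  shows "(\<exists>I :: (path \<Rightarrow> 'k::field) set. admissible I \<and> HH1_vanishes (Lam I) (Lam_scal I)) \<and>
    (\<forall>I :: (path \<Rightarrow> 'k::field) set. admissible I \<longrightarrow>
        infinite_global_dimension (Lam I) (Lam_scal I)) \<and>
    (\<forall>I :: (path \<Rightarrow> 'k::field) set. admissible I \<and> HH1_vanishes (Lam I) (Lam_scal I) \<longrightarrow>
        infinite_rep_type (Lam I) (Lam_scal I))"
proof (intro conjI allI impI)
  show "\<exists>I :: (path \<Rightarrow> 'k) set. admissible I \<and> HH1_vanishes (Lam I) (Lam_scal I)"
  proof (intro exI conjI)
    show "admissible (iota ` shape 10 10 10 (rigid :: 'k poly set))"
      by (rule admissible_iota_shape[OF lin_closed_rigid _ monom_dvd_rigid]) simp_all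
  qed (rule HH1_vanishes_rigid)
next
  fix I :: "(path \<Rightarrow> 'k) set" assume adm: "admissible I"
  then have I: "ideal I kQ" by (simp add: admissible_def)
  obtain n m l W where "2 \<le> n" "1 \<le> l" "l \<le> n" "jset I = shape n m l W"
    using admissible_shape[OF adm] by metis
  then show "infinite_global_dimension (Lam I) (Lam_scal I)"
    using infinite_global_dimension_shape[OF I] by blast
next
  fix I :: "(path \<Rightarrow> 'k) set" assume I: "admissible I \<and> HH1_vanishes (Lam I) (Lam_scal I)"
  then obtain n W where "4 \<le> n" "jset I = shape n n n W"
    using HH1_vanishes_exponents by metis
  then show "infinite_rep_type (Lam I) (Lam_scal I)"
    using infinite_rep_type_shape I by (metis admissible_def)
qed

end
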